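(* Let $n\ge1$, $\beta>0$ and let $f\in L^2(\gamma)$ be a real-valued function on $\mathbb{R}^n$ with $\nabla f\in L^2(\gamma)$ such that $\gamma f^2$ is positive and twice differentiable and $\gamma f^2\in L^2(\gamma_\beta^{-1})$. When $\beta>1$, assume that $\gamma f^2$ is $\beta$-semi-log-subharmonic, and when $\beta<1$, assume that $\gamma f^2$ is $\beta$-semi-log-concave. Then $$\frac12\big(1+D_n(\beta)\big)\int_{\mathbb{R}^n}f^2\,d\gamma-\frac12\Big(\int_{\mathbb{R}^n}|f|\,d\gamma\Big)^2\le\int_{\mathbb{R}^n}|\nabla f|^2\,d\gamma,$$ where $$D_n(\beta)=\frac n2\Big(\log\beta-1+\frac1\beta\Big).$$
   Context: For $\beta>0$, $\gamma_\beta(x)=(2\pi\beta)^{-n/2}e^{-|x|^2/(2\beta)}$ on $\mathbb{R}^n$, $\gamma=\gamma_1$, $d\gamma=\gamma(x)\,dx$. $w\in L^2(\gamma_\beta^{-1})$ means $\int_{\mathbb{R}^n}w^2\gamma_\beta^{-1}\,dx<\infty$. A twice differentiable $w:\mathbb{R}^n\to(0,\infty)$ is $\beta$-semi-log-subharmonic if $\Delta\log w\ge-\frac n\beta$ on $\mathbb{R}^n$, and $\beta$-semi-log-concave if $\nabla^2\log w\le-\frac1\beta\,\mathrm{id}$ on $\mathbb{R}^n$. *)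

theory Defs
  imports "HOL-Analysis.Analysis"
begin

text \<open>The density \<open>\<gamma>\<^sub>\<beta>\<close> on \<open>\<real>\<^sup>n\<close>, where \<open>n = CARD('n)\<close>.\<close>

definition gauss :: "real \<Rightarrow> real ^ 'n \<Rightarrow> real" where
  "gauss \<beta> x = (2 * pi * \<beta>) powr (- (real CARD('n) / 2)) * exp (- ((norm x)\<^sup>2 / (2 * \<beta>)))"

definition weighted :: "(real ^ 'n \<Rightarrow> real) \<Rightarrow> (real ^ 'n) measure" where
  "weighted \<rho> = density lborel (\<lambda>x. ennreal (\<rho> x))"

abbreviation gauss_measure :: "(real ^ 'n) measure" where
  "gauss_measure \<equiv> weighted (gauss 1)"

definition L2 :: "'a measure \<Rightarrow> ('a \<Rightarrow> 'b::euclidean_space) set" where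
  "L2 M = {f. f \<in> borel_measurable M \<and> integrable M (\<lambda>x. (norm (f x))\<^sup>2)}"

text \<open>Classical derivatives. As with \<^const>\<open>frechet_derivative\<close>, the values are meaningful only
  where the function in question is differentiable.\<close>

definition grad :: "(real ^ 'n \<Rightarrow> real) \<Rightarrow> real ^ 'n \<Rightarrow> real ^ 'n" where
  "grad u x = (\<chi> i. frechet_derivative u (at x) (axis i 1))"

definition hessian :: "(real ^ 'n \<Rightarrow> real) \<Rightarrow> real ^ 'n \<Rightarrow> real ^ 'n ^ 'n" where
  "hessian u x = jacobian (grad u) (at x)"

definition laplacian :: "(real ^ 'n \<Rightarrow> real) \<Rightarrow> real ^ 'n \<Rightarrow> real" where
  "laplacian u x = trace (hessian u x)"

text \<open>No continuity of the second derivatives is required.\<close>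

definition twice_differentiable :: "(real ^ 'n \<Rightarrow> real) \<Rightarrow> bool" where
  "twice_differentiable u \<longleftrightarrow>
     (\<forall>x. u differentiable (at x)) \<and> (\<forall>x. grad u differentiable (at x))"

definition semi_log_subharmonic :: "real \<Rightarrow> (real ^ 'n \<Rightarrow> real) \<Rightarrow> bool" where
  "semi_log_subharmonic \<beta> w \<longleftrightarrow>
     (\<forall>x. w x > 0) \<and> twice_differentiable w \<and>
     (\<forall>x. laplacian (\<lambda>y. ln (w y)) x \<ge> - (real CARD('n) / \<beta>))"

definition semi_log_concave :: "real \<Rightarrow> (real ^ 'n \<Rightarrow> real) \<Rightarrow> bool" where
  "semi_log_concave \<beta> w \<longleftrightarrow>
     (\<forall>x. w x > 0) \<and> twice_differentiable w \<and>
     (\<forall>x v. v \<bullet> (hessian (\<lambda>y. ln (w y)) x *v v) \<le> - (1 / \<beta>) * (v \<bullet> v))"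

text \<open>The gradient of a function in \<open>L\<^sup>2(\<gamma>)\<close> is the weak (distributional) one, given here as a
  relation since it is determined only almost everywhere. Test functions are
  continuously differentiable with compact support, as in Gilbarg and Trudinger, Section 7.3;
  by mollification this agrees with testing against smooth functions.\<close>

definition test_function :: "(real ^ 'n \<Rightarrow> real) \<Rightarrow> bool" where
  "test_function \<phi> \<longleftrightarrow>
     (\<forall>x. \<phi> differentiable (at x)) \<and> continuous_on UNIV (grad \<phi>) \<and>
     compact (closure {x. \<phi> x \<noteq> 0})"

definition locally_integrable :: "(real ^ 'n \<Rightarrow> 'b::euclidean_space) \<Rightarrow> bool" where
  "locally_integrable f \<longleftrightarrow> (\<forall>K. compact K \<longrightarrow> set_integrable lborel K f)"

definition weak_gradient :: "(real ^ 'n \<Rightarrow> real) \<Rightarrow> (real ^ 'n \<Rightarrow> real ^ 'n) \<Rightarrow> bool" where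
  "weak_gradient f g \<longleftrightarrow>
     locally_integrable f \<and> locally_integrable g \<and>
     (\<forall>\<phi>. test_function \<phi> \<longrightarrow>
        (\<integral>x. f x *\<^sub>R grad \<phi> x \<partial>lborel) = - (\<integral>x. \<phi> x *\<^sub>R g x \<partial>lborel))"

definition D_const :: "nat \<Rightarrow> real \<Rightarrow> real" where
  "D_const n \<beta> = real n / 2 * (ln \<beta> - 1 + 1 / \<beta>)"

end

theory Submission
  imports Defs "HOL-Probability.Distributions"
begin

text \<open>Put \<open>w = \<gamma> f\<^sup>2\<close>, \<open>v = \<nabla> ln w\<close>, \<open>m = \<integral> w\<close> and let \<open>J = \<integral> \<bar>v\<bar>\<^sup>2 w\<close> be the
  Fisher information of \<open>w\<close>. In the deficit of the logarithmic Sobolev inequality for \<open>\<gamma>\<close> the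
  second moments of \<open>w\<close> cancel, leaving \<open>J / 2 - \<integral> w ln w\<close> up to constants. The logarithmic
  Sobolev inequality for \<open>\<gamma>\<^sub>\<beta>\<close> bounds \<open>\<beta> J / 2 - \<integral> w ln w\<close> from below, and the remaining
  term \<open>(1 - \<beta>) J / 2\<close> is at least \<open>(1 - \<beta>) n m / (2 \<beta>)\<close>: integrating by parts,
  \<open>J = - \<integral> w \<Delta> ln w\<close>, which the hypothesis on \<open>w\<close> compares with \<open>n m / \<beta>\<close> in the right direction.
  This yields the inequality with \<open>m - (\<integral> \<bar>f\<bar> d\<gamma>)\<^sup>2\<close> replaced by the entropy of \<open>f\<^sup>2\<close>, which is larger
  by Jensen's inequality.

  As \<open>\<Delta> ln w\<close> need not be locally integrable, the integration by parts rests on a bisection argument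
  in the style of Goursat. The logarithmic Sobolev inequality is obtained by cutting \<open>\<gamma>\<^sub>\<beta>\<close> into
  many short Gaussian steps, on each of which Taylor expansion of the entropy suffices.\<close>

subsection \<open>Continuously differentiable functions and their gradients\<close>

text \<open>Three features of the hypotheses shape the proof. The function f may change sign and has
  only a weak gradient, but w > 0 is C^1, so h = |f| is a positive C^1 function, and it suffices
  that |grad h| <= |Df| almost everywhere. The second derivatives of w exist everywhere but may be
  discontinuous, so the divergence theorem is proved for everywhere differentiable fields, in the
  form of an inequality that starts from a one-sided bound on the divergence. Finally, the L^2
  condition with weight 1 / \<open>\<gamma>\<^sub>\<beta>\<close> says that F = w /
  \<open>\<gamma>\<^sub>\<beta>\<close> is square integrable for
  \<open>\<gamma>\<^sub>\<beta>\<close>; this makes the second moment of w finite and, with the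
  finite energy of h, also J, so that |v + t x|^2 can be expanded and integrated against w term by
  term. The two parts of D_n have separate origins: (n/2) ln \<beta> is the logarithm of the ratio
  of the normalising constants of \<gamma> and \<open>\<gamma>\<^sub>\<beta>\<close>, and (n/2)
  (1/\<beta> - 1) is the lower bound for (1 - \<beta>) J / (2 m).\<close>

definition C1 :: "(real^'n \<Rightarrow> real) \<Rightarrow> (real^'n \<Rightarrow> real^'n) \<Rightarrow> bool" where
  "C1 f g \<longleftrightarrow> (\<forall>x. (f has_derivative (\<lambda>h. g x \<bullet> h)) (at x)) \<and> continuous_on UNIV g"

definition compact_C1 :: "(real^'n \<Rightarrow> real) \<Rightarrow> (real^'n \<Rightarrow> real^'n) \<Rightarrow> bool" where
  "compact_C1 f g \<longleftrightarrow> C1 f g \<and> (\<exists>R>0. \<forall>x. norm x > R \<longrightarrow> f x = 0)"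

lemma C1_D: "C1 f g \<Longrightarrow> (f has_derivative (\<lambda>h. g x \<bullet> h)) (at x)"
  by (simp add: C1_def)

lemma C1_continuous_grad: "C1 f g \<Longrightarrow> continuous_on UNIV g"
  by (simp add: C1_def)

lemma C1_continuous: "C1 f g \<Longrightarrow> continuous_on UNIV f"
  unfolding C1_def
  by (meson UNIV_I continuous_at_imp_continuous_on has_derivative_continuous)

lemma C1_isCont_grad: "C1 f g \<Longrightarrow> isCont g x"
  using C1_continuous_grad continuous_on_eq_continuous_at by blast

lemma C1_measurable:
  assumes "C1 f g"
  shows "f \<in> borel_measurable borel" "g \<in> borel_measurable borel"
  using C1_continuous[OF assms] C1_continuous_grad[OF assms]
  by (auto intro: borel_measurable_continuous_onI)

lemma has_derivative_grad_unique:
  fixes f :: "real^'n \<Rightarrow> real"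
  assumes "(f has_derivative (\<lambda>h. g \<bullet> h)) (at x)"
  shows "grad f x = g"
proof -
  have "frechet_derivative f (at x) = (\<lambda>h. g \<bullet> h)"
    using assms frechet_derivative_at by metis
  then show ?thesis
    by (simp add: grad_def vec_eq_iff inner_axis)
qed

lemma C1_grad: "C1 f g \<Longrightarrow> grad f = g"
  by (rule ext, rule has_derivative_grad_unique, rule C1_D)

lemma differentiable_has_derivative_grad:
  fixes f :: "real^'n \<Rightarrow> real"
  assumes "f differentiable (at x)"
  shows "(f has_derivative (\<lambda>h. grad f x \<bullet> h)) (at x)"
proof -
  let ?D = "frechet_derivative f (at x)"
  have d: "(f has_derivative ?D) (at x)"
    using assms frechet_derivative_works by blast
  then have lin: "linear ?D"
    using has_derivative_linear by blast
  have "?D h = grad f x \<bullet> h" for h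
  proof -
    have "?D h = ?D (\<Sum>i\<in>UNIV. h $ i *\<^sub>R axis i 1)"
      using basis_expansion[of h] by (simp add: scalar_mult_eq_scaleR)
    also have "\<dots> = (\<Sum>i\<in>UNIV. h $ i * ?D (axis i 1))"
      by (simp add: linear_sum[OF lin] linear_cmul[OF lin])
    finally show ?thesis
      by (simp add: grad_def inner_vec_def mult.commute)
  qed
  then show ?thesis
    using d by (metis (no_types, lifting) ext)
qed

lemma twice_differentiable_C1:
  assumes "twice_differentiable f"
  shows "C1 f (grad f)"
proof -
  have "continuous_on UNIV (grad f)"
    using assms unfolding twice_differentiable_def
    by (meson differentiable_imp_continuous_within continuous_at_imp_continuous_on)
  then show ?thesis
    using assms differentiable_has_derivative_grad
    unfolding C1_def twice_differentiable_def by blast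
qed

lemma C1_const: "C1 (\<lambda>x. c) (\<lambda>x. 0)"
  by (simp add: C1_def)

lemma C1_add: "C1 f g \<Longrightarrow> C1 f' g' \<Longrightarrow> C1 (\<lambda>x. f x + f' x) (\<lambda>x. g x + g' x)"
  unfolding C1_def by (auto intro!: derivative_eq_intros continuous_intros simp: inner_add_left)

lemma C1_mult:
  "C1 f g \<Longrightarrow> C1 f' g' \<Longrightarrow> C1 (\<lambda>x. f x * f' x) (\<lambda>x. f x *\<^sub>R g' x + f' x *\<^sub>R g x)"
  using C1_continuous[of f g] C1_continuous[of f' g']
  unfolding C1_def
  by (auto intro!: derivative_eq_intros continuous_intros simp: inner_add_left)

lemma C1_prod:
  assumes "\<And>i. i \<in> I \<Longrightarrow> \<exists>g. C1 (f i) g"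
  shows "\<exists>g. C1 (\<lambda>x. \<Prod>i\<in>I. f i x) g"
  using assms
proof (induction I rule: infinite_finite_induct)
  case (insert i I)
  obtain g where "C1 (f i) g" using insert.prems by blast
  moreover obtain g' where "C1 (\<lambda>x. \<Prod>i\<in>I. f i x) g'" using insert by blast
  ultimately have "C1 (\<lambda>x. f i x * (\<Prod>i\<in>I. f i x)) (\<lambda>x. f i x *\<^sub>R g' x + (\<Prod>i\<in>I. f i x) *\<^sub>R g x)"
    by (rule C1_mult)
  then show ?case using insert by auto
qed (auto intro: C1_const)

text \<open>Continuity of \<open>\<psi>'\<close> is asked on the range of \<open>f\<close>, so that
  the logarithm can be composed with a positive function.\<close>

lemma C1_compose:
  assumes f: "C1 f g" and d: "\<And>x. (\<psi> has_real_derivative \<psi>' (f x)) (at (f x))"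
    and c: "continuous_on (range f) \<psi>'"
  shows "C1 (\<lambda>x. \<psi> (f x)) (\<lambda>x. \<psi>' (f x) *\<^sub>R g x)"
proof -
  have "((\<lambda>x. \<psi> (f x)) has_derivative (\<lambda>h. (\<psi>' (f x) *\<^sub>R g x) \<bullet> h)) (at x)" for x
    using has_derivative_compose[OF C1_D[OF f] d[of x, unfolded has_field_derivative_def]]
    by simp
  moreover have "continuous_on UNIV (\<lambda>x. \<psi>' (f x))"
    using continuous_on_compose[OF C1_continuous[OF f]] c by (simp add: o_def)
  ultimately show ?thesis
    using C1_continuous_grad[OF f] unfolding C1_def by (intro conjI allI continuous_on_scaleR)
qed

lemma C1_affine:
  assumes "C1 f g"
  shows "C1 (\<lambda>x. f (c *\<^sub>R x + a)) (\<lambda>x. c *\<^sub>R g (c *\<^sub>R x + a))"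
proof -
  have "((\<lambda>x. f (c *\<^sub>R x + a)) has_derivative (\<lambda>h. (c *\<^sub>R g (c *\<^sub>R x + a)) \<bullet> h)) (at x)" for x
  proof -
    have "((\<lambda>x. c *\<^sub>R x + a) has_derivative (\<lambda>h. c *\<^sub>R h)) (at x)"
      by (auto intro!: derivative_eq_intros)
    from has_derivative_compose[OF this C1_D[OF assms]] show ?thesis
      by simp
  qed
  moreover have "continuous_on UNIV (\<lambda>x. g (c *\<^sub>R x + a))"
    using continuous_on_compose[of UNIV "\<lambda>x. c *\<^sub>R x + a" g] continuous_on_subset[OF C1_continuous_grad[OF assms]]
    by (simp add: o_def continuous_intros)
  ultimately show ?thesis
    unfolding C1_def by (intro conjI allI continuous_on_scaleR continuous_on_const)
qed

lemma C1_inner_const: "C1 (\<lambda>x. v \<bullet> x + a) (\<lambda>x. v)"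
  unfolding C1_def by (auto intro!: derivative_eq_intros)

lemma C1_norm_sq: "C1 (\<lambda>x. (norm x)\<^sup>2) (\<lambda>x. 2 *\<^sub>R x)"
  unfolding C1_def power2_norm_eq_inner
  by (auto intro!: derivative_eq_intros continuous_intros simp: inner_commute)

lemma C1_lipschitz_on:
  assumes f: "C1 f g" and S: "convex S" "x \<in> S" "y \<in> S" and b: "\<And>z. z \<in> S \<Longrightarrow> norm (g z) \<le> L"
  shows "\<bar>f y - f x\<bar> \<le> L * norm (y - x)"
proof -
  have "onorm (\<lambda>h. g z \<bullet> h) \<le> L" if "z \<in> S" for z
  proof (rule onorm_le)
    fix h show "norm (g z \<bullet> h) \<le> L * norm h"
      using Cauchy_Schwarz_ineq2[of "g z" h] mult_right_mono[OF b[OF that] norm_ge_zero[of h]] by simp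
  qed
  then have "norm (f y - f x) \<le> L * norm (y - x)"
    by (intro differentiable_bound[OF S(1), of f "\<lambda>z h. g z \<bullet> h"])
       (use S(2,3) has_derivative_at_withinI[OF C1_D[OF f]] in auto)
  then show ?thesis by simp
qed

lemma C1_lipschitz: "C1 f g \<Longrightarrow> (\<And>x. norm (g x) \<le> L) \<Longrightarrow> \<bar>f y - f x\<bar> \<le> L * norm (y - x)"
  by (rule C1_lipschitz_on[of f g UNIV]) auto

lemma C1_difference_quotient:
  assumes f: "C1 f g" and t: "t \<longlonglongrightarrow> 0" "\<And>k. t k > (0::real)"
  shows "(\<lambda>k. (f (x + t k *\<^sub>R e) - f x) / t k) \<longlonglongrightarrow> g x \<bullet> e"
proof -
  have "((\<lambda>s. x + s *\<^sub>R e) has_derivative (\<lambda>s. s *\<^sub>R e)) (at 0)"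
    by (auto intro!: derivative_eq_intros)
  moreover have "(f has_derivative (\<lambda>h. g x \<bullet> h)) (at (x + 0 *\<^sub>R e))"
    using C1_D[OF f] by simp
  ultimately have "((\<lambda>s. f (x + s *\<^sub>R e)) has_derivative (\<lambda>s. g x \<bullet> (s *\<^sub>R e))) (at 0)"
    by (rule has_derivative_compose)
  then have "((\<lambda>s. f (x + s *\<^sub>R e)) has_real_derivative (g x \<bullet> e)) (at 0)"
    by (simp add: has_field_derivative_def mult_commute_abs mult.commute)
  then have "((\<lambda>s. (f (x + s *\<^sub>R e) - f x) / s) \<longlongrightarrow> g x \<bullet> e) (at 0)"
    by (simp add: has_field_derivative_iff)
  then show ?thesis
    by (rule filterlim_compose)
       (use t in \<open>auto simp: filterlim_at less_imp_neq[symmetric] intro!: always_eventually less_imp_neq[symmetric]\<close>)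
qed

text \<open>Near x the function agrees with the constant 0, and gradients are unique. This passes
  support conditions from a function to its gradient.\<close>

lemma C1_grad_zero_open:
  assumes "C1 f g" "open U" "\<And>y. y \<in> U \<Longrightarrow> f y = 0" "x \<in> U"
  shows "g x = 0"
proof -
  have "((\<lambda>x. 0) has_derivative (\<lambda>h. g x \<bullet> h)) (at x)"
    using has_derivative_transform_within_open[OF C1_D[OF assms(1)] assms(2,4), of "\<lambda>x. 0"] assms(3)
    by auto
  then have "grad (\<lambda>x. 0) x = g x"
    by (rule has_derivative_grad_unique)
  moreover have "grad (\<lambda>x. 0::real) x = 0"
    by (rule has_derivative_grad_unique) simp
  ultimately show ?thesis by simp
qed

lemma compact_C1_grad_zero:
  assumes "C1 f g" "\<And>x. norm x > R \<Longrightarrow> f x = 0" "norm x > R"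
  shows "g x = 0"
  by (rule C1_grad_zero_open[OF assms(1), of "{x. norm x > R}"])
     (use assms(2,3) in \<open>auto intro!: open_Collect_less continuous_intros\<close>)

lemma compact_C1_E:
  assumes "compact_C1 f g"
  obtains R where "R > 0" "\<And>x. norm x > R \<Longrightarrow> f x = 0" "\<And>x. norm x > R \<Longrightarrow> g x = 0"
  using assms compact_C1_grad_zero unfolding compact_C1_def by blast

lemma compact_C1_C1: "compact_C1 f g \<Longrightarrow> C1 f g"
  by (simp add: compact_C1_def)

lemma compact_C1_mult:
  "compact_C1 f g \<Longrightarrow> C1 f' g' \<Longrightarrow> compact_C1 (\<lambda>x. f x * f' x) (\<lambda>x. f x *\<^sub>R g' x + f' x *\<^sub>R g x)"
  using C1_mult unfolding compact_C1_def by fastforce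

lemma compact_C1_translate:
  assumes "compact_C1 f g"
  shows "compact_C1 (\<lambda>x. f (x + a)) (\<lambda>x. g (x + a))"
proof -
  obtain R where R: "R > 0" "\<And>x. norm x > R \<Longrightarrow> f x = 0"
    using assms compact_C1_E by blast
  have "f (x + a) = 0" if "norm x > R + norm a" for x
    using that norm_triangle_ineq4[of "x + a" a] by (intro R) auto
  moreover have "R + norm a > 0" using R by (simp add: add_pos_nonneg)
  ultimately show ?thesis
    using C1_affine[OF compact_C1_C1[OF assms], of 1 a] unfolding compact_C1_def by auto
qed

lemma compact_C1_test_function:
  assumes "compact_C1 f g"
  shows "test_function f"
proof -
  obtain R where R: "\<And>x. norm x > R \<Longrightarrow> f x = 0"
    using assms compact_C1_E by metis
  have "{x. f x \<noteq> 0} \<subseteq> cball 0 R"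
    using R by (force simp: not_less[symmetric])
  then have "bounded {x. f x \<noteq> 0}"
    using bounded_cball bounded_subset by blast
  then have "compact (closure {x. f x \<noteq> 0})"
    by (simp add: compact_closure)
  moreover note compact_C1_C1[OF assms]
  ultimately show ?thesis
    unfolding test_function_def
    using C1_grad C1_continuous_grad C1_D differentiable_def by metis
qed

lemma compact_support_integrable:
  fixes f :: "real^'n \<Rightarrow> 'b::euclidean_space"
  assumes "continuous_on UNIV f" "\<And>x. norm x > R \<Longrightarrow> f x = 0"
  shows "integrable lborel f"
proof -
  have "integrable lborel (\<lambda>x. indicator (cball 0 R) x *\<^sub>R f x)"
    by (intro borel_integrable_compact continuous_on_subset[OF assms(1)]) auto
  moreover have "(\<lambda>x. indicator (cball 0 R) x *\<^sub>R f x) = f"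
    using assms(2) by (force simp: indicator_def)
  ultimately show ?thesis by simp
qed

lemma compact_support_bounded:
  fixes f :: "real^'n \<Rightarrow> 'b::euclidean_space"
  assumes "continuous_on UNIV f" "\<And>x. norm x > R \<Longrightarrow> f x = 0"
  shows "\<exists>B>0. \<forall>x. norm (f x) \<le> B"
proof -
  have "bounded (f ` cball 0 R)"
    by (intro compact_imp_bounded compact_continuous_image continuous_on_subset[OF assms(1)]) auto
  then obtain B where B: "B > 0" "\<And>x. x \<in> cball 0 R \<Longrightarrow> norm (f x) \<le> B"
    by (auto simp: bounded_pos)
  have "norm (f x) \<le> B" for x
    using B assms(2)[of x] by (cases "norm x \<le> R") auto
  then show ?thesis using B(1) by blast
qed

lemma compact_C1_bounded:
  assumes "compact_C1 f g"
  shows "\<exists>B>0. \<forall>x. \<bar>f x\<bar> \<le> B \<and> norm (g x) \<le> B"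
proof -
  obtain R where R: "\<And>x. norm x > R \<Longrightarrow> f x = 0" "\<And>x. norm x > R \<Longrightarrow> g x = 0"
    using compact_C1_E[OF assms] by metis
  note C = compact_C1_C1[OF assms]
  obtain B where "B > 0" "\<And>x. norm (f x) \<le> B"
    using compact_support_bounded[OF C1_continuous[OF C] R(1)] by metis
  moreover obtain B' where "B' > 0" "\<And>x. norm (g x) \<le> B'"
    using compact_support_bounded[OF C1_continuous_grad[OF C] R(2)] by metis
  ultimately show ?thesis
    by (intro exI[of _ "max B B'"]) (auto simp: le_max_iff_disj)
qed

section \<open>Translation invariance and integration by parts\<close>

text \<open>No measurability is assumed: if f is not measurable, neither is its translate, and both
  integrals take the default value 0.\<close>

lemma lborel_integral_translate:
  fixes f :: "'a::euclidean_space \<Rightarrow> 'b::{banach, second_countable_topology}"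
  shows "(LBINT x. f (a + x)) = (LBINT x. f x)"
proof -
  have "(\<integral>x. f x \<partial>distr lborel borel ((+) a)) = (LBINT x. f (a + x))" if "f \<in> borel_measurable borel"
    using that by (intro integral_distr) auto
  moreover have "(\<lambda>x. f (a + x)) \<in> borel_measurable borel \<Longrightarrow> f \<in> borel_measurable borel"
    using measurable_compose[of "\<lambda>x. x - a" borel borel "\<lambda>x. f (a + x)" borel] by simp
  ultimately show ?thesis
    by (cases "f \<in> borel_measurable borel")
       (auto simp: lborel_distr_plus dest: borel_measurable_integrable intro!: not_integrable_integral_eq[THEN trans, OF _ not_integrable_integral_eq[symmetric]])
qed

lemma lborel_integrable_translate:
  fixes f :: "'a::euclidean_space \<Rightarrow> 'b::{banach, second_countable_topology}"
  assumes "integrable lborel f"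
  shows "integrable lborel (\<lambda>x. f (a + x))"
proof -
  have "integrable (distr lborel borel ((+) a)) f"
    using assms by (simp add: lborel_distr_plus)
  then show ?thesis
    by (rule integrable_distr[rotated]) simp
qed

text \<open>The directional derivative is a limit of difference quotients, each of integral 0 by
  translation invariance. The Lipschitz bound on a ball containing the shifted supports dominates
  them.\<close>

lemma integral_compact_C1_grad:
  assumes "compact_C1 f g"
  shows "(LBINT x. g x \<bullet> e) = 0"
proof -
  obtain R where R: "R > 0" "\<And>x. norm x > R \<Longrightarrow> f x = 0" "\<And>x. norm x > R \<Longrightarrow> g x = 0"
    using compact_C1_E[OF assms] by metis
  obtain B where B: "B > 0" "\<And>x. norm (g x) \<le> B"
    using compact_C1_bounded[OF assms] by blast
  note C = compact_C1_C1[OF assms]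
  have intf: "integrable lborel f"
    using compact_support_integrable C1_continuous[OF C] R(2) by blast
  define t :: "nat \<Rightarrow> real" where "t k = inverse (real (Suc k))" for k
  have t: "t k > 0" "t k \<le> 1" for k
    by (auto simp: t_def field_simps)
  have t0: "t \<longlonglongrightarrow> 0" unfolding t_def by (rule LIMSEQ_inverse_real_of_nat)
  define q where "q k x = (f (t k *\<^sub>R e + x) - f x) / t k" for k x
  have q0: "(LBINT x. q k x) = 0" for k
    using intf lborel_integrable_translate[OF intf, of "t k *\<^sub>R e"] lborel_integral_translate[of f "t k *\<^sub>R e"]
    by (simp add: q_def)
  have "(\<lambda>k. \<integral>x. q k x \<partial>lborel) \<longlonglongrightarrow> (LBINT x. g x \<bullet> e)"
  proof (rule integral_dominated_convergence[where w = "\<lambda>x. indicator (cball 0 (R + norm e)) x * (B * norm e)"])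
    show "(\<lambda>x. g x \<bullet> e) \<in> borel_measurable lborel"
      using C1_measurable[OF C] by simp
    show "q k \<in> borel_measurable lborel" for k
      using C1_measurable[OF C] unfolding q_def by simp
    show "integrable lborel (\<lambda>x::real^'a. indicator (cball 0 (R + norm e)) x * (B * norm e))"
      using borel_integrable_compact[of "cball 0 (R + norm e)" "\<lambda>x::real^'a. B * norm e"] by simp
    show "AE x in lborel. (\<lambda>k. q k x) \<longlonglongrightarrow> g x \<bullet> e"
      using C1_difference_quotient[OF C t0 t(1)] by (simp add: q_def add.commute)
    show "AE x in lborel. norm (q k x) \<le> indicator (cball 0 (R + norm e)) x * (B * norm e)" for k
    proof (rule AE_I2)
      fix x
      have te: "norm (t k *\<^sub>R e) \<le> norm e" using t[of k] by (simp add: mult_left_le_one_le)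
      show "norm (q k x) \<le> indicator (cball 0 (R + norm e)) x * (B * norm e)"
      proof (cases "norm x \<le> R + norm e")
        case True
        have "\<bar>f (t k *\<^sub>R e + x) - f x\<bar> \<le> B * norm (t k *\<^sub>R e)"
          using C1_lipschitz[OF C B(2), where x = x and y = "t k *\<^sub>R e + x"] by simp
        then show ?thesis using True t[of k]
          by (simp add: q_def field_simps)
      next
        case False
        have "norm x \<le> norm (t k *\<^sub>R e + x) + norm (t k *\<^sub>R e)"
          using norm_triangle_ineq4[of "t k *\<^sub>R e + x" "t k *\<^sub>R e"] by simp
        then have "f x = 0" "f (t k *\<^sub>R e + x) = 0"
          using False te R(1) norm_ge_zero[of e] by (intro R(2); linarith)+
        then show ?thesis using B(1) by (simp add: q_def)
      qed
    qed
  qed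
  then show ?thesis using q0 by (simp add: LIMSEQ_const_iff)
qed

lemma integration_by_parts:
  assumes u: "C1 u gu" and f: "compact_C1 f g"
  shows "(LBINT x. u x * (g x \<bullet> e)) = - (LBINT x. f x * (gu x \<bullet> e))"
proof -
  obtain R where R: "\<And>x. norm x > R \<Longrightarrow> f x = 0" "\<And>x. norm x > R \<Longrightarrow> g x = 0"
    using compact_C1_E[OF f] by metis
  note C = compact_C1_C1[OF f]
  note cont = C1_continuous[OF u] C1_continuous_grad[OF u] C1_continuous[OF C] C1_continuous_grad[OF C]
  have "integrable lborel (\<lambda>x. u x * (g x \<bullet> e))" "integrable lborel (\<lambda>x. f x * (gu x \<bullet> e))"
    by (rule compact_support_integrable[where R = R]; use R cont in \<open>auto intro!: continuous_intros\<close>)+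
  then show ?thesis
    using integral_compact_C1_grad[OF compact_C1_mult[OF f u], of e]
    by (simp add: inner_add_left)
qed

text \<open>Integration by parts in each coordinate, the i-th component of the field having gradient
  equal to row i of A. This exact case is what a differentiable field is compared with at the limit
  point of the bisection.\<close>

lemma integral_affine_inner_grad:
  fixes A :: "real^'n ^ 'n"
  assumes f: "compact_C1 f g"
  shows "(LBINT x. (a + A *v x) \<bullet> g x) = - (trace A * (LBINT x. f x))"
proof -
  obtain R where R: "\<And>x. norm x > R \<Longrightarrow> f x = 0" "\<And>x. norm x > R \<Longrightarrow> g x = 0"
    using compact_C1_E[OF f] by metis
  note C = compact_C1_C1[OF f]
  have i: "integrable lborel (\<lambda>x. (A $ i \<bullet> x + a $ i) * (g x \<bullet> axis i 1))" for i
    by (rule compact_support_integrable[where R = R])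
       (use R C1_continuous_grad[OF C] in \<open>auto intro!: continuous_intros\<close>)
  have "(LBINT x. (a + A *v x) \<bullet> g x)
      = (LBINT x. (\<Sum>i\<in>UNIV. (A $ i \<bullet> x + a $ i) * (g x \<bullet> axis i 1)))"
    by (rule Bochner_Integration.integral_cong)
       (auto simp: inner_vec_def[of "_ + _"] inner_axis matrix_vector_mult_def inner_vec_def[of "A $ _"] add.commute)
  also have "\<dots> = (\<Sum>i\<in>UNIV. \<integral>x. (A $ i \<bullet> x + a $ i) * (g x \<bullet> axis i 1) \<partial>lborel)"
    by (rule Bochner_Integration.integral_sum) (rule i)
  also have "\<dots> = (\<Sum>i\<in>UNIV. - (LBINT x. f x * (A $ i \<bullet> axis i 1)))"
    by (intro sum.cong refl integration_by_parts[OF C1_inner_const f])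
  finally show ?thesis
    by (simp add: inner_axis trace_def sum_negf sum_distrib_left mult.commute)
qed

section \<open>Cutoff functions from truncated squares\<close>

definition ppart_sq :: "real \<Rightarrow> real" where
  "ppart_sq t = (max 0 t)\<^sup>2"

lemma ppart_sq_deriv: "(ppart_sq has_real_derivative 2 * max 0 t) (at t)"
proof -
  consider "t > 0" | "t < 0" | "t = 0" by linarith
  then show ?thesis
  proof cases
    case 1
    have "((\<lambda>t. t\<^sup>2) has_real_derivative 2 * max 0 t) (at t)"
      using 1 by (auto intro!: derivative_eq_intros)
    then show ?thesis
      by (rule has_field_derivative_transform_within_open[where S = "{0<..}"])
         (use 1 in \<open>auto simp: ppart_sq_def\<close>)
  next
    case 2
    have "((\<lambda>t. 0) has_real_derivative 2 * max 0 t) (at t)"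
      using 2 by (auto intro!: derivative_eq_intros)
    then show ?thesis
      by (rule has_field_derivative_transform_within_open[where S = "{..<0}"])
         (use 2 in \<open>auto simp: ppart_sq_def\<close>)
  next
    case 3
    have "((\<lambda>h. ppart_sq h / h) \<longlongrightarrow> 0) (at 0)"
    proof (rule Lim_null_comparison)
      show "\<forall>\<^sub>F h in at 0. norm (ppart_sq h / h) \<le> \<bar>h\<bar>"
        by (rule always_eventually) (auto simp: ppart_sq_def max_def power2_eq_square)
      show "((\<lambda>h::real. \<bar>h\<bar>) \<longlongrightarrow> 0) (at 0)"
        by (rule tendsto_rabs_zero) (rule tendsto_ident_at)
    qed
    then show ?thesis using 3 by (simp add: has_field_derivative_iff ppart_sq_def)
  qed
qed

text \<open>The primitive of the hat function on [0, 2]: a C^1 step rising from 0 to 1 there.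
  Truncated squares are chosen because dilations act on them by scalars, which later yields the
  refinement equation of the splines.\<close>

definition smooth_step :: "real \<Rightarrow> real" where
  "smooth_step t = (ppart_sq t - 2 * ppart_sq (t - 1) + ppart_sq (t - 2)) / 2"

definition smooth_step' :: "real \<Rightarrow> real" where
  "smooth_step' t = max 0 t - 2 * max 0 (t - 1) + max 0 (t - 2)"

lemma smooth_step_deriv: "(smooth_step has_real_derivative smooth_step' t) (at t)"
proof -
  have "((\<lambda>t. ppart_sq (t - a)) has_real_derivative 2 * max 0 (t - a)) (at t)" for a
    using DERIV_chain2[OF ppart_sq_deriv, of "\<lambda>t. t - a" 1 t UNIV] DERIV_diff[OF DERIV_ident DERIV_const, of a t UNIV]
    by simp
  note * = this
  from DERIV_cdivide[OF DERIV_add[OF DERIV_diff[OF *[of 0] DERIV_cmult[OF *[of 1], of 2]] *[of 2]], of 2]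
  have "((\<lambda>t. (ppart_sq (t - 0) - 2 * ppart_sq (t - 1) + ppart_sq (t - 2)) / 2) has_real_derivative smooth_step' t) (at t)"
    by (rule DERIV_cong) (simp add: smooth_step'_def field_simps)
  then show ?thesis unfolding smooth_step_def by simp
qed

lemma smooth_step'_continuous: "continuous_on S smooth_step'"
  unfolding smooth_step'_def by (intro continuous_intros)

lemma smooth_step_le_0: "t \<le> 0 \<Longrightarrow> smooth_step t = 0"
  by (simp add: smooth_step_def ppart_sq_def)

lemma smooth_step_ge_2: "t \<ge> 2 \<Longrightarrow> smooth_step t = 1"
  by (simp add: smooth_step_def ppart_sq_def power2_eq_square algebra_simps)

lemma smooth_step'_bounds: "0 \<le> smooth_step' t" "smooth_step' t \<le> 1"
  by (auto simp: smooth_step'_def max_def)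

lemma smooth_step'_outside: "t \<le> 0 \<or> t \<ge> 2 \<Longrightarrow> smooth_step' t = 0"
  by (auto simp: smooth_step'_def max_def)

lemma smooth_step_mono: "s \<le> t \<Longrightarrow> smooth_step s \<le> smooth_step t"
  by (rule DERIV_nonneg_imp_nondecreasing[where f = smooth_step]) (use smooth_step_deriv smooth_step'_bounds in blast)+

lemma smooth_step_bounds: "0 \<le> smooth_step t" "smooth_step t \<le> 1"
  using smooth_step_mono[of "min t 0" t] smooth_step_mono[of t "max t 2"]
  by (auto simp: smooth_step_le_0 smooth_step_ge_2)

text \<open>The squared norm keeps the function differentiable at the origin. The step is completed
  at |x|^2 = 3 R^2, so the radius 2 R is a safe bound for the support.\<close>

definition cutoff :: "real \<Rightarrow> real^'n \<Rightarrow> real" where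
  "cutoff R x = 1 - smooth_step ((norm x)\<^sup>2 / R\<^sup>2 - 1)"

definition cutoff' :: "real \<Rightarrow> real^'n \<Rightarrow> real^'n" where
  "cutoff' R x = (- (2 * smooth_step' ((norm x)\<^sup>2 / R\<^sup>2 - 1) / R\<^sup>2)) *\<^sub>R x"

lemma cutoff_argument_ge_2:
  fixes y :: real
  assumes "R > 0" "y > 2 * R"
  shows "2 \<le> y\<^sup>2 / R\<^sup>2 - 1"
proof -
  have "(2 * R)\<^sup>2 \<le> y\<^sup>2" using assms by (intro power_mono) auto
  then have *: "4 * R\<^sup>2 \<le> y\<^sup>2" by (simp add: power_mult_distrib)
  have "R\<^sup>2 > 0" using assms by simp
  with * have "3 * R\<^sup>2 \<le> y\<^sup>2" by linarith
  then show ?thesis using \<open>R\<^sup>2 > 0\<close> by (simp add: le_diff_eq pos_le_divide_eq)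
qed

lemma cutoff_bounds: "0 \<le> cutoff R x" "cutoff R x \<le> 1"
  using smooth_step_bounds by (auto simp: cutoff_def)

lemma cutoff_eq_1: "norm x \<le> R \<Longrightarrow> cutoff R x = 1"
  unfolding cutoff_def
  by (subst smooth_step_le_0) (auto simp: divide_le_eq power_mono)

lemma cutoff_eq_0: "R > 0 \<Longrightarrow> norm x > 2 * R \<Longrightarrow> cutoff R x = 0"
  unfolding cutoff_def
  by (subst smooth_step_ge_2) (simp_all add: cutoff_argument_ge_2)

lemma cutoff'_eq_0:
  assumes "R > 0" "norm x < R \<or> norm x > 2 * R"
  shows "cutoff' R x = 0"
proof -
  have "(norm x)\<^sup>2 / R\<^sup>2 - 1 \<le> 0 \<or> (norm x)\<^sup>2 / R\<^sup>2 - 1 \<ge> 2"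
    using assms(2)
  proof
    assume "norm x < R"
    then show ?thesis using assms(1) power_mono[of "norm x" R 2] by (auto simp: divide_le_eq)
  next
    assume "norm x > 2 * R"
    then show ?thesis using assms(1) cutoff_argument_ge_2 by blast
  qed
  then show ?thesis by (simp add: cutoff'_def smooth_step'_outside)
qed

text \<open>Inside radius 2 R the factor x costs at most 2 R against 2 / R^2. The resulting order 1
  / R is what lets the cutoff errors disappear as R grows.\<close>

lemma cutoff'_bound:
  assumes "R > 0"
  shows "norm (cutoff' R x) \<le> 4 / R"
proof (cases "norm x \<le> 2 * R")
  case True
  have "norm (cutoff' R x) = 2 * smooth_step' ((norm x)\<^sup>2 / R\<^sup>2 - 1) / R\<^sup>2 * norm x"
    using smooth_step'_bounds(1) by (simp add: cutoff'_def)
  also have "\<dots> \<le> 2 * 1 / R\<^sup>2 * (2 * R)"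
    using True assms smooth_step'_bounds by (intro mult_mono divide_right_mono) auto
  finally show ?thesis using assms by (simp add: power2_eq_square)
qed (use assms in \<open>simp add: cutoff'_eq_0\<close>)

lemma compact_C1_cutoff:
  assumes "R > 0"
  shows "compact_C1 (cutoff R) (cutoff' R)"
proof -
  let ?n = "\<lambda>x::real^'a. (1 / R\<^sup>2) * (norm x)\<^sup>2 + - 1"
  let ?h = "\<lambda>x::real^'a. (1 / R\<^sup>2) *\<^sub>R (2 *\<^sub>R x) + ((norm x)\<^sup>2) *\<^sub>R 0 + 0"
  have "C1 ?n ?h"
    by (intro C1_add C1_mult C1_const C1_norm_sq)
  then have "C1 (\<lambda>x. 1 - smooth_step (?n x)) (\<lambda>x. (- smooth_step' (?n x)) *\<^sub>R ?h x)"
    by (rule C1_compose)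
       (auto intro!: derivative_eq_intros smooth_step_deriv smooth_step'_continuous continuous_intros)
  moreover have "(\<lambda>x. 1 - smooth_step (?n x)) = cutoff R"
    by (auto simp: cutoff_def)
  moreover have "(\<lambda>x. (- smooth_step' (?n x)) *\<^sub>R ?h x) = cutoff' R"
    by (auto simp: cutoff'_def)
  ultimately have "C1 (cutoff R) (cutoff' R :: real^'a \<Rightarrow> _)" by simp
  then show ?thesis
    unfolding compact_C1_def using cutoff_eq_0[OF assms] assms by (auto intro!: exI[of _ "2 * R"])
qed

subsection \<open>A divergence theorem for everywhere differentiable vector fields\<close>

text \<open>Products of quadratic B-splines play the part of the cubes in Goursat's argument: they are continuously
  differentiable, and each is a nonnegative combination of its translates at half the scale.\<close>

definition bspline :: "real \<Rightarrow> real" where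
  "bspline t = smooth_step t - smooth_step (t - 1)"

definition bspline' :: "real \<Rightarrow> real" where
  "bspline' t = smooth_step' t - smooth_step' (t - 1)"

lemma bspline_deriv: "(bspline has_real_derivative bspline' t) (at t)"
  unfolding bspline_def bspline'_def
  using DERIV_diff[OF smooth_step_deriv[of t] DERIV_chain2[OF smooth_step_deriv DERIV_diff[OF DERIV_ident DERIV_const[of 1]]]]
  by simp

lemma bspline'_continuous: "continuous_on S bspline'"
  unfolding bspline'_def smooth_step'_def by (intro continuous_intros)

lemma bspline_bounds: "0 \<le> bspline t" "bspline t \<le> 1"
  using smooth_step_mono[of "t - 1" t] smooth_step_bounds[of t] smooth_step_bounds[of "t - 1"]
  by (auto simp: bspline_def)

lemma bspline'_bound: "\<bar>bspline' t\<bar> \<le> 1"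
  using smooth_step'_bounds[of t] smooth_step'_bounds[of "t - 1"] by (auto simp: bspline'_def abs_if)

lemma bspline_outside: "t < 0 \<or> t > 3 \<Longrightarrow> bspline t = 0"
  by (auto simp: bspline_def smooth_step_le_0 smooth_step_ge_2)

text \<open>The binomial coefficients 1, 3, 3, 1 divided by 4, the subdivision mask of the quadratic
  B-spline.\<close>

definition refine_coeff :: "nat \<Rightarrow> real" where
  "refine_coeff k = (if k = 0 \<or> k = 3 then 1/4 else 3/4)"

lemma ppart_sq_scale: "c \<ge> 0 \<Longrightarrow> ppart_sq (c * t) = c\<^sup>2 * ppart_sq t"
  by (auto simp: ppart_sq_def max_def power_mult_distrib zero_le_mult_iff)

text \<open>Let z denote the shift by 1/2 and p the truncated square. The spline is (1 - z^2)^3 p /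
  2, while its half-scale copy is 2 (1 - z)^3 p because p(2 t) = 4 p(t). The factorisation (1 -
  z^2)^3 = (1 + z)^3 (1 - z)^3 leaves the mask (1 + z)^3 / 4.\<close>

lemma bspline_refine: "bspline t = (\<Sum>k<4. refine_coeff k * bspline (2 * t - real k))"
proof -
  have 4: "ppart_sq (2 * t - a) = 4 * ppart_sq (t - a / 2)" for a
    using ppart_sq_scale[of 2 "t - a / 2"] by (simp add: algebra_simps)
  have s: "{..<4} = {0, 1, 2, 3::nat}" by auto
  have e: "bspline (2 * t - a) = 2 * (ppart_sq (t - a / 2) - 3 * ppart_sq (t - (a + 1) / 2)
      + 3 * ppart_sq (t - (a + 2) / 2) - ppart_sq (t - (a + 3) / 2))" for a
  proof -
    have "2 * t - a - 1 = 2 * t - (a + 1)" "2 * t - a - 2 = 2 * t - (a + 2)"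
      "2 * t - (a + 1) - 1 = 2 * t - (a + 2)" "2 * t - (a + 1) - 2 = 2 * t - (a + 3)" by simp_all
    then show ?thesis
      unfolding bspline_def smooth_step_def by (simp only: 4) argo
  qed
  have "bspline t = (ppart_sq t - 3 * ppart_sq (t - 1) + 3 * ppart_sq (t - 2) - ppart_sq (t - 3)) / 2"
    unfolding bspline_def smooth_step_def by (simp, argo)
  then show ?thesis
    unfolding s using e[of 0] e[of 1] e[of 2] e[of 3] by (simp add: refine_coeff_def, argo)
qed

definition box_spline :: "real^'n \<Rightarrow> real \<Rightarrow> real^'n \<Rightarrow> real" where
  "box_spline y r x = (\<Prod>i\<in>UNIV. bspline ((x $ i - y $ i) / r))"

lemma box_spline_bounds: "0 \<le> box_spline y r x" "box_spline y r x \<le> 1"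
  unfolding box_spline_def by (auto intro!: prod_nonneg prod_le_1 bspline_bounds)

lemma box_spline_outside:
  assumes "r > 0" "x \<notin> cbox y (y + (\<chi> i. 3 * r))"
  shows "box_spline y r x = 0"
proof -
  obtain i where "x $ i < y $ i \<or> y $ i + 3 * r < x $ i"
    using assms(2) by (auto simp: mem_box_cart not_le)
  then have "bspline ((x $ i - y $ i) / r) = 0"
    using assms(1) by (intro bspline_outside) (auto simp: field_simps)
  then show ?thesis unfolding box_spline_def by (intro prod_zero) auto
qed

text \<open>In the product rule each of the n factors is differentiated once, at cost 1 / r, while
  the others stay in [0, 1]. The growth 1 / r is compensated later by a first-order Taylor remainder
  of size o(r).\<close>

lemma box_spline_C1_bound:
  fixes y :: "real^'n"
  assumes "r > 0"
  shows "\<exists>g. C1 (box_spline y r) g \<and> (\<forall>x. norm (g x) \<le> real CARD('n) / r)"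
proof -
  define b where "b i x = bspline ((x $ i - y $ i) / r)" for i and x :: "real^'n"
  have C: "C1 (b i) (\<lambda>x. bspline' ((x $ i - y $ i) / r) *\<^sub>R axis i (1 / r))" for i
  proof -
    have "C1 (\<lambda>x. axis i (1 / r) \<bullet> x + (- y $ i / r)) (\<lambda>x. axis i (1 / r))"
      by (rule C1_inner_const)
    from C1_compose[OF this bspline_deriv bspline'_continuous]
    show ?thesis unfolding b_def by (simp add: inner_axis' diff_divide_distrib)
  qed
  have "\<exists>g. C1 (\<lambda>x. \<Prod>i\<in>I. b i x) g \<and> (\<forall>x. norm (g x) \<le> real (card I) / r)" for I
  proof (induction I rule: infinite_finite_induct)
    case (insert i I)
    then obtain g where g: "C1 (\<lambda>x. \<Prod>i\<in>I. b i x) g" "\<And>x. norm (g x) \<le> real (card I) / r"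
      by blast
    let ?h = "\<lambda>x. b i x *\<^sub>R g x + (\<Prod>i\<in>I. b i x) *\<^sub>R (bspline' ((x $ i - y $ i) / r) *\<^sub>R axis i (1 / r))"
    have "norm (?h x) \<le> real (card (insert i I)) / r" for x
    proof -
      have 1: "\<bar>b i x\<bar> \<le> 1" for i using bspline_bounds[of "(x $ i - y $ i) / r"] unfolding b_def by simp
      have 2: "\<bar>\<Prod>i\<in>I. b i x\<bar> \<le> 1"
        unfolding abs_prod by (rule prod_le_1) (simp add: 1)
      have "norm (?h x) \<le> \<bar>b i x\<bar> * norm (g x) + \<bar>\<Prod>i\<in>I. b i x\<bar> * (\<bar>bspline' ((x $ i - y $ i) / r)\<bar> * (1 / r))"
        using assms by (intro norm_triangle_le) (simp add: norm_eq_sqrt_inner[of "axis i _"] inner_axis_axis real_sqrt_divide abs_mult)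
      also have "\<dots> \<le> 1 * (real (card I) / r) + 1 * (1 * (1 / r))"
        using assms by (intro add_mono mult_mono 1 2 g bspline'_bound) auto
      also have "\<dots> = real (card (insert i I)) / r"
        using insert by (simp add: add_divide_distrib)
      finally show ?thesis .
    qed
    then show ?case using C1_mult[OF C[of i] g(1)] insert by (auto simp del: card_insert_disjoint)
  qed (use assms C1_const in \<open>auto intro!: exI[of _ "\<lambda>x. 0"]\<close>)
  from this[of UNIV] show ?thesis
    unfolding b_def box_spline_def by simp
qed

lemma box_spline_refine:
  fixes y :: "real^'n"
  assumes "r > 0"
  shows "box_spline y r x = (\<Sum>k\<in>PiE UNIV (\<lambda>_. {..<4}).
           (\<Prod>i\<in>UNIV. refine_coeff (k i)) * box_spline (y + (\<chi> i. r / 2 * real (k i))) (r / 2) x)"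
proof -
  have "box_spline y r x = (\<Prod>i\<in>UNIV. \<Sum>k<4. refine_coeff k * bspline (2 * ((x $ i - y $ i) / r) - real k))"
    unfolding box_spline_def by (rule prod.cong[OF refl bspline_refine])
  also have "\<dots> = (\<Sum>k\<in>PiE UNIV (\<lambda>_. {..<4}). \<Prod>i\<in>UNIV. refine_coeff (k i) * bspline (2 * ((x $ i - y $ i) / r) - real (k i)))"
    by (rule prod_sum_PiE) auto
  also have "\<dots> = (\<Sum>k\<in>PiE UNIV (\<lambda>_. {..<4}).
      (\<Prod>i\<in>UNIV. refine_coeff (k i)) * box_spline (y + (\<chi> i. r / 2 * real (k i))) (r / 2) x)"
  proof -
    have "2 * ((x $ i - y $ i) / r) - real (k i) = (x $ i - (y + (\<chi> i. r / 2 * real (k i))) $ i) / (r / 2)" for i k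
      using assms by (simp add: field_simps)
    then show ?thesis
      by (simp only: box_spline_def prod.distrib)
  qed
  finally show ?thesis .
qed

text \<open>Each coordinate contributes 1/4 + 3/4 + 3/4 + 1/4 = 2. The total offsets the volume
  factor 2^-n of halving the scale, so a defect proportional to r^n passes to a child with the same
  constant.\<close>

lemma refine_coeff_sum:
  "(\<Sum>k\<in>PiE (UNIV::'n::finite set) (\<lambda>_. {..<4}). \<Prod>i\<in>UNIV. refine_coeff (k i)) = 2 ^ CARD('n)"
proof -
  have s: "{..<4} = {0, 1, 2, 3::nat}" by auto
  have "(\<Sum>k<4. refine_coeff k) = 2" unfolding s by (simp add: refine_coeff_def)
  then show ?thesis
    using prod_sum_PiE[of "UNIV::'n set" "\<lambda>_. {..<4}" "\<lambda>_. refine_coeff"] by simp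
qed

text \<open>In each coordinate the sum of consecutive splines telescopes to a difference of two
  steps, at x_i + m + 2 >= 2 and at x_i - m <= 0.\<close>

lemma box_spline_partition:
  fixes x :: "real^'n" and m :: nat
  assumes "\<And>i. \<bar>x $ i\<bar> \<le> real m"
  shows "(\<Sum>k\<in>PiE UNIV (\<lambda>_. {..<2 * m + 2}). box_spline (\<chi> i. real (k i) - real m - 2) 1 x) = 1"
proof -
  have "(\<Sum>k<2 * m + 2. bspline (x $ i - (real k - real m - 2))) = 1" for i
  proof -
    have "(\<Sum>k<N. bspline (x $ i - (real k - real m - 2)))
        = smooth_step (x $ i + real m + 2) - smooth_step (x $ i + real m + 2 - real N)" for N
      by (induction N) (auto simp: bspline_def algebra_simps)
    from this[of "2 * m + 2"] show ?thesis
      using assms[of i] by (simp add: smooth_step_ge_2 smooth_step_le_0 abs_le_iff)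
  qed
  then have "1 = (\<Prod>i\<in>UNIV. \<Sum>k<2 * m + 2. bspline ((x $ i - (real k - real m - 2)) / 1))" by simp
  also have "\<dots> = (\<Sum>k\<in>PiE UNIV (\<lambda>_. {..<2 * m + 2}). box_spline (\<chi> i. real (k i) - real m - 2) 1 x)"
    unfolding box_spline_def by (subst prod_sum_PiE) auto
  finally show ?thesis by simp
qed

text \<open>This is \<open>\<integral> (div V - c) \<psi>\<close> with the derivatives moved to \<open>\<psi>\<close>.\<close>

definition flux :: "(real^'n \<Rightarrow> real^'n) \<Rightarrow> real \<Rightarrow> (real^'n \<Rightarrow> real) \<Rightarrow> real" where
  "flux V c \<psi> = - (LBINT x. V x \<bullet> grad \<psi> x) - c * (LBINT x. \<psi> x)"

lemma compact_C1_sum: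
  assumes "finite I" "\<And>i. i \<in> I \<Longrightarrow> compact_C1 (f i) (g i)"
  shows "compact_C1 (\<lambda>x. \<Sum>i\<in>I. a i * f i x) (\<lambda>x. \<Sum>i\<in>I. a i *\<^sub>R g i x)"
  using assms
proof (induction I)
  case empty
  show ?case by (auto simp: compact_C1_def C1_const intro: exI[of _ 1])
next
  case (insert i I)
  then obtain R R' where R: "R > 0" "\<And>x. norm x > R \<Longrightarrow> f i x = 0"
      "\<And>x. norm x > R' \<Longrightarrow> (\<Sum>i\<in>I. a i * f i x) = 0"
    by (meson compact_C1_E insertCI)
  have "C1 (\<lambda>x. a i * f i x + (\<Sum>i\<in>I. a i * f i x)) (\<lambda>x. (a i *\<^sub>R g i x + f i x *\<^sub>R 0) + (\<Sum>i\<in>I. a i *\<^sub>R g i x))"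
    using insert by (intro C1_add C1_mult C1_const) (auto simp: compact_C1_def)
  moreover have "max R R' > 0 \<and> (\<forall>x. norm x > max R R' \<longrightarrow> a i * f i x + (\<Sum>i\<in>I. a i * f i x) = 0)"
    using R by auto
  ultimately show ?case using insert(1,2) unfolding compact_C1_def by auto
qed

lemma compact_C1_integrable:
  assumes "compact_C1 f g"
  shows "integrable lborel f"
  using compact_C1_E[OF assms] compact_support_integrable C1_continuous compact_C1_C1[OF assms] by metis

lemma compact_C1_flux_integrable:
  fixes V :: "real^'n \<Rightarrow> real^'n"
  assumes "compact_C1 f g" "continuous_on UNIV V"
  shows "integrable lborel (\<lambda>x. V x \<bullet> g x)"
proof -
  obtain R where "\<And>x. norm x > R \<Longrightarrow> g x = 0" using compact_C1_E[OF assms(1)] by metis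
  then show ?thesis
    using assms C1_continuous_grad[OF compact_C1_C1[OF assms(1)]]
    by (intro compact_support_integrable[of _ R]) (auto intro!: continuous_intros)
qed

lemma flux_sum:
  fixes V :: "real^'n \<Rightarrow> real^'n"
  assumes V: "continuous_on UNIV V" and I: "finite I" "\<And>i. i \<in> I \<Longrightarrow> compact_C1 (f i) (g i)"
  shows "flux V c (\<lambda>x. \<Sum>i\<in>I. a i * f i x) = (\<Sum>i\<in>I. a i * flux V c (f i))"
proof -
  have C: "compact_C1 (\<lambda>x. \<Sum>i\<in>I. a i * f i x) (\<lambda>x. \<Sum>i\<in>I. a i *\<^sub>R g i x)"
    by (rule compact_C1_sum[OF I])
  have gr: "grad (\<lambda>x. \<Sum>i\<in>I. a i * f i x) = (\<lambda>x. \<Sum>i\<in>I. a i *\<^sub>R g i x)"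
    by (rule C1_grad[OF compact_C1_C1[OF C]])
  have "(LBINT x. V x \<bullet> grad (\<lambda>x. \<Sum>i\<in>I. a i * f i x) x) = (LBINT x. (\<Sum>i\<in>I. a i * (V x \<bullet> g i x)))"
    by (simp only: gr inner_sum_right inner_scaleR_right)
  also have "\<dots> = (\<Sum>i\<in>I. a i * (LBINT x. V x \<bullet> g i x))"
    using compact_C1_flux_integrable[OF I(2) V] by (subst Bochner_Integration.integral_sum) auto
  also have "\<dots> = (\<Sum>i\<in>I. a i * (LBINT x. V x \<bullet> grad (f i) x))"
    by (intro sum.cong refl) (simp add: C1_grad[OF compact_C1_C1[OF I(2)]])
  finally have 1: "(LBINT x. V x \<bullet> grad (\<lambda>x. \<Sum>i\<in>I. a i * f i x) x)
      = (\<Sum>i\<in>I. a i * (LBINT x. V x \<bullet> grad (f i) x))" .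
  have 2: "(LBINT x. (\<Sum>i\<in>I. a i * f i x)) = (\<Sum>i\<in>I. a i * (LBINT x. f i x))"
    using compact_C1_integrable[OF I(2)] by (subst Bochner_Integration.integral_sum) auto
  show ?thesis
    unfolding flux_def 1 2
    by (simp add: sum_distrib_left sum_subtractf sum_negf algebra_simps)
qed

lemma compact_C1_mult_box_spline:
  assumes "compact_C1 f g" "r > 0"
  shows "\<exists>g'. compact_C1 (\<lambda>x. f x * box_spline y r x) g'"
  using box_spline_C1_bound[OF assms(2)] compact_C1_mult[OF assms(1)] by blast

text \<open>Bisection in the manner of Goursat, by contradiction. A partition of unity passes a
  negative flux to some spline of unit scale; refinement then yields nested cubes of scale r,
  tending to 0, on which the localised flux stays below - e r^n. At their common point x0 the field
  is affine up to o(|x - x0|). The affine part contributes (trace - c) times a nonnegative mass, and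
  the remainder at most o(r) (1 / r) r^n in absolute value, which is too small. Only
  differentiability at the single point x0 enters the final estimate, so no continuity of
  \<open>A\<close> is involved.\<close>

theorem flux_nonneg:
  fixes V :: "real^'n \<Rightarrow> real^'n" and A :: "real^'n \<Rightarrow> real^'n ^ 'n"
  assumes V: "\<And>x. (V has_derivative (\<lambda>h. A x *v h)) (at x)"
    and div: "\<And>x. trace (A x) \<ge> c"
    and \<phi>: "compact_C1 \<phi> g" "\<And>x. \<phi> x \<ge> 0"
  shows "flux V c \<phi> \<ge> 0"
proof (rule ccontr)
  assume neg: "\<not> 0 \<le> flux V c \<phi>"
  have Vc: "continuous_on UNIV V"
    by (rule continuous_at_imp_continuous_on) (use has_derivative_continuous[OF V] in blast)
  define J where "J y r = flux V c (\<lambda>x. \<phi> x * box_spline y r x)" for y r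
  let ?n = "CARD('n)"
  obtain R where R: "R > 0" "\<And>x. norm x > R \<Longrightarrow> \<phi> x = 0"
    using compact_C1_E[OF \<phi>(1)] by metis
  obtain B where B: "B > 0" "\<And>x. \<bar>\<phi> x\<bar> \<le> B" "\<And>x. norm (g x) \<le> B"
    using compact_C1_bounded[OF \<phi>(1)] by blast
  have start: "\<exists>y0. J y0 1 < 0"
  proof (rule ccontr)
    assume "\<not> ?thesis"
    then have nn: "J y 1 \<ge> 0" for y by (simp add: not_less)
    obtain m :: nat where m: "real m \<ge> R" using real_arch_simple by blast
    define I where "I = PiE (UNIV::'n set) (\<lambda>_. {..<2 * m + 2})"
    have fin: "finite I" unfolding I_def by (intro finite_PiE) auto
    define y where "y k = (\<chi> i::'n. real (k i) - real m - 2)" for k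
    have "\<exists>G. \<forall>k. compact_C1 (\<lambda>x. \<phi> x * box_spline (y k) 1 x) (G k)"
      by (intro choice allI compact_C1_mult_box_spline[OF \<phi>(1) zero_less_one])
    then obtain G where G: "\<And>k. compact_C1 (\<lambda>x. \<phi> x * box_spline (y k) 1 x) (G k)"
      by blast
    have "\<phi> x = (\<Sum>k\<in>I. 1 * (\<phi> x * box_spline (y k) 1 x))" for x
    proof (cases "norm x \<le> R")
      case True
      then have "\<bar>x $ i\<bar> \<le> real m" for i
        using component_le_norm_cart[of x i] m by linarith
      from box_spline_partition[OF this] show ?thesis
        unfolding I_def y_def by (simp add: sum_distrib_left[symmetric])
    qed (simp add: R(2))
    then have "flux V c \<phi> = flux V c (\<lambda>x. \<Sum>k\<in>I. 1 * (\<phi> x * box_spline (y k) 1 x))" by presburger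
    also have "\<dots> = (\<Sum>k\<in>I. 1 * J (y k) 1)"
      unfolding J_def by (rule flux_sum[OF Vc fin G])
    also have "\<dots> \<ge> 0" using nn by (intro sum_nonneg) simp
    finally show False using neg by simp
  qed
  then obtain y0 where y0: "J y0 1 < 0" by blast
  \<comment> \<open>Halving leaves room for the strict inequality that the bisection
    propagates.\<close>
  define e where "e = - J y0 1 / 2"
  have e: "e > 0" "J y0 1 < - e * 1 ^ ?n" using y0 by (auto simp: e_def)
  \<comment> \<open>If every child had flux at least - e (r/2)^n, the weights of total 2^n would
    give at least - e r^n for the parent. The bounds on y' make the supporting cubes, of sides 3 r /
    2 and 3 r, nested.\<close>
  have step: "\<exists>y'. (\<forall>i. y $ i \<le> y' $ i \<and> y' $ i \<le> y $ i + 3 * r / 2) \<and> J y' (r / 2) < - e * (r / 2) ^ ?n"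
    if r: "r > 0" and J: "J y r < - e * r ^ ?n" for y r
  proof (rule ccontr)
    assume con: "\<not> ?thesis"
    define I where "I = PiE (UNIV::'n set) (\<lambda>_. {..<4::nat})"
    have fin: "finite I" unfolding I_def by (intro finite_PiE) auto
    define a where "a k = (\<Prod>i\<in>UNIV. refine_coeff (k (i::'n)))" for k
    define z where "z k = y + (\<chi> i. r / 2 * real (k i))" for k
    have a: "a k \<ge> 0" for k unfolding a_def by (intro prod_nonneg) (auto simp: refine_coeff_def)
    have zJ: "J (z k) (r / 2) \<ge> - e * (r / 2) ^ ?n" if "k \<in> I" for k
    proof -
      have "k i < 4" for i using that PiE_mem[of k UNIV "\<lambda>_. {..<4}" i] by (simp add: I_def)
      then have "real (k i) \<le> 3" for i using nat_less_real_le[of "k i" 4] by fastforce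
      then have "\<forall>i. y $ i \<le> z k $ i \<and> z k $ i \<le> y $ i + 3 * r / 2"
        using r mult_left_mono[of _ 3 "r / 2"] by (auto simp: z_def)
      then show ?thesis using con not_less by blast
    qed
    have "\<exists>G. \<forall>k. compact_C1 (\<lambda>x. \<phi> x * box_spline (z k) (r / 2) x) (G k)"
      by (intro choice allI compact_C1_mult_box_spline[OF \<phi>(1) half_gt_zero[OF r]])
    then obtain G where G: "\<And>k. compact_C1 (\<lambda>x. \<phi> x * box_spline (z k) (r / 2) x) (G k)"
      by blast
    have "\<phi> x * box_spline y r x = (\<Sum>k\<in>I. a k * (\<phi> x * box_spline (z k) (r / 2) x))" for x
      unfolding box_spline_refine[OF r, of y x] I_def a_def z_def
      by (simp add: sum_distrib_left algebra_simps)
    then have "J y r = flux V c (\<lambda>x. \<Sum>k\<in>I. a k * (\<phi> x * box_spline (z k) (r / 2) x))"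
      unfolding J_def by simp
    also have "\<dots> = (\<Sum>k\<in>I. a k * J (z k) (r / 2))"
      unfolding J_def by (rule flux_sum[OF Vc fin G])
    also have "\<dots> \<ge> (\<Sum>k\<in>I. a k * (- e * (r / 2) ^ ?n))"
      by (intro sum_mono mult_left_mono zJ a)
    also have "(\<Sum>k\<in>I. a k * (- e * (r / 2) ^ ?n)) = - e * r ^ ?n"
      using refine_coeff_sum[where 'n = 'n]
      by (simp add: sum_distrib_right[symmetric] sum_divide_distrib[symmetric] a_def[symmetric] I_def[symmetric] power_divide sum_negf)
    finally show False using J by simp
  qed
  define r where "r j = (1 / 2 :: real) ^ j" for j :: nat
  have r: "r j > 0" "r j \<le> 1" "r (Suc j) = r j / 2" for j
    by (auto simp: r_def power_le_one)
  have "\<exists>y. \<forall>j. J (y j) (r j) < - e * r j ^ ?n \<and>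
          (\<forall>i. y j $ i \<le> y (Suc j) $ i \<and> y (Suc j) $ i \<le> y j $ i + 3 * r j / 2)"
  proof (rule dependent_nat_choice)
    show "\<exists>y. J y (r 0) < - e * r 0 ^ ?n" using e by (auto simp: r_def)
    show "\<exists>y'. J y' (r (Suc j)) < - e * r (Suc j) ^ ?n \<and> (\<forall>i. y $ i \<le> y' $ i \<and> y' $ i \<le> y $ i + 3 * r j / 2)"
      if "J y (r j) < - e * r j ^ ?n" for y j
      using step[OF r(1) that] unfolding r(3) by blast
  qed
  then obtain y where yJ: "\<And>j. J (y j) (r j) < - e * r j ^ ?n"
    and y: "\<And>j i. y j $ i \<le> y (Suc j) $ i" "\<And>j i. y (Suc j) $ i \<le> y j $ i + 3 * r j / 2"
    by blast
  define Q where "Q j = cbox (y j) (y j + (\<chi> i. 3 * r j))" for j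
  have "Q (Suc j) \<subseteq> Q j" for j
  proof
    fix x assume x: "x \<in> Q (Suc j)"
    have "y j $ i \<le> x $ i \<and> x $ i \<le> y j $ i + 3 * r j" for i
    proof -
      have "y (Suc j) $ i \<le> x $ i" "x $ i \<le> y (Suc j) $ i + 3 * (r j / 2)"
        using x unfolding Q_def r(3) by (auto simp: mem_box_cart)
      then show ?thesis using y[of j i] by simp
    qed
    then show "x \<in> Q j" by (auto simp: Q_def mem_box_cart)
  qed
  then have "Q m \<subseteq> Q j" if "j \<le> m" for j m
    using that by (rule lift_Suc_antimono_le)
  moreover have "compact (Q j)" "Q j \<noteq> {}" for j
  proof -
    have "y j \<in> Q j" using r(1)[of j] by (auto simp: Q_def mem_box_cart less_imp_le)
    then show "Q j \<noteq> {}" by blast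
  qed (simp add: Q_def)
  ultimately have "\<Inter>(range Q) \<noteq> {}" by (intro compact_nest)
  then obtain x0 where x0: "\<And>j. x0 \<in> Q j" by blast
  have dist: "norm (x - x0) \<le> 3 * real ?n * r j" if "x \<in> Q j" for x j
  proof -
    have "\<bar>(x - x0) $ i\<bar> \<le> 3 * r j" for i
    proof -
      have "y j $ i \<le> x $ i" "x $ i \<le> y j $ i + 3 * r j" "y j $ i \<le> x0 $ i" "x0 $ i \<le> y j $ i + 3 * r j"
        using that x0[of j] by (auto simp: Q_def mem_box_cart)
      then show ?thesis by (simp add: abs_le_iff)
    qed
    then have "(\<Sum>i\<in>UNIV. \<bar>(x - x0) $ i\<bar>) \<le> (\<Sum>i\<in>(UNIV::'n set). 3 * r j)" by (rule sum_mono)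
    then show ?thesis using norm_le_l1_cart[of "x - x0"] by simp
  qed
  \<comment> \<open>The product of the constants in the final estimate: 3 n for the distance to x0,
    (n + 1) B for the gradient of the localised test function, 3^n for the volume. With Taylor
    accuracy e / K the remainder is exactly e r^n.\<close>
  define K where "K = 3 * real ?n * ((real ?n + 1) * B) * 3 ^ ?n"
  have K: "K > 0" using B(1) by (simp add: K_def)
  have "\<exists>d>0. \<forall>x. norm (x - x0) < d \<longrightarrow> norm (V x - V x0 - A x0 *v (x - x0)) \<le> e / K * norm (x - x0)"
    using V[of x0] divide_pos_pos[OF e(1) K] unfolding has_derivative_at_alt by blast
  then obtain d where d: "d > 0"
    "\<And>x. norm (x - x0) < d \<Longrightarrow> norm (V x - V x0 - A x0 *v (x - x0)) \<le> e / K * norm (x - x0)" by blast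
  have "(\<lambda>j. 3 * real ?n * r j) \<longlonglongrightarrow> 3 * real ?n * 0"
    unfolding r_def by (intro tendsto_intros LIMSEQ_power_zero) simp
  then have "\<forall>\<^sub>F j in sequentially. 3 * real ?n * r j < d"
    using d(1) by (intro order_tendstoD(2)) auto
  then obtain j where j: "3 * real ?n * r j < d"
    using eventually_happens' sequentially_bot by blast
  define \<psi> where "\<psi> x = \<phi> x * box_spline (y j) (r j) x" for x
  obtain gb where gb: "C1 (box_spline (y j) (r j)) gb" "\<And>x. norm (gb x) \<le> real ?n / r j"
    using box_spline_C1_bound[OF r(1)] by blast
  define G where "G x = \<phi> x *\<^sub>R gb x + box_spline (y j) (r j) x *\<^sub>R g x" for x
  have CG: "compact_C1 \<psi> G"
    unfolding \<psi>_def[abs_def] G_def[abs_def] by (rule compact_C1_mult[OF \<phi>(1) gb(1)])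
  have G0: "G x = 0" if "x \<notin> Q j" for x
  proof (rule C1_grad_zero_open[OF compact_C1_C1[OF CG], of "- Q j"])
    show "open (- Q j)" by (simp add: Q_def open_Compl closed_cbox)
    show "\<psi> z = 0" if "z \<in> - Q j" for z
      using box_spline_outside[OF r(1), of z "y j" j] that unfolding \<psi>_def Q_def by simp
  qed (use that in simp)
  have Gb: "norm (G x) \<le> (real ?n + 1) * B / r j" for x
  proof -
    have "norm (G x) \<le> \<bar>\<phi> x\<bar> * norm (gb x) + \<bar>box_spline (y j) (r j) x\<bar> * norm (g x)"
      unfolding G_def by (intro norm_triangle_le) simp
    also have "\<dots> \<le> B * (real ?n / r j) + 1 * B"
      using box_spline_bounds[of "y j" "r j" x] B(1) by (intro add_mono mult_mono B gb) auto
    \<comment> \<open>Since r <= 1, the term without a factor 1 / r can be absorbed.\<close>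
    also have "\<dots> \<le> B * (real ?n / r j) + B / r j"
      using r[of j] B(1) by (simp add: pos_le_divide_eq mult_le_cancel_left1)
    finally show ?thesis by (simp add: algebra_simps add_divide_distrib)
  qed
  define E where "E x = V x - V x0 - A x0 *v (x - x0)" for x
  have Ec: "continuous_on UNIV E"
    unfolding E_def
    by (intro continuous_intros Vc linear_continuous_on_compose[of UNIV "\<lambda>x. x - x0" "\<lambda>h. A x0 *v h"] matrix_vector_mul_linear)
  define a where "a = V x0 - A x0 *v x0"
  have aff: "V x = (a + A x0 *v x) + E x" for x
    by (simp add: E_def a_def matrix_vector_mult_diff_distrib)
  have iE: "integrable lborel (\<lambda>x. E x \<bullet> G x)"
    by (rule compact_C1_flux_integrable[OF CG Ec])
  have "continuous_on UNIV (\<lambda>x. a + A x0 *v x)"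
    by (intro continuous_intros linear_continuous_on_compose[of UNIV "\<lambda>x. x" "\<lambda>h. A x0 *v h"] matrix_vector_mul_linear)
  then have iA: "integrable lborel (\<lambda>x. (a + A x0 *v x) \<bullet> G x)"
    by (rule compact_C1_flux_integrable[OF CG])
  have "(LBINT x. V x \<bullet> G x) = - (trace (A x0) * (LBINT x. \<psi> x)) + (LBINT x. E x \<bullet> G x)"
    unfolding aff inner_add_left[of "_ + _" "E _"]
    using iE iA integral_affine_inner_grad[OF CG, of a "A x0"] by simp
  then have J: "J (y j) (r j) = (trace (A x0) - c) * (LBINT x. \<psi> x) - (LBINT x. E x \<bullet> G x)"
    unfolding J_def flux_def \<psi>_def[abs_def, symmetric] C1_grad[OF compact_C1_C1[OF CG]]
    by (simp add: algebra_simps)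
  have "(LBINT x. \<psi> x) \<ge> 0"
    unfolding \<psi>_def by (intro integral_nonneg_AE AE_I2 mult_nonneg_nonneg \<phi>(2) box_spline_bounds)
  then have J1: "J (y j) (r j) \<ge> - (LBINT x. E x \<bullet> G x)"
    unfolding J using div[of x0] by simp
  define M where "M = e / K * (3 * real ?n * r j) * ((real ?n + 1) * B / r j)"
  have "(LBINT x. E x \<bullet> G x) \<le> (LBINT x. indicator (Q j) x * M)"
  proof (rule integral_mono[OF iE])
    show "integrable lborel (\<lambda>x. indicator (Q j) x * M)"
      using borel_integrable_compact[of "Q j" "\<lambda>_. M"] by (simp add: Q_def)
    show "E x \<bullet> G x \<le> indicator (Q j) x * M" for x
    proof (cases "x \<in> Q j")
      case True
      have "norm (E x) \<le> e / K * norm (x - x0)"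
        unfolding E_def using d(2)[of x] dist[OF True] j by simp
      also have "\<dots> \<le> e / K * (3 * real ?n * r j)"
        using dist[OF True] e(1) K by (intro mult_left_mono) auto
      finally have "norm (E x) * norm (G x) \<le> M"
        unfolding M_def using e(1) K r(1)[of j] by (intro mult_mono Gb) auto
      then show ?thesis using True norm_cauchy_schwarz[of "E x" "G x"] by simp
    qed (simp add: G0)
  qed
  also have "\<dots> = (3 * r j) ^ ?n * M"
  proof -
    have "cbox (y j) (y j + (\<chi> i. 3 * r j)) \<noteq> {}" using x0[of j] by (auto simp: Q_def)
    then have "measure lborel (Q j) = (3 * r j) ^ ?n"
      unfolding Q_def by (simp add: content_cbox_cart)
    then show ?thesis by (simp add: Q_def)
  qed
  also have "\<dots> = e * r j ^ ?n"
  proof -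
    have "M = e / K * (3 * real ?n * ((real ?n + 1) * B))"
      unfolding M_def using r(1)[of j] by simp
    then have "(3 * r j) ^ ?n * M = e / K * K * r j ^ ?n"
      unfolding K_def power_mult_distrib by (simp only: mult_ac times_divide_eq_left times_divide_eq_right)
    then show ?thesis using K by simp
  qed
  finally show False using J1 yJ[of j] by simp
qed

subsection \<open>Testing pointwise inequalities\<close>

text \<open>K is covered by finitely many balls of radius r, and 1 - \<phi> is the product of the
  complements of the cutoffs at their centres. It vanishes as soon as one cutoff is 1 and equals 1
  where all of them vanish.\<close>

lemma compact_smooth_bump:
  fixes K :: "(real^'n) set"
  assumes "compact K" "r > 0"
  obtains \<phi> g where "compact_C1 \<phi> g" "\<And>x. 0 \<le> \<phi> x" "\<And>x. \<phi> x \<le> 1" "\<And>x. x \<in> K \<Longrightarrow> \<phi> x = 1"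
    "\<And>x. \<phi> x \<noteq> 0 \<Longrightarrow> \<exists>y\<in>K. dist x y \<le> 2 * r"
proof -
  have "K \<subseteq> (\<Union>c\<in>K. ball c r)" using assms(2) by auto
  then obtain D where D: "D \<subseteq> K" "finite D" "K \<subseteq> (\<Union>c\<in>D. ball c r)"
    using compactE_image[OF assms(1), of K "\<lambda>c. ball c r"] by auto
  define \<phi> where "\<phi> x = 1 - (\<Prod>c\<in>D. 1 - cutoff r (x - c))" for x
  have "\<exists>g. C1 (\<lambda>x. 1 - cutoff r (x - c)) g" for c :: "real^'n"
  proof -
    have "C1 (\<lambda>x::real^'n. cutoff r (1 *\<^sub>R x + (- c))) (\<lambda>x. 1 *\<^sub>R cutoff' r (1 *\<^sub>R x + (- c)))"
      by (intro C1_affine compact_C1_C1 compact_C1_cutoff assms)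
    from C1_add[OF C1_const C1_mult[OF C1_const this], of 1 "-1"] show ?thesis by auto
  qed
  then obtain g where "C1 (\<lambda>x. \<Prod>c\<in>D. 1 - cutoff r (x - c)) g"
    using C1_prod[of D "\<lambda>c x. 1 - cutoff r (x - c)"] by blast
  from C1_add[OF C1_const C1_mult[OF C1_const this], of 1 "-1"]
  obtain G where G: "C1 \<phi> G" unfolding \<phi>_def[abs_def] by auto
  have near: "\<exists>y\<in>K. dist x y \<le> 2 * r" if "\<phi> x \<noteq> 0" for x
  proof (rule ccontr)
    assume "\<not> ?thesis"
    then have "norm (x - c) > 2 * r" if "c \<in> D" for c
      using D(1) that by (force simp: dist_norm)
    then have "(\<Prod>c\<in>D. 1 - cutoff r (x - c)) = 1"
      using cutoff_eq_0[OF assms(2)] by (intro prod.neutral) auto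
    then show False using that by (simp add: \<phi>_def)
  qed
  obtain R where R: "R > 0" "\<And>y. y \<in> K \<Longrightarrow> norm y \<le> R"
    using compact_imp_bounded[OF assms(1)] by (auto simp: bounded_pos)
  have "\<phi> x = 0" if "norm x > R + 2 * r" for x
  proof (rule ccontr)
    assume "\<phi> x \<noteq> 0"
    then obtain y where "y \<in> K" "dist x y \<le> 2 * r" using near by blast
    then show False using R(2)[of y] that norm_triangle_ineq2[of x y] by (simp add: dist_norm)
  qed
  moreover have "R + 2 * r > 0" using R assms by simp
  ultimately have "compact_C1 \<phi> G" unfolding compact_C1_def using G by blast
  moreover have "0 \<le> \<phi> x" "\<phi> x \<le> 1" for x
  proof -
    have "0 \<le> (\<Prod>c\<in>D. 1 - cutoff r (x - c))" "(\<Prod>c\<in>D. 1 - cutoff r (x - c)) \<le> 1"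
      using cutoff_bounds[of r] by (auto intro!: prod_nonneg prod_le_1)
    then show "0 \<le> \<phi> x" "\<phi> x \<le> 1" by (auto simp: \<phi>_def)
  qed
  moreover have "\<phi> x = 1" if xK: "x \<in> K" for x
  proof -
    obtain c where c: "c \<in> D" "x \<in> ball c r" using D(3) xK by blast
    then have "norm (x - c) \<le> r" by (simp add: dist_norm norm_minus_commute)
    then have "(\<Prod>c\<in>D. 1 - cutoff r (x - c)) = 0"
      using D(2) c(1) cutoff_eq_1[of "x - c" r] by (intro prod_zero) auto
    then show ?thesis by (simp add: \<phi>_def)
  qed
  ultimately show ?thesis using near that by blast
qed

lemma locally_integrable_compact_support:
  fixes q :: "real^'n \<Rightarrow> 'b::euclidean_space"
  assumes "locally_integrable q" and \<psi>: "continuous_on UNIV \<psi>" "\<And>x. norm x > R \<Longrightarrow> \<psi> x = 0"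
  shows "integrable lborel (\<lambda>x. \<psi> x *\<^sub>R q x)"
proof -
  have "set_integrable lborel (cball 0 R) q"
    using assms(1) unfolding locally_integrable_def by simp
  then have i: "integrable lborel (\<lambda>x. indicator (cball 0 R) x *\<^sub>R q x)"
    by (simp add: set_integrable_def)
  obtain B where B: "B > 0" "\<And>x. norm (\<psi> x) \<le> B"
    using compact_support_bounded[OF \<psi>] by blast
  have "integrable lborel (\<lambda>x. \<psi> x *\<^sub>R (indicator (cball 0 R) x *\<^sub>R q x))"
  proof (rule Bochner_Integration.integrable_bound[OF integrable_scaleR_right[OF i, of B]])
    have "\<psi> \<in> borel_measurable borel" by (rule borel_measurable_continuous_onI[OF \<psi>(1)])
    then show "(\<lambda>x. \<psi> x *\<^sub>R (indicator (cball 0 R) x *\<^sub>R q x)) \<in> borel_measurable lborel"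
      using borel_measurable_integrable[OF i] by (auto intro!: borel_measurable_scaleR simp del: scaleR_scaleR)
    show "AE x in lborel. norm (\<psi> x *\<^sub>R (indicator (cball 0 R) x *\<^sub>R q x)) \<le> norm (B *\<^sub>R (indicator (cball 0 R) x *\<^sub>R q x))"
      using B by (intro AE_I2) (auto intro!: mult_right_mono simp: indicator_def)
  qed
  moreover have "(\<lambda>x. \<psi> x *\<^sub>R (indicator (cball 0 R) x *\<^sub>R q x)) = (\<lambda>x. \<psi> x *\<^sub>R q x)"
    using \<psi>(2) by (force simp: indicator_def)
  ultimately show ?thesis by simp
qed

lemma locally_integrable_compact_C1:
  assumes "locally_integrable q" "compact_C1 \<phi> g"
  shows "integrable lborel (\<lambda>x. \<phi> x *\<^sub>R q x)"
  using compact_C1_E[OF assms(2)] locally_integrable_compact_support[OF assms(1)]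
    C1_continuous[OF compact_C1_C1[OF assms(2)]] by metis

text \<open>Bumps shrinking to a compact K give a nonnegative integral of q over K by dominated
  convergence. Hence every compact subset of the set q < 0 is null, and inner regularity extends
  this to the whole set.\<close>

lemma AE_nonneg_if_test:
  fixes q :: "real^'n \<Rightarrow> real"
  assumes q: "locally_integrable q"
    and meas: "q \<in> borel_measurable borel"
    and test: "\<And>\<phi> g. compact_C1 \<phi> g \<Longrightarrow> (\<And>x. 0 \<le> \<phi> x) \<Longrightarrow> 0 \<le> (LBINT x. \<phi> x * q x)"
  shows "AE x in lborel. 0 \<le> q x"
proof -
  have int: "0 \<le> (LBINT x. indicator K x * q x)" if K: "compact K" for K
  proof -
    obtain R where R: "R > 0" "\<And>y. y \<in> K \<Longrightarrow> norm y \<le> R"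
      using compact_imp_bounded[OF K] by (auto simp: bounded_pos)
    define r where "r k = inverse (real (Suc k))" for k
    have r: "r k > 0" "r k \<le> 1" for k by (auto simp: r_def field_simps)
    have "\<exists>\<phi> g. compact_C1 \<phi> g \<and> (\<forall>x. 0 \<le> \<phi> x \<and> \<phi> x \<le> 1) \<and> (\<forall>x\<in>K. \<phi> x = 1) \<and> (\<forall>x. \<phi> x \<noteq> 0 \<longrightarrow> (\<exists>y\<in>K. dist x y \<le> 2 * r k))" for k
      by (rule compact_smooth_bump[OF K r(1)[of k]]) blast
    then have "\<exists>\<phi>. \<forall>k. (\<exists>g. compact_C1 (\<phi> k) g) \<and> (\<forall>x. 0 \<le> \<phi> k x \<and> \<phi> k x \<le> 1) \<and> (\<forall>x\<in>K. \<phi> k x = 1) \<and> (\<forall>x. \<phi> k x \<noteq> 0 \<longrightarrow> (\<exists>y\<in>K. dist x y \<le> 2 * r k))"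
      by (intro choice) blast
    then obtain \<phi> where \<phi>: "\<And>k. \<exists>g. compact_C1 (\<phi> k) g" "\<And>k x. 0 \<le> \<phi> k x" "\<And>k x. \<phi> k x \<le> 1"
      "\<And>k x. x \<in> K \<Longrightarrow> \<phi> k x = 1" "\<And>k x. \<phi> k x \<noteq> 0 \<Longrightarrow> \<exists>y\<in>K. dist x y \<le> 2 * r k"
      by blast
    have i: "integrable lborel (\<lambda>x. indicator (cball 0 (R + 2)) x * q x)"
      using q unfolding locally_integrable_def set_integrable_def by simp
    have "(\<lambda>k. \<integral>x. \<phi> k x * q x \<partial>lborel) \<longlonglongrightarrow> (LBINT x. indicator K x * q x)"
    proof (rule integral_dominated_convergence[where w = "\<lambda>x. norm (indicator (cball 0 (R + 2)) x * q x)"])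
      show "(\<lambda>x. indicator K x * q x) \<in> borel_measurable lborel"
        using meas compact_imp_closed[OF K] by (auto intro!: borel_measurable_times)
      show "(\<lambda>x. \<phi> k x * q x) \<in> borel_measurable lborel" for k
        using meas \<phi>(1)[of k] C1_measurable(1)[OF compact_C1_C1] by (auto intro!: borel_measurable_times)
      show "integrable lborel (\<lambda>x. norm (indicator (cball 0 (R + 2)) x * q x))"
        using i by (rule integrable_norm)
      show "AE x in lborel. (\<lambda>k. \<phi> k x * q x) \<longlonglongrightarrow> indicator K x * q x"
      proof (rule AE_I2)
        fix x
        show "(\<lambda>k. \<phi> k x * q x) \<longlonglongrightarrow> indicator K x * q x"
        proof (cases "x \<in> K")
          case False
          then obtain d where d: "d > 0" "ball x d \<subseteq> - K"
            using compact_imp_closed[OF K] by (meson ComplI open_Compl open_contains_ball)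
          have "(\<lambda>k. 2 * r k) \<longlonglongrightarrow> 2 * 0" unfolding r_def by (intro tendsto_intros LIMSEQ_inverse_real_of_nat)
          then have "\<forall>\<^sub>F k in sequentially. 2 * r k < d" using d(1) by (intro order_tendstoD(2)) auto
          then have "\<forall>\<^sub>F k in sequentially. \<phi> k x * q x = 0"
          proof eventually_elim
            case (elim k)
            then show ?case using \<phi>(5)[of k x] d(2) by force
          qed
          then show ?thesis using False by (simp add: tendsto_eventually)
        qed (simp add: \<phi>(4))
      qed
      show "AE x in lborel. norm (\<phi> k x * q x) \<le> norm (indicator (cball 0 (R + 2)) x * q x)" for k
      proof (rule AE_I2)
        fix x
        show "norm (\<phi> k x * q x) \<le> norm (indicator (cball 0 (R + 2)) x * q x)"
        proof (cases "\<phi> k x = 0")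
          case False
          then obtain y where "y \<in> K" "dist x y \<le> 2 * r k" using \<phi>(5) by blast
          then have "norm x \<le> R + 2"
            using R(2)[of y] norm_triangle_ineq2[of x y] r[of k] by (simp add: dist_norm)
          then show ?thesis using \<phi>(2,3)[of k x] by (simp add: abs_mult mult_left_le_one_le)
        qed simp
      qed
    qed
    moreover have "0 \<le> (LBINT x. \<phi> k x * q x)" for k
      using \<phi>(1,2) test by blast
    ultimately show ?thesis by (intro LIMSEQ_le_const) auto
  qed
  have null_K: "emeasure lborel K = 0" if K: "compact K" "\<And>x. x \<in> K \<Longrightarrow> q x < 0" for K
  proof -
    have [measurable]: "K \<in> sets borel" using compact_imp_closed[OF K(1)] by simp
    have i: "integrable lborel (\<lambda>x. - (indicator K x * q x))"
      using q K(1) unfolding locally_integrable_def set_integrable_def by simp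
    have nn: "0 \<le> - (indicator K x * q x)" for x
      using K(2)[of x] by (auto simp: indicator_def)
    have "(LBINT x. - (indicator K x * q x)) = 0"
      using int[OF K(1)] integral_nonneg_AE[where M = lborel and f = "\<lambda>x. - (indicator K x * q x)"] nn by simp
    then have "AE x in lborel. - (indicator K x * q x) = 0"
      using integral_nonneg_eq_0_iff_AE[OF i] nn by simp
    then have "AE x in lborel. x \<notin> K"
      by eventually_elim (use K(2) in \<open>force simp: indicator_def split: if_splits\<close>)
    then show ?thesis by (subst (asm) AE_iff_measurable[of K]) auto
  qed
  \<comment> \<open>Intersecting with a ball makes the closed sets supplied by inner regularity
    compact, so that \<open>null_K\<close> applies to them.\<close>
  have "emeasure lborel ({x. q x < 0} \<inter> cball 0 (real m)) = 0" for m :: nat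
  proof -
    let ?N = "{x. q x < 0} \<inter> cball 0 (real m)"
    have N: "?N \<in> sets borel" using meas by measurable
    have "emeasure lborel ?N \<le> 0 + ennreal e" if e: "e > 0" for e
    proof -
      obtain T where T: "closed T" "T \<subseteq> ?N" "?N - T \<in> lmeasurable" "emeasure lebesgue (?N - T) < ennreal e"
        using sets_lebesgue_inner_closed[of ?N e] N e by auto
      have "bounded T" using T(2) bounded_cball bounded_subset by (metis inf.bounded_iff)
      then have "compact T" using T(1) compact_eq_bounded_closed by blast
      then have "emeasure lborel T = 0" using null_K T(2) by blast
      moreover have "emeasure lborel ?N = emeasure lborel T + emeasure lborel (?N - T)"
        using T N by (subst plus_emeasure) (auto simp: Un_absorb1)
      moreover have "emeasure lborel (?N - T) < ennreal e"
        using T(1,4) N by (simp add: emeasure_completion main_part_sets)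
      ultimately show ?thesis by simp
    qed
    then show ?thesis using ennreal_le_epsilon[of 0] by (metis le_zero_eq)
  qed
  then have "AE x in lborel. x \<notin> {x. q x < 0} \<inter> cball 0 (real m)" for m :: nat
    using meas by (intro AE_not_in) (auto simp: null_sets_def)
  then have "AE x in lborel. \<forall>m::nat. x \<notin> {x. q x < 0} \<inter> cball 0 (real m)"
    by (subst AE_all_countable) blast
  then show ?thesis
  proof eventually_elim
    case (elim x)
    obtain m :: nat where "norm x \<le> real m" using real_arch_simple by blast
    then show ?case using elim[rule_format, of m] by (auto simp: not_less)
  qed
qed

subsection \<open>Weak gradients\<close>

lemma integrable_mult_pair:
  fixes u :: "'a \<Rightarrow> real" and v :: "'b \<Rightarrow> real"
  assumes "sigma_finite_measure M1" "sigma_finite_measure M2"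
    and u: "integrable M1 u" and v: "integrable M2 v"
  shows "integrable (M1 \<Otimes>\<^sub>M M2) (\<lambda>(x, y). u x * v y)"
proof -
  interpret M1: sigma_finite_measure M1 by fact
  interpret M2: sigma_finite_measure M2 by fact
  interpret pair_sigma_finite M1 M2 ..
  have [measurable]: "u \<in> borel_measurable M1" "v \<in> borel_measurable M2"
    using u v by auto
  show ?thesis
    by (rule Fubini_integrable) (use u v in \<open>auto simp: abs_mult\<close>)
qed

lemma integrable_indicator_Icc: "integrable lborel (indicator {a..b::real} :: real \<Rightarrow> real)"
  by (rule integrable_real_indicator) (auto simp: emeasure_lborel_Icc_eq)

lemma locally_integrable_cball:
  "locally_integrable q \<Longrightarrow> integrable lborel (\<lambda>x. indicator (cball 0 R) x *\<^sub>R q x)"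
  unfolding locally_integrable_def set_integrable_def by simp

lemma locally_integrableI:
  fixes q :: "real^'n \<Rightarrow> 'b::euclidean_space"
  assumes q: "q \<in> borel_measurable borel"
    and i: "\<And>R. integrable lborel (\<lambda>x. indicator (cball 0 R) x *\<^sub>R q x)"
  shows "locally_integrable q"
  unfolding locally_integrable_def set_integrable_def
proof (intro allI impI)
  fix K :: "(real^'n) set" assume K: "compact K"
  obtain R where R: "\<And>y. y \<in> K \<Longrightarrow> norm y \<le> R"
    using compact_imp_bounded[OF K] by (auto simp: bounded_iff)
  have [measurable]: "K \<in> sets borel" using compact_imp_closed[OF K] by simp
  show "integrable lborel (\<lambda>x. indicator K x *\<^sub>R q x)"
    by (rule Bochner_Integration.integrable_bound[OF i[of R]])
       (use q R in \<open>auto simp: indicator_def\<close>)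
qed

lemma locally_integrable_translate:
  fixes q :: "real^'n \<Rightarrow> 'b::euclidean_space"
  assumes q: "q \<in> borel_measurable borel" and l: "locally_integrable q"
  shows "locally_integrable (\<lambda>x. q (x + a))"
proof (rule locally_integrableI)
  show "(\<lambda>x. q (x + a)) \<in> borel_measurable borel" using q by simp
  fix R
  have "integrable lborel (\<lambda>x. indicator (cball 0 (R + norm a)) (a + x) *\<^sub>R q (a + x))"
    by (rule lborel_integrable_translate[OF locally_integrable_cball[OF l]])
  then show "integrable lborel (\<lambda>x. indicator (cball 0 R) x *\<^sub>R q (x + a))"
  proof (rule Bochner_Integration.integrable_bound)
    show "(\<lambda>x. indicator (cball 0 R) x *\<^sub>R q (x + a)) \<in> borel_measurable lborel"
      using q by (intro borel_measurable_scaleR borel_measurable_indicator) auto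
    show "AE x in lborel. norm (indicator (cball 0 R) x *\<^sub>R q (x + a))
        \<le> norm (indicator (cball 0 (R + norm a)) (a + x) *\<^sub>R q (a + x))"
    proof (rule AE_I2)
      fix x
      have "norm x \<le> R \<Longrightarrow> norm (a + x) \<le> R + norm a" using norm_triangle_ineq[of a x] by simp
      then show "norm (indicator (cball 0 R) x *\<^sub>R q (x + a))
        \<le> norm (indicator (cball 0 (R + norm a)) (a + x) *\<^sub>R q (a + x))"
        by (auto simp: indicator_def add.commute)
    qed
  qed
qed

text \<open>If \<open>\<bar>f\<bar>\<close> is continuously differentiable, its gradient is dominated by the weak gradient of
  \<open>f\<close>: the increments of \<open>\<bar>f\<bar>\<close> are bounded by those of \<open>f\<close>, which are averages of
  the weak gradient along segments.\<close>

context
  fixes f :: "real^'n \<Rightarrow> real" and Df :: "real^'n \<Rightarrow> real^'n" and e :: "real^'n"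
  assumes wg: "weak_gradient f Df"
    and fm [measurable]: "f \<in> borel_measurable borel"
    and Dm [measurable]: "Df \<in> borel_measurable borel"
begin

lemma weak_gradient_loc: "locally_integrable f"
  using wg by (simp add: weak_gradient_def)

lemma weak_partial_loc: "locally_integrable (\<lambda>x. Df x \<bullet> e)"
proof (rule locally_integrableI)
  fix R
  have "integrable lborel (\<lambda>x. indicator (cball 0 R) x *\<^sub>R Df x)"
    using wg by (intro locally_integrable_cball) (simp add: weak_gradient_def)
  then have "integrable lborel (\<lambda>x. (indicator (cball 0 R) x *\<^sub>R Df x) \<bullet> e)"
    by (intro integrable_inner_left)
  then show "integrable lborel (\<lambda>x. indicator (cball 0 R) x *\<^sub>R (Df x \<bullet> e))" by simp
qed simp

lemma weak_partial_abs_loc: "locally_integrable (\<lambda>x. \<bar>Df x \<bullet> e\<bar>)"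
proof (rule locally_integrableI)
  fix R
  show "integrable lborel (\<lambda>x. indicator (cball 0 R) x *\<^sub>R \<bar>Df x \<bullet> e\<bar>)"
    using integrable_abs[OF locally_integrable_cball[OF weak_partial_loc, of R]] by (simp add: abs_mult)
qed simp

lemma weak_gradient_test:
  assumes \<phi>: "compact_C1 \<phi> g"
  shows "(LBINT x. f x * (g x \<bullet> e)) = - (LBINT x. \<phi> x * (Df x \<bullet> e))"
proof -
  obtain R where R: "\<And>x. norm x > R \<Longrightarrow> g x = 0" using compact_C1_E[OF \<phi>] by metis
  note C = compact_C1_C1[OF \<phi>]
  note [measurable] = C1_measurable[OF C]
  have "integrable lborel (\<lambda>x. norm (g x) *\<^sub>R f x)"
    by (rule locally_integrable_compact_support[OF weak_gradient_loc, of _ R])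
       (use R C1_continuous_grad[OF C] in \<open>auto intro!: continuous_intros\<close>)
  then have i1: "integrable lborel (\<lambda>x. f x *\<^sub>R g x)"
    by (rule Bochner_Integration.integrable_bound) (auto simp: abs_mult)
  have i2: "integrable lborel (\<lambda>x. \<phi> x *\<^sub>R Df x)"
    using wg by (intro locally_integrable_compact_C1[OF _ \<phi>]) (simp add: weak_gradient_def)
  have "(LBINT x. f x *\<^sub>R g x) = - (LBINT x. \<phi> x *\<^sub>R Df x)"
    using wg compact_C1_test_function[OF \<phi>] unfolding weak_gradient_def C1_grad[OF C, symmetric] by blast
  then have "(LBINT x. f x *\<^sub>R g x) \<bullet> e = - ((LBINT x. \<phi> x *\<^sub>R Df x) \<bullet> e)"
    by simp
  moreover have "(LBINT x. f x *\<^sub>R g x) \<bullet> e = (LBINT x. (f x *\<^sub>R g x) \<bullet> e)"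
    using i1 by (intro integral_inner_left[symmetric])
  moreover have "(LBINT x. \<phi> x *\<^sub>R Df x) \<bullet> e = (LBINT x. (\<phi> x *\<^sub>R Df x) \<bullet> e)"
    using i2 by (intro integral_inner_left[symmetric])
  ultimately show ?thesis by simp
qed

text \<open>The translation is moved onto \<phi>, and \<phi>(x - t e) - \<phi>(x) is written as an
  integral of directional derivatives over [0, t]. After Fubini, each translate of \<phi> serves as
  a test function for the weak gradient.\<close>

lemma weak_increment:
  assumes \<phi>: "compact_C1 \<phi> g" and t: "t \<ge> 0"
  shows "(LBINT x. \<phi> x * (f (x + t *\<^sub>R e) - f x))
       = (LBINT s. indicator {0..t} s * (LBINT x. \<phi> (x - s *\<^sub>R e) * (Df x \<bullet> e)))"
proof -
  note C = compact_C1_C1[OF \<phi>]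
  note [measurable] = C1_measurable[OF C]
  obtain R where R: "R > 0" "\<And>x. norm x > R \<Longrightarrow> \<phi> x = 0" "\<And>x. norm x > R \<Longrightarrow> g x = 0"
    using compact_C1_E[OF \<phi>] by metis
  obtain B where B: "B > 0" "\<And>x. norm (g x) \<le> B"
    using compact_C1_bounded[OF \<phi>] by blast
  have tr: "compact_C1 (\<lambda>x. \<phi> (x - s *\<^sub>R e)) (\<lambda>x. g (x - s *\<^sub>R e))" for s
    using compact_C1_translate[OF \<phi>, of "- (s *\<^sub>R e)"] by simp
  have i0: "integrable lborel (\<lambda>x. \<phi> x * f x)"
    using locally_integrable_compact_C1[OF weak_gradient_loc \<phi>] by simp
  have i1: "integrable lborel (\<lambda>x. \<phi> x * f (x + t *\<^sub>R e))"
    using locally_integrable_compact_C1[OF locally_integrable_translate[OF fm weak_gradient_loc] \<phi>] by simp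
  have i2: "integrable lborel (\<lambda>x. \<phi> (x - t *\<^sub>R e) * f x)"
    using locally_integrable_compact_C1[OF weak_gradient_loc tr] by simp
  define H where "H x s = indicator {0..t} s * (f x * - (g (x - s *\<^sub>R e) \<bullet> e))" for x s
  have "integrable (lborel \<Otimes>\<^sub>M lborel) (\<lambda>(x, s). (indicator (cball 0 (R + t * norm e)) x * f x) * (B * norm e * indicator {0..t} s))"
    using locally_integrable_cball[OF weak_gradient_loc]
    by (intro integrable_mult_pair sigma_finite_lborel integrable_mult_right integrable_indicator_Icc) auto
  then have iH: "integrable (lborel \<Otimes>\<^sub>M lborel) (case_prod H)"
  proof (rule Bochner_Integration.integrable_bound)
    show "case_prod H \<in> borel_measurable (lborel \<Otimes>\<^sub>M lborel)"
      unfolding H_def by measurable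
    have "\<bar>H x s\<bar> \<le> \<bar>(indicator (cball 0 (R + t * norm e)) x * f x) * (B * norm e * indicator {0..t} s)\<bar>" for x s
    proof (cases "s \<in> {0..t} \<and> g (x - s *\<^sub>R e) \<noteq> 0")
      case True
      then have "norm (x - s *\<^sub>R e) \<le> R" using R(3) not_less by blast
      moreover have "norm (s *\<^sub>R e) \<le> t * norm e" using True by (auto intro!: mult_right_mono)
      ultimately have "norm x \<le> R + t * norm e" using norm_triangle_ineq[of "x - s *\<^sub>R e" "s *\<^sub>R e"] by simp
      moreover have "\<bar>g (x - s *\<^sub>R e) \<bullet> e\<bar> \<le> B * norm e"
        using Cauchy_Schwarz_ineq2[of "g (x - s *\<^sub>R e)" e] mult_right_mono[OF B(2) norm_ge_zero]
        by (rule order_trans)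
      ultimately show ?thesis using True B(1)
        by (auto simp: H_def abs_mult intro!: mult_left_mono)
    qed (auto simp: H_def)
    then show "AE p in lborel \<Otimes>\<^sub>M lborel. norm (case_prod H p)
       \<le> norm (case p of (x, s) \<Rightarrow> (indicator (cball 0 (R + t * norm e)) x * f x) * (B * norm e * indicator {0..t} s))"
      by (intro AE_I2) auto
  qed
  have FTC: "(LBINT s. H x s) = f x * (\<phi> (x - t *\<^sub>R e) - \<phi> x)" for x
  proof -
    have "(LBINT s. - (g (x - s *\<^sub>R e) \<bullet> e) * indicator {0..t} s) = \<phi> (x - t *\<^sub>R e) - \<phi> (x - 0 *\<^sub>R e)"
    proof (rule integral_FTC_Icc_real[OF t])
      fix s :: real
      have "((\<lambda>s. x - s *\<^sub>R e) has_derivative (\<lambda>s. - (s *\<^sub>R e))) (at s)"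
        by (auto intro!: derivative_eq_intros)
      from has_derivative_compose[OF this C1_D[OF C]]
      show "((\<lambda>s. \<phi> (x - s *\<^sub>R e)) has_real_derivative - (g (x - s *\<^sub>R e) \<bullet> e)) (at s)"
        unfolding has_field_derivative_def by (rule has_derivative_eq_rhs) (auto simp: mult.commute)
      have "isCont (\<lambda>s. g (x - s *\<^sub>R e)) s"
        by (rule isCont_o2[OF _ C1_isCont_grad[OF C]]) (intro continuous_intros)
      then show "isCont (\<lambda>s. - (g (x - s *\<^sub>R e) \<bullet> e)) s" by (intro continuous_intros)
    qed
    moreover have "(LBINT s. H x s) = f x * (LBINT s. - (g (x - s *\<^sub>R e) \<bullet> e) * indicator {0..t} s)"
      unfolding integral_mult_right_zero[symmetric] H_def by (intro Bochner_Integration.integral_cong) auto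
    ultimately show ?thesis by simp
  qed
  have "(LBINT x. \<phi> x * (f (x + t *\<^sub>R e) - f x))
      = (LBINT x. \<phi> x * f (x + t *\<^sub>R e)) - (LBINT x. \<phi> x * f x)"
    using i0 i1 by (simp add: right_diff_distrib)
  also have "(LBINT x. \<phi> x * f (x + t *\<^sub>R e)) = (LBINT x. \<phi> (x - t *\<^sub>R e) * f x)"
    using lborel_integral_translate[of "\<lambda>x. \<phi> (x - t *\<^sub>R e) * f x" "t *\<^sub>R e"] by (simp add: add.commute)
  also have "\<dots> - (LBINT x. \<phi> x * f x) = (LBINT x. (LBINT s. H x s))"
    unfolding FTC using i0 i2 by (simp add: right_diff_distrib mult.commute)
  also have "\<dots> = (LBINT s. (LBINT x. H x s))"
    by (rule lborel_pair.Fubini_integral[OF iH, symmetric])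
  also have "\<dots> = (LBINT s. indicator {0..t} s * (LBINT x. \<phi> (x - s *\<^sub>R e) * (Df x \<bullet> e)))"
  proof (intro Bochner_Integration.integral_cong refl)
    fix s
    show "(LBINT x. H x s) = indicator {0..t} s * (LBINT x. \<phi> (x - s *\<^sub>R e) * (Df x \<bullet> e))"
      using weak_gradient_test[OF tr, of s] by (simp add: H_def)
  qed
  finally show ?thesis .
qed

text \<open>There is no division by t, so that this bounds the increment itself and not the
  difference quotient.\<close>

definition line_average :: "real \<Rightarrow> real^'n \<Rightarrow> real" where
  "line_average t x = (LBINT s. indicator {0..t} s * \<bar>Df (x + s *\<^sub>R e) \<bullet> e\<bar>)"

lemma line_average_nonneg: "0 \<le> line_average t x"
  unfolding line_average_def by (intro integral_nonneg_AE AE_I2) auto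

lemma line_average_measurable [measurable]: "line_average t \<in> borel_measurable borel"
proof -
  have "(\<lambda>x. \<integral>s. indicator {0..t} s * \<bar>Df (x + s *\<^sub>R e) \<bullet> e\<bar> \<partial>lborel) \<in> borel_measurable (borel :: (real^'n) measure)"
    by measurable
  then show ?thesis unfolding line_average_def[abs_def] .
qed

text \<open>Fubini, followed by a translation of the inner integral. The weight is merely
  measurable, bounded and of bounded support, so that indicators of balls are covered as well as
  test functions.\<close>

lemma line_average_integral:
  assumes t: "t \<ge> 0" and \<psi> [measurable]: "\<psi> \<in> borel_measurable borel"
    and b: "\<And>x. 0 \<le> \<psi> x" "\<And>x. \<psi> x \<le> B" "\<And>x. norm x > R \<Longrightarrow> \<psi> x = 0"
  shows "integrable lborel (\<lambda>x. \<psi> x * line_average t x)"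
    and "(LBINT x. \<psi> x * line_average t x)
      = (LBINT s. indicator {0..t} s * (LBINT x. \<psi> (x - s *\<^sub>R e) * \<bar>Df x \<bullet> e\<bar>))"
    and "integrable lborel (\<lambda>s. indicator {0..t} s * (LBINT x. \<psi> (x - s *\<^sub>R e) * \<bar>Df x \<bullet> e\<bar>))"
proof -
  define P where "P s x = indicator {0..t} s * (\<psi> x * \<bar>Df (x + s *\<^sub>R e) \<bullet> e\<bar>)" for s x
  have Pm [measurable]: "case_prod P \<in> borel_measurable (lborel \<Otimes>\<^sub>M lborel)"
    unfolding P_def by measurable
  have B0: "B \<ge> 0" using b(1,2)[of 0] by linarith
  define D where "D = (LBINT x. B * (indicator (cball 0 (R + t * norm e)) x *\<^sub>R \<bar>Df x \<bullet> e\<bar>))"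
  have iD: "integrable lborel (\<lambda>x. B * (indicator (cball 0 (R + t * norm e)) x *\<^sub>R \<bar>Df x \<bullet> e\<bar>))"
    by (intro integrable_mult_right locally_integrable_cball weak_partial_abs_loc)
  have bd: "\<psi> (x - s *\<^sub>R e) * \<bar>Df x \<bullet> e\<bar> \<le> B * (indicator (cball 0 (R + t * norm e)) x *\<^sub>R \<bar>Df x \<bullet> e\<bar>)"
    if "s \<in> {0..t}" for x s
  proof (cases "\<psi> (x - s *\<^sub>R e) = 0")
    case False
    then have "norm (x - s *\<^sub>R e) \<le> R" using b(3) not_less by blast
    moreover have "norm (s *\<^sub>R e) \<le> t * norm e" using that by (auto intro!: mult_right_mono)
    ultimately have "norm x \<le> R + t * norm e" using norm_triangle_ineq[of "x - s *\<^sub>R e" "s *\<^sub>R e"] by simp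
    then show ?thesis using b(2) by (auto intro!: mult_right_mono)
  qed (use B0 in simp)
  have i1: "integrable lborel (\<lambda>x. \<psi> (x - s *\<^sub>R e) * \<bar>Df x \<bullet> e\<bar>)" if "s \<in> {0..t}" for s
    by (rule Bochner_Integration.integrable_bound[OF iD]) (use bd[OF that] b(1) B0 in \<open>auto simp: abs_mult\<close>)
  have tr: "(LBINT x. \<psi> x * \<bar>Df (x + s *\<^sub>R e) \<bullet> e\<bar>) = (LBINT x. \<psi> (x - s *\<^sub>R e) * \<bar>Df x \<bullet> e\<bar>)" for s
    using lborel_integral_translate[of "\<lambda>x. \<psi> (x - s *\<^sub>R e) * \<bar>Df x \<bullet> e\<bar>" "s *\<^sub>R e"] by (simp add: add.commute)
  have i2: "integrable lborel (\<lambda>x. \<psi> x * \<bar>Df (x + s *\<^sub>R e) \<bullet> e\<bar>)" if "s \<in> {0..t}" for s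
    using lborel_integrable_translate[OF i1[OF that], of "s *\<^sub>R e"] by (simp add: add.commute)
  have Pint: "(LBINT x. P s x) = indicator {0..t} s * (LBINT x. \<psi> (x - s *\<^sub>R e) * \<bar>Df x \<bullet> e\<bar>)" for s
    unfolding P_def by (simp add: tr)
  have iP: "integrable (lborel \<Otimes>\<^sub>M lborel) (case_prod P)"
  proof (rule lborel_pair.Fubini_integrable)
    have n: "(LBINT x. norm (case_prod P (s, x))) = (LBINT x. P s x)" for s
      using b(1) by (intro Bochner_Integration.integral_cong) (auto simp: P_def)
    have D': "(LBINT x. P s x) \<le> indicator {0..t} s * D" "0 \<le> (LBINT x. P s x)" for s
    proof -
      have "(LBINT x. \<psi> (x - s *\<^sub>R e) * \<bar>Df x \<bullet> e\<bar>) \<le> D" if "s \<in> {0..t}"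
        unfolding D_def by (rule integral_mono[OF i1[OF that] iD]) (rule bd[OF that])
      then show "(LBINT x. P s x) \<le> indicator {0..t} s * D"
        unfolding Pint by (auto simp: indicator_def)
      show "0 \<le> (LBINT x. P s x)"
        using b(1) by (intro integral_nonneg_AE AE_I2) (auto simp: P_def)
    qed
    have "integrable lborel (\<lambda>s. indicator {0..t} s * D)"
      by (intro integrable_mult_left integrable_indicator_Icc)
    then show "integrable lborel (\<lambda>s. \<integral>x. norm (case_prod P (s, x)) \<partial>lborel)"
      unfolding n
      by (rule Bochner_Integration.integrable_bound) (use D' in \<open>auto intro: order_trans[OF _ abs_ge_self]\<close>)
    show "AE s in lborel. integrable lborel (\<lambda>x. case_prod P (s, x))"
    proof (rule AE_I2)
      fix s show "integrable lborel (\<lambda>x. case_prod P (s, x))"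
        using i2[of s] by (cases "s \<in> {0..t}") (auto simp: P_def)
    qed
  qed (rule Pm)
  have a: "(LBINT s. P s x) = \<psi> x * line_average t x" for x
    unfolding line_average_def integral_mult_right_zero[symmetric] P_def
    by (intro Bochner_Integration.integral_cong) auto
  show "integrable lborel (\<lambda>x. \<psi> x * line_average t x)"
    using lborel_pair.integrable_snd[OF iP] unfolding a .
  show "(LBINT x. \<psi> x * line_average t x)
      = (LBINT s. indicator {0..t} s * (LBINT x. \<psi> (x - s *\<^sub>R e) * \<bar>Df x \<bullet> e\<bar>))"
    using lborel_pair.Fubini_integral[OF iP] unfolding a Pint .
  show "integrable lborel (\<lambda>s. indicator {0..t} s * (LBINT x. \<psi> (x - s *\<^sub>R e) * \<bar>Df x \<bullet> e\<bar>))"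
    using lborel_pair.integrable_fst[OF iP] unfolding Pint .
qed

lemma line_average_loc: "t \<ge> 0 \<Longrightarrow> locally_integrable (line_average t)"
proof (rule locally_integrableI[OF line_average_measurable])
  fix R
  assume "t \<ge> 0"
  moreover have "(indicator (cball 0 R) :: real^'n \<Rightarrow> real) \<in> borel_measurable borel"
    by (rule borel_measurable_indicator) auto
  ultimately have "integrable lborel (\<lambda>x. indicator (cball 0 R) x * line_average t x)"
    by (rule line_average_integral(1)[where B = 1 and R = R]) (auto simp: indicator_def)
  then
  show "integrable lborel (\<lambda>x. indicator (cball 0 R) x *\<^sub>R line_average t x)"
    by simp
qed

text \<open>The weak gradient controls the increment only against test functions. Testing
  \<open>line_average\<close> plus and minus the increment turns this into an inequality almost
  everywhere.\<close>

lemma increment_le_line_average: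
  assumes t: "t \<ge> 0"
  shows "AE x in lborel. \<bar>f (x + t *\<^sub>R e) - f x\<bar> \<le> line_average t x"
proof -
  have l: "locally_integrable (\<lambda>x. f (x + t *\<^sub>R e) - f x)"
  proof (rule locally_integrableI)
    fix R show "integrable lborel (\<lambda>x. indicator (cball 0 R) x *\<^sub>R (f (x + t *\<^sub>R e) - f x))"
      unfolding scaleR_diff_right
      by (intro Bochner_Integration.integrable_diff locally_integrable_cball weak_gradient_loc
          locally_integrable_translate[OF fm weak_gradient_loc])
  qed simp
  have nn: "AE x in lborel. 0 \<le> line_average t x + c * (f (x + t *\<^sub>R e) - f x)" if c: "c = 1 \<or> c = - 1" for c
  proof (rule AE_nonneg_if_test)
    show "locally_integrable (\<lambda>x. line_average t x + c * (f (x + t *\<^sub>R e) - f x))"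
    proof (rule locally_integrableI)
      fix R
      have "integrable lborel (\<lambda>x. indicator (cball 0 R) x *\<^sub>R line_average t x + c * (indicator (cball 0 R) x *\<^sub>R (f (x + t *\<^sub>R e) - f x)))"
        by (intro Bochner_Integration.integrable_add integrable_mult_right locally_integrable_cball l line_average_loc t)
      then show "integrable lborel (\<lambda>x. indicator (cball 0 R) x *\<^sub>R (line_average t x + c * (f (x + t *\<^sub>R e) - f x)))"
        by (simp add: algebra_simps)
    qed simp
    show "(\<lambda>x. line_average t x + c * (f (x + t *\<^sub>R e) - f x)) \<in> borel_measurable borel" by simp
  next
    fix \<phi> :: "real^'n \<Rightarrow> real" and g assume \<phi>: "compact_C1 \<phi> g" "\<And>x. 0 \<le> \<phi> x"
    obtain R where R: "\<And>x. norm x > R \<Longrightarrow> \<phi> x = 0" using compact_C1_E[OF \<phi>(1)] by metis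
    obtain B where B: "\<And>x. \<bar>\<phi> x\<bar> \<le> B" using compact_C1_bounded[OF \<phi>(1)] by blast
    have Bx: "\<phi> x \<le> B" for x using B[of x] by simp
    note a = line_average_integral[OF t C1_measurable(1)[OF compact_C1_C1[OF \<phi>(1)]] \<phi>(2) Bx R]
    have "\<bar>\<integral>x. \<phi> x * (f (x + t *\<^sub>R e) - f x) \<partial>lborel\<bar>
      \<le> (LBINT s. \<bar>indicator {0..t} s * (LBINT x. \<phi> (x - s *\<^sub>R e) * (Df x \<bullet> e))\<bar>)"
      unfolding weak_increment[OF \<phi>(1) t] by (rule integral_abs_bound)
    also have "\<dots> \<le> (LBINT s. indicator {0..t} s * (LBINT x. \<phi> (x - s *\<^sub>R e) * \<bar>Df x \<bullet> e\<bar>))"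
    proof (rule integral_mono')
      fix s :: real
      have "\<bar>\<integral>x. \<phi> (x - s *\<^sub>R e) * (Df x \<bullet> e) \<partial>lborel\<bar> \<le> (LBINT x. \<bar>\<phi> (x - s *\<^sub>R e) * (Df x \<bullet> e)\<bar>)"
        by (rule integral_abs_bound)
      then show "\<bar>indicator {0..t} s * (LBINT x. \<phi> (x - s *\<^sub>R e) * (Df x \<bullet> e))\<bar>
        \<le> indicator {0..t} s * (LBINT x. \<phi> (x - s *\<^sub>R e) * \<bar>Df x \<bullet> e\<bar>)"
        using \<phi>(2) by (auto simp: abs_mult indicator_def)
      show "0 \<le> indicator {0..t} s * (LBINT x. \<phi> (x - s *\<^sub>R e) * \<bar>Df x \<bullet> e\<bar>)"
        using \<phi>(2) by (intro mult_nonneg_nonneg integral_nonneg_AE AE_I2) auto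
    qed (rule a(3))
    also have "\<dots> = (LBINT x. \<phi> x * line_average t x)" by (rule a(2)[symmetric])
    finally have "0 \<le> (LBINT x. \<phi> x * line_average t x) + c * (LBINT x. \<phi> x * (f (x + t *\<^sub>R e) - f x))"
      using c by auto
    also have "\<dots> = (LBINT x. \<phi> x * line_average t x + c * (\<phi> x * (f (x + t *\<^sub>R e) - f x)))"
      using a(1) locally_integrable_compact_C1[OF l \<phi>(1)] by simp
    finally show "0 \<le> (LBINT x. \<phi> x * (line_average t x + c * (f (x + t *\<^sub>R e) - f x)))"
      by (simp add: algebra_simps)
  qed
  from nn[OF disjI1[OF refl]] nn[OF disjI2[OF refl]] show ?thesis by eventually_elim auto
qed

text \<open>The increments of h are bounded by those of f, but with an exceptional set depending on
  t. Integrating against a test function absorbs it and lets the shift of Df be transferred to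
  \<phi>, whose Lipschitz continuity then gives the limit t -> 0 in place of a Lebesgue point
  argument.\<close>

lemma abs_gradient_le:
  assumes h: "C1 h hg" and abs: "\<And>x. \<bar>f x\<bar> = h x"
  shows "AE x in lborel. \<bar>hg x \<bullet> e\<bar> \<le> \<bar>Df x \<bullet> e\<bar>"
proof -
  note [measurable] = C1_measurable[OF h]
  have hloc: "locally_integrable (\<lambda>x. \<bar>hg x \<bullet> e\<bar>)"
    unfolding locally_integrable_def set_integrable_def
    using C1_continuous_grad[OF h]
    by (intro allI impI borel_integrable_compact) (auto intro!: continuous_intros intro: continuous_on_subset)
  have "AE x in lborel. 0 \<le> \<bar>Df x \<bullet> e\<bar> - \<bar>hg x \<bullet> e\<bar>"
  proof (rule AE_nonneg_if_test)
    show "locally_integrable (\<lambda>x. \<bar>Df x \<bullet> e\<bar> - \<bar>hg x \<bullet> e\<bar>)"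
    proof (rule locally_integrableI)
      fix R show "integrable lborel (\<lambda>x. indicator (cball 0 R) x *\<^sub>R (\<bar>Df x \<bullet> e\<bar> - \<bar>hg x \<bullet> e\<bar>))"
        unfolding scaleR_diff_right
        by (intro Bochner_Integration.integrable_diff locally_integrable_cball weak_partial_abs_loc hloc)
    qed simp
    show "(\<lambda>x. \<bar>Df x \<bullet> e\<bar> - \<bar>hg x \<bullet> e\<bar>) \<in> borel_measurable borel" by simp
  next
    fix \<phi> :: "real^'n \<Rightarrow> real" and g assume \<phi>: "compact_C1 \<phi> g" "\<And>x. 0 \<le> \<phi> x"
    note C = compact_C1_C1[OF \<phi>(1)]
    note [measurable] = C1_measurable[OF C]
    obtain R where R: "R > 0" "\<And>x. norm x > R \<Longrightarrow> \<phi> x = 0" using compact_C1_E[OF \<phi>(1)] by metis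
    obtain B where B: "B > 0" "\<And>x. \<bar>\<phi> x\<bar> \<le> B" "\<And>x. norm (g x) \<le> B" using compact_C1_bounded[OF \<phi>(1)] by blast
    have Bx: "\<phi> x \<le> B" for x using B(2)[of x] by simp
    have id: "integrable lborel (\<lambda>x. \<phi> x * \<bar>Df x \<bullet> e\<bar>)"
      using locally_integrable_compact_C1[OF weak_partial_abs_loc \<phi>(1)] by simp
    have ih: "integrable lborel (\<lambda>x. \<phi> x * \<bar>hg x \<bullet> e\<bar>)"
      using locally_integrable_compact_C1[OF hloc \<phi>(1)] by simp
    define Q where "Q = (LBINT x. indicator (cball 0 (R + norm e)) x *\<^sub>R \<bar>Df x \<bullet> e\<bar>)"
    have iQ: "integrable lborel (\<lambda>x. indicator (cball 0 (R + norm e)) x *\<^sub>R \<bar>Df x \<bullet> e\<bar>)"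
      by (intro locally_integrable_cball weak_partial_abs_loc)
    \<comment> \<open>Moving \<phi> by at most t |e| changes it by at most B |e| t; \<open>Q\<close>
      is the mass of |Df . e| on a ball containing all the shifted supports.\<close>
    have est: "(LBINT x. \<phi> x * (\<bar>h (x + t *\<^sub>R e) - h x\<bar> / t))
        \<le> (LBINT x. \<phi> x * \<bar>Df x \<bullet> e\<bar>) + B * norm e * t * Q" if t: "0 < t" "t \<le> 1" for t
    proof -
      have t0: "t \<ge> 0" using t by simp
      note a = line_average_integral[OF t0 C1_measurable(1)[OF C] \<phi>(2) Bx R(2)]
      have "(LBINT x. \<phi> x * \<bar>h (x + t *\<^sub>R e) - h x\<bar>) \<le> (LBINT x. \<phi> x * line_average t x)"
      proof (rule integral_mono_AE')
        show "integrable lborel (\<lambda>x. \<phi> x * line_average t x)" by (rule a(1))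
        show "AE x in lborel. \<phi> x * \<bar>h (x + t *\<^sub>R e) - h x\<bar> \<le> \<phi> x * line_average t x"
          using increment_le_line_average[OF t0]
        proof eventually_elim
          case (elim x)
          then have "\<bar>h (x + t *\<^sub>R e) - h x\<bar> \<le> line_average t x"
            using abs_triangle_ineq3[of "f (x + t *\<^sub>R e)" "f x"] unfolding abs by linarith
          then show ?case using \<phi>(2) by (rule mult_left_mono)
        qed
        show "AE x in lborel. 0 \<le> \<phi> x * line_average t x" using \<phi>(2) line_average_nonneg by simp
      qed
      also have "\<dots> = (LBINT s. indicator {0..t} s * (LBINT x. \<phi> (x - s *\<^sub>R e) * \<bar>Df x \<bullet> e\<bar>))"
        by (rule a(2))
      also have "\<dots> \<le> (LBINT s. indicator {0..t} s * ((LBINT x. \<phi> x * \<bar>Df x \<bullet> e\<bar>) + B * norm e * t * Q))"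
      proof (rule integral_mono[OF a(3)])
        show "integrable lborel (\<lambda>s. indicator {0..t} s * ((LBINT x. \<phi> x * \<bar>Df x \<bullet> e\<bar>) + B * norm e * t * Q))"
          by (intro integrable_mult_left integrable_indicator_Icc)
        fix s :: real
        show "indicator {0..t} s * (LBINT x. \<phi> (x - s *\<^sub>R e) * \<bar>Df x \<bullet> e\<bar>)
            \<le> indicator {0..t} s * ((LBINT x. \<phi> x * \<bar>Df x \<bullet> e\<bar>) + B * norm e * t * Q)"
        proof (cases "s \<in> {0..t}")
          case True
          have "(LBINT x. \<phi> (x - s *\<^sub>R e) * \<bar>Df x \<bullet> e\<bar>)
              \<le> (LBINT x. \<phi> x * \<bar>Df x \<bullet> e\<bar> + B * norm e * t * (indicator (cball 0 (R + norm e)) x *\<^sub>R \<bar>Df x \<bullet> e\<bar>))"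
          proof (rule integral_mono')
            show "integrable lborel (\<lambda>x. \<phi> x * \<bar>Df x \<bullet> e\<bar> + B * norm e * t * (indicator (cball 0 (R + norm e)) x *\<^sub>R \<bar>Df x \<bullet> e\<bar>))"
              using id iQ by (intro Bochner_Integration.integrable_add integrable_mult_right)
            fix x
            have "\<phi> (x - s *\<^sub>R e) \<le> \<phi> x + B * norm e * t * indicator (cball 0 (R + norm e)) x"
            proof (cases "\<phi> (x - s *\<^sub>R e) = 0")
              case False
              then have "norm (x - s *\<^sub>R e) \<le> R" using R(2) not_less by blast
              moreover have "norm (s *\<^sub>R e) \<le> 1 * norm e" unfolding norm_scaleR
                using True t by (intro mult_right_mono) auto
              ultimately have "norm x \<le> R + norm e" using norm_triangle_ineq[of "x - s *\<^sub>R e" "s *\<^sub>R e"] by simp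
              moreover have "\<bar>\<phi> (x - s *\<^sub>R e) - \<phi> x\<bar> \<le> B * norm (x - s *\<^sub>R e - x)"
                by (rule C1_lipschitz[OF C B(3)])
              moreover have "B * norm (x - s *\<^sub>R e - x) \<le> B * (t * norm e)"
                using True B(1) by (intro mult_left_mono) (auto intro!: mult_right_mono)
              ultimately show ?thesis by (simp add: mult_ac abs_le_iff)
            qed (use \<phi>(2) B t in simp)
            from mult_right_mono[OF this, of "\<bar>Df x \<bullet> e\<bar>"]
            show "\<phi> (x - s *\<^sub>R e) * \<bar>Df x \<bullet> e\<bar>
              \<le> \<phi> x * \<bar>Df x \<bullet> e\<bar> + B * norm e * t * (indicator (cball 0 (R + norm e)) x *\<^sub>R \<bar>Df x \<bullet> e\<bar>)"
              by (simp add: algebra_simps)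
            show "0 \<le> \<phi> x * \<bar>Df x \<bullet> e\<bar> + B * norm e * t * (indicator (cball 0 (R + norm e)) x *\<^sub>R \<bar>Df x \<bullet> e\<bar>)"
              using \<phi>(2) B(1) t by simp
          qed
          also have "\<dots> = (LBINT x. \<phi> x * \<bar>Df x \<bullet> e\<bar>) + B * norm e * t * Q"
            unfolding Q_def using id iQ by simp
          finally show ?thesis using True by simp
        qed simp
      qed
      also have "\<dots> = t * ((LBINT x. \<phi> x * \<bar>Df x \<bullet> e\<bar>) + B * norm e * t * Q)"
        using t by simp
      finally show ?thesis using t by (simp add: pos_divide_le_eq mult.commute)
    qed
    define t :: "nat \<Rightarrow> real" where "t k = inverse (real (Suc k))" for k
    have t: "t k > 0" "t k \<le> 1" for k by (auto simp: t_def field_simps)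
    have t0: "t \<longlonglongrightarrow> 0" unfolding t_def by (rule LIMSEQ_inverse_real_of_nat)
    have "bounded (hg ` cball 0 (R + norm e))"
      by (intro compact_imp_bounded compact_continuous_image continuous_on_subset[OF C1_continuous_grad[OF h]]) auto
    then obtain L where L: "L > 0" "\<And>x. x \<in> cball 0 (R + norm e) \<Longrightarrow> norm (hg x) \<le> L"
      by (auto simp: bounded_pos)
    have "(\<lambda>k. \<integral>x. \<phi> x * (\<bar>h (x + t k *\<^sub>R e) - h x\<bar> / t k) \<partial>lborel) \<longlonglongrightarrow> (LBINT x. \<phi> x * \<bar>hg x \<bullet> e\<bar>)"
    proof (rule integral_dominated_convergence[where w = "\<lambda>x. \<phi> x * (L * norm e)"])
      show "integrable lborel (\<lambda>x. \<phi> x * (L * norm e))"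
        using compact_C1_integrable[OF \<phi>(1)] by simp
      show "AE x in lborel. (\<lambda>k. \<phi> x * (\<bar>h (x + t k *\<^sub>R e) - h x\<bar> / t k)) \<longlonglongrightarrow> \<phi> x * \<bar>hg x \<bullet> e\<bar>"
      proof (rule AE_I2)
        fix x
        from tendsto_mult[OF tendsto_const tendsto_rabs[OF C1_difference_quotient[OF h t0 t(1)]], of "\<phi> x"]
        show "(\<lambda>k. \<phi> x * (\<bar>h (x + t k *\<^sub>R e) - h x\<bar> / t k)) \<longlonglongrightarrow> \<phi> x * \<bar>hg x \<bullet> e\<bar>"
          using t(1) by (simp add: abs_of_pos)
      qed
      show "AE x in lborel. norm (\<phi> x * (\<bar>h (x + t k *\<^sub>R e) - h x\<bar> / t k)) \<le> \<phi> x * (L * norm e)" for k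
      proof (rule AE_I2)
        fix x
        show "norm (\<phi> x * (\<bar>h (x + t k *\<^sub>R e) - h x\<bar> / t k)) \<le> \<phi> x * (L * norm e)"
        proof (cases "\<phi> x = 0")
          case False
          then have x: "norm x \<le> R" using R(2) not_less by blast
          have te: "norm (t k *\<^sub>R e) \<le> norm e" using t[of k] by (simp add: mult_left_le_one_le)
          have xe: "norm (x + t k *\<^sub>R e) \<le> R + norm e" "norm x \<le> R + norm e"
            using x te norm_triangle_ineq[of x "t k *\<^sub>R e"] norm_ge_zero[of e] by linarith+
          have "\<bar>h (x + t k *\<^sub>R e) - h x\<bar> \<le> L * norm (x + t k *\<^sub>R e - x)"
            by (rule C1_lipschitz_on[OF h convex_cball[of 0 "R + norm e"] _ _ L(2)]) (use xe in auto)
          then have "\<bar>h (x + t k *\<^sub>R e) - h x\<bar> / t k \<le> L * norm e"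
            using t[of k] by (simp add: pos_divide_le_eq mult_ac)
          from mult_left_mono[OF this \<phi>(2)[of x]] show ?thesis
            using t(1)[of k] \<phi>(2)[of x] by (simp add: abs_mult)
        qed simp
      qed
    qed measurable
    moreover have "(\<lambda>k. (LBINT x. \<phi> x * \<bar>Df x \<bullet> e\<bar>) + B * norm e * t k * Q)
        \<longlonglongrightarrow> (LBINT x. \<phi> x * \<bar>Df x \<bullet> e\<bar>) + B * norm e * 0 * Q"
      by (intro tendsto_intros t0)
    ultimately have "(LBINT x. \<phi> x * \<bar>hg x \<bullet> e\<bar>) \<le> (LBINT x. \<phi> x * \<bar>Df x \<bullet> e\<bar>) + B * norm e * 0 * Q"
      using est[OF t] by (intro LIMSEQ_le) auto
    then show "0 \<le> (LBINT x. \<phi> x * (\<bar>Df x \<bullet> e\<bar> - \<bar>hg x \<bullet> e\<bar>))"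
      using id ih by (simp add: right_diff_distrib)
  qed
  then show ?thesis by eventually_elim simp
qed

end

lemma norm_gradient_abs_le:
  fixes f h :: "real^'n \<Rightarrow> real"
  assumes "weak_gradient f Df" "f \<in> borel_measurable borel" "Df \<in> borel_measurable borel"
    and "C1 h hg" "\<And>x. \<bar>f x\<bar> = h x"
  shows "AE x in lborel. (norm (hg x))\<^sup>2 \<le> (norm (Df x))\<^sup>2"
proof -
  have "AE x in lborel. \<forall>i\<in>UNIV. \<bar>hg x \<bullet> axis i 1\<bar> \<le> \<bar>Df x \<bullet> axis i 1\<bar>"
    using abs_gradient_le[OF assms] by (intro AE_finite_allI) auto
  then show ?thesis
  proof eventually_elim
    case (elim x)
    then have "(hg x $ i)\<^sup>2 \<le> (Df x $ i)\<^sup>2" for i by (simp add: inner_axis abs_le_square_iff)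
    then show ?case
      unfolding power2_norm_eq_inner inner_vec_def by (intro sum_mono) (simp add: power2_eq_square)
  qed
qed

subsection \<open>Gaussian measures\<close>

lemma gauss_pos: "\<beta> > 0 \<Longrightarrow> gauss \<beta> x > 0"
  unfolding gauss_def by simp

lemma gauss_nonneg: "0 \<le> gauss \<beta> x"
  unfolding gauss_def by simp

lemma gauss_measurable [measurable]: "gauss \<beta> \<in> borel_measurable borel"
  unfolding gauss_def[abs_def] by measurable

lemma norm_sq_sum: "(norm (x :: real^'n))\<^sup>2 = (\<Sum>i\<in>UNIV. (x $ i)\<^sup>2)"
  unfolding power2_norm_eq_inner inner_vec_def by (simp add: power2_eq_square)

lemma gauss_prod:
  fixes x :: "real^'n"
  assumes "\<beta> > 0"
  shows "gauss \<beta> x = (\<Prod>i\<in>UNIV. normal_density 0 (sqrt \<beta>) (x $ i))"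
proof -
  have "(\<Prod>i\<in>UNIV. normal_density 0 (sqrt \<beta>) (x $ i))
      = (1 / sqrt (2 * pi * \<beta>)) ^ CARD('n) * exp (\<Sum>i\<in>UNIV. - ((x $ i)\<^sup>2 / (2 * \<beta>)))"
    using assms unfolding normal_density_def prod.distrib exp_sum[OF finite] by simp
  also have "(\<Sum>i\<in>UNIV. - ((x $ i)\<^sup>2 / (2 * \<beta>))) = - ((norm x)\<^sup>2 / (2 * \<beta>))"
    by (simp add: norm_sq_sum sum_negf sum_divide_distrib)
  also have "(1 / sqrt (2 * pi * \<beta>)) ^ CARD('n) = (2 * pi * \<beta>) powr (- (real CARD('n) / 2))"
  proof -
    have "1 / sqrt (2 * pi * \<beta>) = (2 * pi * \<beta>) powr (- (1 / 2))"
      using assms by (simp add: powr_minus powr_half_sqrt divide_simps)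
    then have "(1 / sqrt (2 * pi * \<beta>)) ^ CARD('n) = ((2 * pi * \<beta>) powr (- (1 / 2))) powr (real CARD('n))"
      using assms by (simp add: powr_realpow)
    then show ?thesis by (simp add: powr_powr)
  qed
  finally show ?thesis unfolding gauss_def by simp
qed

lemma nn_integral_gauss:
  assumes "\<beta> > 0"
  shows "(\<integral>\<^sup>+x. ennreal (gauss \<beta> (x :: real^'n)) \<partial>lborel) = 1"
proof -
  have 1: "(\<integral>\<^sup>+t. ennreal (normal_density 0 (sqrt \<beta>) t) \<partial>lborel) = 1"
    using assms by (subst nn_integral_eq_integral) auto
  have "ennreal (gauss \<beta> x) = (\<Prod>b\<in>Basis. ennreal (normal_density 0 (sqrt \<beta>) (x \<bullet> b)))" for x :: "real^'n"
  proof -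
    have inj: "inj (\<lambda>i. axis i (1::real) :: real^'n)" by (auto simp: inj_def axis_eq_axis)
    have B: "(Basis :: (real^'n) set) = range (\<lambda>i. axis i 1)" by (auto simp: Basis_vec_def)
    show ?thesis
      unfolding B prod.reindex[OF inj] gauss_prod[OF assms]
      by (simp add: prod_ennreal inner_axis)
  qed
  then have "(\<integral>\<^sup>+x. ennreal (gauss \<beta> (x :: real^'n)) \<partial>lborel)
      = (\<integral>\<^sup>+x. (\<Prod>b\<in>Basis. ennreal (normal_density 0 (sqrt \<beta>) (x \<bullet> b))) \<partial>(lborel :: (real^'n) measure))"
    by simp
  also have "\<dots> = (\<Prod>b\<in>(Basis :: (real^'n) set). \<integral>\<^sup>+t. ennreal (normal_density 0 (sqrt \<beta>) t) \<partial>lborel)"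
    by (rule nn_integral_lborel_prod) auto
  finally show ?thesis by (simp add: 1)
qed

lemma space_weighted [simp]: "space (weighted \<rho>) = UNIV"
  by (simp add: weighted_def)

lemma sets_weighted [simp, measurable_cong]: "sets (weighted \<rho>) = sets borel"
  by (simp add: weighted_def)

lemma prob_space_gauss: "\<beta> > 0 \<Longrightarrow> prob_space (weighted (gauss \<beta>) :: (real^'n) measure)"
  by (intro prob_spaceI) (simp add: weighted_def emeasure_density nn_integral_gauss)

lemma integral_weighted_gauss:
  fixes f :: "real^'n \<Rightarrow> real"
  assumes "f \<in> borel_measurable borel"
  shows "(\<integral>x. f x \<partial>weighted (gauss \<beta>)) = (LBINT x. gauss \<beta> x * f x)"
  unfolding weighted_def using assms gauss_nonneg by (subst integral_density) auto

lemma integrable_weighted_gauss: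
  fixes f :: "real^'n \<Rightarrow> real"
  assumes "f \<in> borel_measurable borel"
  shows "integrable (weighted (gauss \<beta>)) f \<longleftrightarrow> integrable lborel (\<lambda>x. gauss \<beta> x * f x)"
  unfolding weighted_def using assms gauss_nonneg by (subst integrable_density) auto

lemma nn_integral_lborel_translate:
  fixes f :: "'a::euclidean_space \<Rightarrow> ennreal"
  assumes "f \<in> borel_measurable borel"
  shows "(\<integral>\<^sup>+x. f (a + x) \<partial>lborel) = (\<integral>\<^sup>+x. f x \<partial>lborel)"
  using assms nn_integral_distr[of "(+) a" lborel borel f] by (simp add: lborel_distr_plus)

section \<open>Exponential and power moments\<close>

text \<open>Completing the square turns the factor exp (p . y) into a shift of the Gaussian by
  \<beta> p. All the moments below are extracted from this formula.\<close>

lemma gauss_mgf: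
  fixes p :: "real^'n"
  assumes b: "\<beta> > 0"
  shows "integrable (weighted (gauss \<beta>)) (\<lambda>y. exp (p \<bullet> y))"
    and "(\<integral>y. exp (p \<bullet> y) \<partial>weighted (gauss \<beta>)) = exp (\<beta> * (norm p)\<^sup>2 / 2)"
proof -
  have sq: "gauss \<beta> y * exp (p \<bullet> y) = exp (\<beta> * (norm p)\<^sup>2 / 2) * gauss \<beta> (- (\<beta> *\<^sub>R p) + y)" for y
  proof -
    have "(norm (- (\<beta> *\<^sub>R p) + y))\<^sup>2 = (norm y)\<^sup>2 - 2 * \<beta> * (p \<bullet> y) + \<beta>\<^sup>2 * (norm p)\<^sup>2"
      unfolding power2_norm_eq_inner by (simp add: inner_simps inner_commute power2_eq_square algebra_simps)
    then have "- ((norm y)\<^sup>2 / (2 * \<beta>)) + p \<bullet> y = \<beta> * (norm p)\<^sup>2 / 2 + - ((norm (- (\<beta> *\<^sub>R p) + y))\<^sup>2 / (2 * \<beta>))"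
      using b by (simp add: field_simps power2_eq_square)
    then show ?thesis
      unfolding gauss_def by (simp add: exp_add[symmetric] mult.assoc mult.left_commute[of "exp _"])
  qed
  have "(\<integral>\<^sup>+y. ennreal (exp (p \<bullet> y)) \<partial>weighted (gauss \<beta>)) = (\<integral>\<^sup>+y. ennreal (gauss \<beta> y * exp (p \<bullet> y)) \<partial>lborel)"
    unfolding weighted_def by (subst nn_integral_density) (auto simp: ennreal_mult' gauss_nonneg)
  also have "\<dots> = ennreal (exp (\<beta> * (norm p)\<^sup>2 / 2)) * (\<integral>\<^sup>+y. ennreal (gauss \<beta> (- (\<beta> *\<^sub>R p) + y)) \<partial>lborel)"
    unfolding sq by (subst nn_integral_cmult[symmetric]) (auto simp: ennreal_mult' gauss_nonneg)
  also have "\<dots> = ennreal (exp (\<beta> * (norm p)\<^sup>2 / 2))"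
    using nn_integral_lborel_translate[of "\<lambda>y. ennreal (gauss \<beta> y)" "- (\<beta> *\<^sub>R p)"] nn_integral_gauss[OF b, where 'n = 'n]
    by simp
  finally have n: "(\<integral>\<^sup>+y. ennreal (exp (p \<bullet> y)) \<partial>weighted (gauss \<beta>)) = ennreal (exp (\<beta> * (norm p)\<^sup>2 / 2))" .
  have m: "(\<lambda>y. exp (p \<bullet> y)) \<in> borel_measurable (weighted (gauss \<beta>))" by measurable
  show "integrable (weighted (gauss \<beta>)) (\<lambda>y. exp (p \<bullet> y))"
    by (rule integrableI_nn_integral_finite[OF m _ n]) auto
  show "(\<integral>y. exp (p \<bullet> y) \<partial>weighted (gauss \<beta>)) = exp (\<beta> * (norm p)\<^sup>2 / 2)"
    by (rule integral_eq_nn_integral[OF m, THEN trans]) (auto simp: n)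
qed

text \<open>The difference e^x + e^-x - 2 is the square of 2 sinh (x/2), and 2 sinh y >= 2 y for y
  >= 0. The latter follows from e^y >= 1 + y + y^2/2 and (1 + y + y^2/2) (1 - y + y^2/2) = 1 + y^4/4
  >= 1.\<close>

lemma exp_symmetric_ge_square: "x\<^sup>2 + 2 \<le> exp x + exp (- (x::real))"
proof -
  have *: "2 * y \<le> exp y - exp (- y)" if "0 \<le> y" for y :: real
  proof -
    have 1: "1 + y + y\<^sup>2 / 2 \<le> exp y" by (rule exp_lower_Taylor_quadratic[OF that])
    have p: "0 < 1 + y + y\<^sup>2 / 2" using that by (smt (verit) zero_le_power2 divide_nonneg_pos)
    have "(1 + y + y\<^sup>2 / 2) * (1 - y + y\<^sup>2 / 2) = 1 + (y\<^sup>2 / 2)\<^sup>2"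
      by (simp add: power2_eq_square field_simps)
    then have "1 \<le> (1 - y + y\<^sup>2 / 2) * (1 + y + y\<^sup>2 / 2)" by (simp add: mult.commute)
    then have "1 / (1 + y + y\<^sup>2 / 2) \<le> 1 - y + y\<^sup>2 / 2"
      using p by (simp add: pos_divide_le_eq)
    moreover have "exp (- y) \<le> 1 / (1 + y + y\<^sup>2 / 2)"
      using 1 p by (simp add: exp_minus field_simps)
    ultimately show ?thesis using 1 by linarith
  qed
  define z where "z = \<bar>x\<bar> / 2"
  have "(2 * z)\<^sup>2 \<le> (exp z - exp (- z))\<^sup>2"
    using *[of z] by (intro power_mono) (auto simp: z_def)
  also have "\<dots> = exp (2 * z) + exp (- (2 * z)) - 2"
    by (simp add: power2_eq_square algebra_simps exp_add[symmetric])
  also have "\<dots> = exp x + exp (- x) - 2" by (cases "x \<ge> 0") (auto simp: z_def)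
  finally show ?thesis by (simp add: z_def)
qed

text \<open>The constant is 4^4, from e^|x| >= (1 + |x|/4)^4.\<close>

lemma exp_symmetric_ge_fourth: "x ^ 4 \<le> 256 * (exp x + exp (- (x::real)))"
proof -
  have "(\<bar>x\<bar> / 4) ^ 4 \<le> (1 + \<bar>x\<bar> / real 4) ^ 4" by (intro power_mono) auto
  also have "\<dots> \<le> exp \<bar>x\<bar>" by (rule exp_ge_one_plus_x_over_n_power_n) auto
  also have "\<dots> \<le> exp x + exp (- x)" by (cases "x \<ge> 0") auto
  finally show ?thesis by (simp add: power_divide)
qed

text \<open>With u = \<beta> |p|^2 / 2, the bound s^2 (p . y)^2 <= e^(s p . y) + e^(- s p . y) - 2
  integrates to 2 (e^(s^2 u) - 1). Dividing by s^2 and letting s -> 0 gives the sharp constant,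
  which becomes the constant of the logarithmic Sobolev inequality.\<close>

lemma gauss_second_moment:
  fixes p :: "real^'n"
  assumes b: "\<beta> > 0"
  shows "integrable (weighted (gauss \<beta>)) (\<lambda>y. (p \<bullet> y)\<^sup>2)"
    and "(\<integral>y. (p \<bullet> y)\<^sup>2 \<partial>weighted (gauss \<beta>)) \<le> \<beta> * (norm p)\<^sup>2"
proof -
  interpret prob_space "weighted (gauss \<beta>) :: (real^'n) measure" by (rule prob_space_gauss[OF b])
  have i: "integrable (weighted (gauss \<beta>)) (\<lambda>y. exp ((s *\<^sub>R p) \<bullet> y) + exp ((- s *\<^sub>R p) \<bullet> y) - 2)" for s
    by (intro Bochner_Integration.integrable_diff Bochner_Integration.integrable_add gauss_mgf(1)[OF b]) auto
  have le: "(s * (p \<bullet> y))\<^sup>2 \<le> exp ((s *\<^sub>R p) \<bullet> y) + exp ((- s *\<^sub>R p) \<bullet> y) - 2" for s y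
    using exp_symmetric_ge_square[of "s * (p \<bullet> y)"] by simp
  show int: "integrable (weighted (gauss \<beta>)) (\<lambda>y. (p \<bullet> y)\<^sup>2)"
    by (rule Bochner_Integration.integrable_bound[OF i[of 1]])
       (use le[of 1] in \<open>auto intro!: AE_I2 intro: order_trans[OF _ abs_ge_self]\<close>)
  let ?I = "\<integral>y. (p \<bullet> y)\<^sup>2 \<partial>weighted (gauss \<beta>)"
  define u where "u = \<beta> * (norm p)\<^sup>2 / 2"
  have u0: "u \<ge> 0" using b by (simp add: u_def)
  have est: "?I \<le> 2 * u + 2 * u\<^sup>2 * s\<^sup>2" if s: "s > 0" "s\<^sup>2 * u \<le> 1" for s
  proof -
    have "s\<^sup>2 * ?I = (\<integral>y. (s * (p \<bullet> y))\<^sup>2 \<partial>weighted (gauss \<beta>))"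
      by (simp add: power_mult_distrib)
    also have "\<dots> \<le> (\<integral>y. exp ((s *\<^sub>R p) \<bullet> y) + exp ((- s *\<^sub>R p) \<bullet> y) - 2 \<partial>weighted (gauss \<beta>))"
    proof (rule integral_mono)
      show "integrable (weighted (gauss \<beta>)) (\<lambda>y. (s * (p \<bullet> y))\<^sup>2)"
        using int by (simp add: power_mult_distrib)
    qed (rule i, rule le)
    also have "\<dots> = 2 * exp (s\<^sup>2 * u) - 2"
      using gauss_mgf[OF b, of "s *\<^sub>R p"] gauss_mgf[OF b, of "- s *\<^sub>R p"] prob_space
      by (simp add: power_mult_distrib u_def algebra_simps)
    also have "\<dots> \<le> 2 * (s\<^sup>2 * u + (s\<^sup>2 * u)\<^sup>2)"
      using exp_bound[of "s\<^sup>2 * u"] s u0 by simp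
    also have "\<dots> = s\<^sup>2 * (2 * u + 2 * u\<^sup>2 * s\<^sup>2)"
      by (simp add: power2_eq_square algebra_simps)
    finally show ?thesis using s by simp
  qed
  define s :: "nat \<Rightarrow> real" where "s k = inverse (real (Suc k))" for k
  have s0: "s \<longlonglongrightarrow> 0" unfolding s_def by (rule LIMSEQ_inverse_real_of_nat)
  have "(\<lambda>k. 2 * u + 2 * u\<^sup>2 * (s k)\<^sup>2) \<longlonglongrightarrow> 2 * u + 2 * u\<^sup>2 * 0\<^sup>2"
    by (intro tendsto_intros s0)
  moreover have "\<forall>\<^sub>F k in sequentially. ?I \<le> 2 * u + 2 * u\<^sup>2 * (s k)\<^sup>2"
  proof -
    have "(\<lambda>k. (s k)\<^sup>2 * u) \<longlonglongrightarrow> 0\<^sup>2 * u" by (intro tendsto_intros s0)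
    then have "\<forall>\<^sub>F k in sequentially. (s k)\<^sup>2 * u < 1" by (intro order_tendstoD(2)) auto
    then show ?thesis
      by eventually_elim (auto simp: s_def intro!: est)
  qed
  ultimately have "?I \<le> 2 * u + 2 * u\<^sup>2 * 0\<^sup>2"
    by (rule tendsto_lowerbound) simp
  then show "?I \<le> \<beta> * (norm p)\<^sup>2" by (simp add: u_def)
qed

text \<open>The second moment enters the leading term and is sharp. Of the fourth moment only the
  order \<beta>^2 matters, so its constant is generous.\<close>

lemma gauss_norm_moments:
  assumes b: "\<beta> > 0"
  defines "M \<equiv> weighted (gauss \<beta>) :: (real^'n) measure"
  defines "n \<equiv> real CARD('n)"
  shows "integrable M (\<lambda>y. (norm y)\<^sup>2)" "(\<integral>y. (norm y)\<^sup>2 \<partial>M) \<le> n * \<beta>"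
    and "integrable M (\<lambda>y. (norm y) ^ 4)" "(\<integral>y. (norm y) ^ 4 \<partial>M) \<le> 1024 * n\<^sup>2 * \<beta>\<^sup>2"
proof -
  have sq: "(norm y)\<^sup>2 = (\<Sum>i\<in>UNIV. (axis i 1 \<bullet> y)\<^sup>2)" for y :: "real^'n"
    by (simp add: norm_sq_sum inner_axis')
  note s = gauss_second_moment[OF b, of "axis _ 1 :: real^'n", folded M_def]
  show "integrable M (\<lambda>y. (norm y)\<^sup>2)" unfolding sq using s(1) by simp
  have "(\<integral>y. (norm y)\<^sup>2 \<partial>M) = (\<Sum>i\<in>UNIV. \<integral>y. (axis i 1 \<bullet> y)\<^sup>2 \<partial>M)" unfolding sq using s(1) by simp
  also have "\<dots> \<le> (\<Sum>i\<in>(UNIV::'n set). \<beta>)" using s(2) by (intro sum_mono) simp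
  finally show "(\<integral>y. (norm y)\<^sup>2 \<partial>M) \<le> n * \<beta>" by (simp add: n_def)
  \<comment> \<open>Rescaling to unit variance: each exponential then integrates to e^(1/2) <= 2,
    and 256 * 2 * 2 = 1024.\<close>
  define q where "q = 1 / sqrt \<beta>"
  have q: "q > 0" "q\<^sup>2 * \<beta> = 1" "q ^ 4 = 1 / \<beta>\<^sup>2" using b by (auto simp: q_def power_divide power4_eq_xxxx power2_eq_square)
  define E where "E i y = 256 * \<beta>\<^sup>2 * (exp ((q *\<^sub>R axis i 1) \<bullet> y) + exp ((- q *\<^sub>R axis i 1) \<bullet> y))" for i and y :: "real^'n"
  have iE: "integrable M (E i)" for i
    unfolding E_def M_def using gauss_mgf(1)[OF b]
    by (intro integrable_mult_right Bochner_Integration.integrable_add)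
  have EE: "(\<integral>y. E i y \<partial>M) \<le> 1024 * \<beta>\<^sup>2" for i
  proof -
    have e: "exp (1 / 2 :: real) \<le> 2"
      using exp_bound[of "1/2"] by (simp add: power2_eq_square)
    have "(\<integral>y. E i y \<partial>M) = 256 * \<beta>\<^sup>2 * (2 * exp (1 / 2))"
      unfolding E_def M_def using gauss_mgf[OF b, of "q *\<^sub>R axis i 1"] gauss_mgf[OF b, of "- q *\<^sub>R axis i 1"] q
      by (simp add: power_mult_distrib mult.commute)
    also have "\<dots> \<le> 256 * \<beta>\<^sup>2 * (2 * 2)" using e by (intro mult_left_mono) auto
    finally show ?thesis by simp
  qed
  have le: "(norm y) ^ 4 \<le> n * (\<Sum>i\<in>UNIV. E i y)" for y
  proof -
    have c: "(y $ i) ^ 4 \<le> E i y" for i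
    proof -
      have "(q * y $ i) ^ 4 \<le> 256 * (exp (q * y $ i) + exp (- (q * y $ i)))" by (rule exp_symmetric_ge_fourth)
      then have "(y $ i) ^ 4 / \<beta>\<^sup>2 \<le> 256 * (exp (q * y $ i) + exp (- (q * y $ i)))"
        by (simp add: power_mult_distrib q)
      then show ?thesis using b by (simp add: E_def inner_axis' field_simps)
    qed
    have "(norm y) ^ 4 = (\<Sum>i\<in>UNIV. (y $ i)\<^sup>2)\<^sup>2"
      by (simp add: norm_sq_sum[symmetric] power_mult[symmetric])
    also have "\<dots> \<le> n * (\<Sum>i\<in>UNIV. ((y $ i)\<^sup>2)\<^sup>2)"
      unfolding n_def using sum_squared_le_sum_of_squares[of "\<lambda>i. (y $ i)\<^sup>2" "UNIV::'n set"] by (simp add: mult.commute)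
    also have "\<dots> \<le> n * (\<Sum>i\<in>UNIV. E i y)"
      using c by (intro mult_left_mono sum_mono) (auto simp: n_def)
    finally show ?thesis .
  qed
  have iS: "integrable M (\<lambda>y. n * (\<Sum>i\<in>UNIV. E i y))" using iE by simp
  show i4: "integrable M (\<lambda>y. (norm y) ^ 4)"
    by (rule Bochner_Integration.integrable_bound[OF iS]) (use le in \<open>auto simp: M_def intro: order_trans[OF _ abs_ge_self]\<close>)
  have "(\<integral>y. (norm y) ^ 4 \<partial>M) \<le> (\<integral>y. n * (\<Sum>i\<in>UNIV. E i y) \<partial>M)"
    by (rule integral_mono[OF i4 iS le])
  also have "\<dots> = n * (\<Sum>i\<in>UNIV. \<integral>y. E i y \<partial>M)" using iE by simp
  also have "\<dots> \<le> n * (\<Sum>i\<in>(UNIV::'n set). 1024 * \<beta>\<^sup>2)"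
    using EE by (intro mult_left_mono sum_mono) (auto simp: n_def)
  finally show "(\<integral>y. (norm y) ^ 4 \<partial>M) \<le> 1024 * n\<^sup>2 * \<beta>\<^sup>2" by (simp add: n_def power2_eq_square algebra_simps)
qed

section \<open>The Gaussian semigroup\<close>

text \<open>Completing the square in y: the product is the density of variance s + t at x times that
  of variance r = s t / (s + t) centred at a = s x / (s + t), and the second factor integrates to
  1.\<close>

lemma gauss_convolution_density:
  fixes x :: "real^'n"
  assumes s: "s > 0" and t: "t > 0"
  shows "(\<integral>\<^sup>+y. ennreal (gauss s y * gauss t (x - y)) \<partial>lborel) = ennreal (gauss (s + t) x)"
proof -
  define r where "r = s * t / (s + t)"
  have r: "r > 0" using s t by (simp add: r_def)
  define a where "a = (s / (s + t)) *\<^sub>R x"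
  have eq: "gauss s y * gauss t (x - y) = gauss (s + t) x * gauss r (- a + y)" for y
  proof -
    have "(norm y)\<^sup>2 / (2 * s) + (norm (x - y))\<^sup>2 / (2 * t) = (norm x)\<^sup>2 / (2 * (s + t)) + (norm (- a + y))\<^sup>2 / (2 * r)"
    proof -
      define N P Y d where "N = x \<bullet> x" and "P = x \<bullet> y" and "Y = y \<bullet> y" and "d = s + t"
      have d: "d > 0" "t = d - s" using s t by (auto simp: d_def)
      have "(norm (x - y))\<^sup>2 = N - 2 * P + Y"
        unfolding power2_norm_eq_inner N_def P_def Y_def by (simp add: inner_simps inner_commute)
      moreover have "(norm (- a + y))\<^sup>2 = Y - 2 * (s / d) * P + (s / d)\<^sup>2 * N"
        unfolding power2_norm_eq_inner N_def P_def Y_def a_def d_def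
        by (simp add: inner_simps inner_commute power2_eq_square algebra_simps)
      moreover have "Y / (2 * s) + (N - 2 * P + Y) / (2 * t)
          = N / (2 * d) + (Y - 2 * (s / d) * P + (s / d)\<^sup>2 * N) * (d / (2 * s * t))"
      proof -
        have "(Y / (2 * s) + (N - 2 * P + Y) / (2 * t)) * (2 * s * t * d)
          = (N / (2 * d) + (Y - 2 * (s / d) * P + (s / d)\<^sup>2 * N) * (d / (2 * s * t))) * (2 * s * t * d)"
        proof -
          have "(Y / (2 * s) + (N - 2 * P + Y) / (2 * t)) * (2 * s * t * d) = Y * t * d + (N - 2 * P + Y) * s * d"
            using s t by (simp add: field_simps)
          moreover have "(N / (2 * d) + (Y - 2 * (s / d) * P + (s / d)\<^sup>2 * N) * (d / (2 * s * t))) * (2 * s * t * d)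
            = N * s * t + (Y * d\<^sup>2 - 2 * s * d * P + s\<^sup>2 * N)"
            using s t d(1) by (simp add: power2_eq_square field_simps)
          moreover have "Y * t * d + (N - 2 * P + Y) * s * d = N * s * t + (Y * d\<^sup>2 - 2 * s * d * P + s\<^sup>2 * N)"
            unfolding d_def by (simp add: power2_eq_square algebra_simps)
          ultimately show ?thesis by simp
        qed
        then show ?thesis using s t d by simp
      qed
      ultimately show ?thesis
        unfolding r_def power2_norm_eq_inner[of x] power2_norm_eq_inner[of y] d_def N_def Y_def P_def by simp
    qed
    then have e: "exp (- ((norm y)\<^sup>2 / (2 * s))) * exp (- ((norm (x - y))\<^sup>2 / (2 * t)))
       = exp (- ((norm x)\<^sup>2 / (2 * (s + t)))) * exp (- ((norm (- a + y))\<^sup>2 / (2 * r)))"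
      unfolding exp_add[symmetric] by simp
    have "2 * pi * s * (2 * pi * t) = 2 * pi * (s + t) * (2 * pi * r)" using s t by (simp add: r_def)
    then have "(2 * pi * s) powr c * (2 * pi * t) powr c = (2 * pi * (s + t)) powr c * (2 * pi * r) powr c" for c
      using s t r by (metis (no_types, lifting) powr_mult mult_nonneg_nonneg pi_ge_zero zero_le_numeral less_imp_le add_nonneg_nonneg)
    then show ?thesis using e unfolding gauss_def by (simp add: mult_ac)
  qed
  have "(\<integral>\<^sup>+y. ennreal (gauss s y * gauss t (x - y)) \<partial>lborel) = ennreal (gauss (s + t) x) * (\<integral>\<^sup>+y. ennreal (gauss r (- a + y)) \<partial>lborel)"
    unfolding eq by (subst nn_integral_cmult[symmetric]) (auto simp: ennreal_mult' gauss_nonneg)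
  also have "(\<integral>\<^sup>+y. ennreal (gauss r (- a + y)) \<partial>lborel) = 1"
    using nn_integral_lborel_translate[of "\<lambda>y. ennreal (gauss r y)" "- a"] nn_integral_gauss[OF r, where 'n = 'n] by simp
  finally show ?thesis by simp
qed

lemma gauss_convolution:
  assumes s: "s > 0" and t: "t > 0"
  shows "weighted (gauss (s + t)) = distr (weighted (gauss s) \<Otimes>\<^sub>M weighted (gauss t)) borel (\<lambda>(y, z). y + z :: real^'n)"
    (is "?L = distr (?S \<Otimes>\<^sub>M ?T) borel ?f")
proof (rule measure_eqI)
  interpret S: prob_space ?S by (rule prob_space_gauss[OF s])
  interpret T: prob_space ?T by (rule prob_space_gauss[OF t])
  fix A assume "A \<in> sets ?L"
  then have A [measurable]: "A \<in> sets borel" by simp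
  have "emeasure (distr (?S \<Otimes>\<^sub>M ?T) borel ?f) A = (\<integral>\<^sup>+p. indicator A (?f p) \<partial>(?S \<Otimes>\<^sub>M ?T))"
    by (subst nn_integral_indicator[symmetric], simp, subst nn_integral_distr) auto
  also have "\<dots> = (\<integral>\<^sup>+y. \<integral>\<^sup>+z. indicator A (y + z) \<partial>?T \<partial>?S)"
    by (subst T.nn_integral_fst[symmetric]) auto
  also have "\<dots> = (\<integral>\<^sup>+y. ennreal (gauss s y) * (\<integral>\<^sup>+z. ennreal (gauss t z) * indicator A (y + z) \<partial>lborel) \<partial>lborel)"
    unfolding weighted_def by (subst nn_integral_density, simp, measurable, subst nn_integral_density) auto
  also have "\<dots> = (\<integral>\<^sup>+y. (\<integral>\<^sup>+x. ennreal (gauss s y * gauss t (x - y)) * indicator A x \<partial>lborel) \<partial>lborel)"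
  proof (intro nn_integral_cong)
    fix y :: "real^'n"
    have "(\<integral>\<^sup>+z. ennreal (gauss t z) * indicator A (y + z) \<partial>lborel) = (\<integral>\<^sup>+x. ennreal (gauss t (x - y)) * indicator A x \<partial>lborel)"
      using nn_integral_lborel_translate[of "\<lambda>x. ennreal (gauss t (x - y)) * indicator A x" y] by simp
    then show "ennreal (gauss s y) * (\<integral>\<^sup>+z. ennreal (gauss t z) * indicator A (y + z) \<partial>lborel)
      = (\<integral>\<^sup>+x. ennreal (gauss s y * gauss t (x - y)) * indicator A x \<partial>lborel)"
      by (simp add: nn_integral_cmult[symmetric] ennreal_mult' gauss_nonneg mult.assoc)
  qed
  also have "\<dots> = (\<integral>\<^sup>+x. (\<integral>\<^sup>+y. ennreal (gauss s y * gauss t (x - y)) * indicator A x \<partial>lborel) \<partial>lborel)"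
    by (rule lborel_pair.Fubini') measurable
  also have "\<dots> = (\<integral>\<^sup>+x. ennreal (gauss (s + t) x) * indicator A x \<partial>lborel)"
    by (simp add: nn_integral_multc gauss_convolution_density[OF s t])
  also have "\<dots> = emeasure ?L A"
    unfolding weighted_def by (simp add: emeasure_density)
  finally show "emeasure ?L A = emeasure (distr (?S \<Otimes>\<^sub>M ?T) borel ?f) A" by simp
qed simp

lemma gauss_semigroup:
  fixes k :: "real^'n \<Rightarrow> real"
  assumes s: "s > 0" and t: "t > 0" and k [measurable]: "k \<in> borel_measurable borel" and B: "\<And>x. \<bar>k x\<bar> \<le> B"
  shows "(\<integral>x. k x \<partial>weighted (gauss (s + t))) = (\<integral>y. (\<integral>z. k (y + z) \<partial>weighted (gauss t)) \<partial>weighted (gauss s))"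
proof -
  interpret S: prob_space "weighted (gauss s) :: (real^'n) measure" by (rule prob_space_gauss[OF s])
  interpret T: prob_space "weighted (gauss t) :: (real^'n) measure" by (rule prob_space_gauss[OF t])
  interpret pair_prob_space "weighted (gauss s) :: (real^'n) measure" "weighted (gauss t) :: (real^'n) measure" ..
  have "integrable (weighted (gauss s) \<Otimes>\<^sub>M weighted (gauss t)) (\<lambda>p. k (fst p + snd p))"
    by (rule P.integrable_const_bound[of _ B]) (use B in auto)
  then show ?thesis
    unfolding gauss_convolution[OF s t]
    by (subst integral_distr) (auto simp: case_prod_beta integral_fst'[symmetric])
qed

subsection \<open>Short Gaussian steps\<close>

text \<open>The graph of the convex function r ln r lies above its tangent at c; in logarithmic form
  this is ln t <= t - 1.\<close>

lemma entropy_tangent: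
  fixes r c :: real
  assumes "r > 0" "c > 0"
  shows "c * ln c + (ln c + 1) * (r - c) \<le> r * ln r"
proof -
  have "r * ln (c / r) \<le> r * (c / r - 1)"
    using assms by (intro mult_left_mono ln_le_minus_one) auto
  then show ?thesis using assms by (simp add: ln_div algebra_simps)
qed

lemma ln_one_minus_le:
  fixes y :: real
  assumes "0 \<le> y" "y < 1"
  shows "ln (1 - y) \<le> - y - y\<^sup>2 / 2"
proof -
  have "- 0 - 0\<^sup>2 / 2 - ln (1 - 0) \<le> - y - y\<^sup>2 / 2 - ln (1 - y)"
  proof (rule DERIV_nonneg_imp_nondecreasing[OF assms(1)])
    fix x assume x: "0 \<le> x" "x \<le> y"
    have "((\<lambda>x. - x - x\<^sup>2 / 2 - ln (1 - x)) has_real_derivative x\<^sup>2 / (1 - x)) (at x)"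
      using x assms by (auto intro!: derivative_eq_intros simp: field_simps power2_eq_square)
    then show "\<exists>y. ((\<lambda>x. - x - x\<^sup>2 / 2 - ln (1 - x)) has_real_derivative y) (at x) \<and> 0 \<le> y"
      using x assms by (intro exI[of _ "x\<^sup>2 / (1 - x)"]) auto
  qed
  then show ?thesis by simp
qed

text \<open>A Taylor bound at 1 with sharp quadratic coefficient, valid up to r = 0. For r >= 1 the
  quadratic term suffices; for r = 1 - y the cubic one arises from expanding (1 - y) (- y -
  y^2/2).\<close>

lemma entropy_upper_one:
  fixes r :: real
  assumes "r > 0"
  shows "r * ln r - r + 1 \<le> (r - 1)\<^sup>2 / 2 + \<bar>r - 1\<bar> ^ 3 / 2"
proof (cases "r \<ge> 1")
  case True
  have "(1 - 1)\<^sup>2 / 2 - (1 * ln 1 - 1 + 1) \<le> (r - 1)\<^sup>2 / 2 - (r * ln r - r + 1)"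
  proof (rule DERIV_nonneg_imp_nondecreasing[OF True])
    fix x assume x: "1 \<le> x" "x \<le> r"
    have "((\<lambda>x. (x - 1)\<^sup>2 / 2 - (x * ln x - x + 1)) has_real_derivative x - 1 - ln x) (at x)"
      using x by (auto intro!: derivative_eq_intros)
    then show "\<exists>y. ((\<lambda>x. (x - 1)\<^sup>2 / 2 - (x * ln x - x + 1)) has_real_derivative y) (at x) \<and> 0 \<le> y"
      using x ln_le_minus_one[of x] by (intro exI[of _ "x - 1 - ln x"]) auto
  qed
  then have "r * ln r - r + 1 \<le> (r - 1)\<^sup>2 / 2" by simp
  moreover have "0 \<le> \<bar>r - 1\<bar> ^ 3 / 2" by simp
  ultimately show ?thesis by linarith
next
  case False
  define y where "y = 1 - r"
  have y: "0 \<le> y" "y < 1" using False assms by (auto simp: y_def)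
  have "(1 - y) * ln (1 - y) \<le> (1 - y) * (- y - y\<^sup>2 / 2)"
    using y by (intro mult_left_mono ln_one_minus_le) auto
  also have "\<dots> = - y + y\<^sup>2 / 2 + y ^ 3 / 2" by (simp add: power2_eq_square power3_eq_cube field_simps)
  finally have "(1 - y) * ln (1 - y) \<le> - y + y\<^sup>2 / 2 + y ^ 3 / 2" .
  moreover have "r = 1 - y" "\<bar>r - 1\<bar> = y" "(r - 1)\<^sup>2 = y\<^sup>2" using y by (auto simp: y_def power2_commute)
  ultimately show ?thesis by simp
qed

text \<open>The bound at 1 applied to r / c and multiplied by c.\<close>

lemma entropy_upper:
  fixes r c :: real
  assumes "r > 0" "c > 0"
  shows "r * ln r \<le> c * ln c + (ln c + 1) * (r - c) + (r - c)\<^sup>2 / (2 * c) + \<bar>r - c\<bar> ^ 3 / (2 * c\<^sup>2)"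
proof -
  have "c * (r / c * ln (r / c) - r / c + 1) \<le> c * ((r / c - 1)\<^sup>2 / 2 + \<bar>r / c - 1\<bar> ^ 3 / 2)"
    using assms by (intro mult_left_mono entropy_upper_one) auto
  moreover have "c * (r / c * ln (r / c) - r / c + 1) = r * ln r - c * ln c - (ln c + 1) * (r - c)"
    using assms by (simp add: ln_div algebra_simps)
  moreover have "r / c - 1 = (r - c) / c" using assms by (simp add: field_simps)
  moreover have "c * (((r - c) / c)\<^sup>2 / 2) = (r - c)\<^sup>2 / (2 * c)"
    using assms by (simp add: power2_eq_square)
  moreover have "c * (\<bar>(r - c) / c\<bar> ^ 3 / 2) = \<bar>r - c\<bar> ^ 3 / (2 * c\<^sup>2)"
    using assms by (simp add: abs_divide power_divide power2_eq_square power3_eq_cube)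
  ultimately show ?thesis by (simp add: distrib_left)
qed

text \<open>The error of a Gaussian step of variance \<delta> is \<delta> (\<open>err1\<close>
  \<epsilon> + \<open>err2\<close> sqrt \<delta>). It is essential that \<open>err1\<close> does not
  contain K, because K has to be chosen after \<epsilon> and may grow as \<epsilon> tends to
  0.\<close>

definition err1 :: "real \<Rightarrow> real \<Rightarrow> real \<Rightarrow> real" where
  "err1 n a L = L * n / a + L / a"

definition err2 :: "real \<Rightarrow> real \<Rightarrow> real \<Rightarrow> real \<Rightarrow> real" where
  "err2 n a L K = (L * K / a + L ^ 3 / (2 * a\<^sup>2)) * ((n + 1024 * n\<^sup>2) / 2)
        + (2 * L * K / a + L ^ 3 / a\<^sup>2) * (1 + n) / 4"

text \<open>The hypotheses are stable under averaging translates, uniformly in the constants. This lets the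
  logarithmic Sobolev inequality be proved by composing many short Gaussian steps.\<close>

locale almost_differentiable =
  fixes F :: "real^'n \<Rightarrow> real" and G :: "real^'n \<Rightarrow> real^'n" and a b L \<epsilon> K :: real
  assumes Fm [measurable]: "F \<in> borel_measurable borel" and Gm [measurable]: "G \<in> borel_measurable borel"
    and a: "a > 0" and F: "\<And>x. a \<le> F x" "\<And>x. F x \<le> b"
    and nn: "L \<ge> 0" "\<epsilon> \<ge> 0" "K \<ge> 0"
    and G: "\<And>x. norm (G x) \<le> L"
    and Flip: "\<And>x z. \<bar>F (x + z) - F x\<bar> \<le> L * norm z"
    and Ftaylor: "\<And>x z. \<bar>F (x + z) - F x - G x \<bullet> z\<bar> \<le> \<epsilon> * norm z + K * (norm z)\<^sup>2"
    and Gcont: "\<And>x z. norm (G (x + z) - G x) \<le> \<epsilon> + K * norm z"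
begin

lemma Fpos: "F x > 0"
  using a F(1)[of x] by linarith

lemma Fabs: "\<bar>F x\<bar> \<le> b"
  using Fpos[of x] F(2)[of x] by simp

text \<open>The density of the Fisher information of F.\<close>

definition Q :: "real^'n \<Rightarrow> real" where
  "Q x = (norm (G x))\<^sup>2 / F x"

lemma Qm [measurable]: "Q \<in> borel_measurable borel"
  unfolding Q_def[abs_def] by measurable

lemma Qbound: "\<bar>Q x\<bar> \<le> L\<^sup>2 / a"
  using Fpos[of x] F(1)[of x] G[of x] a nn
  by (auto simp: Q_def abs_divide intro!: frac_le power_mono)

lemma entropy_bound: "\<bar>F x * ln (F x)\<bar> \<le> b * b + b + 1"
proof -
  have "F x * ln (F x) \<le> F x * F x"
    using Fpos[of x] ln_le_minus_one[of "F x"] by (intro mult_left_mono) auto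
  also have "\<dots> \<le> b * b" using Fpos[of x] F(2)[of x] by (intro mult_mono) auto
  finally have 1: "F x * ln (F x) \<le> b * b" .
  have "1 * ln 1 + (ln 1 + 1) * (F x - 1) \<le> F x * ln (F x)"
    by (rule entropy_tangent) (use Fpos in auto)
  then have "- 1 \<le> F x * ln (F x)" using Fpos[of x] by simp
  then show ?thesis using 1 Fabs[of x] by (simp add: abs_le_iff)
     (smt (verit) mult_nonneg_nonneg)
qed

text \<open>Every condition bounds an expression linear in the pair (F, G), uniformly in x, and
  therefore passes to averages with the same constants.\<close>

lemma averaged:
  assumes M: "prob_space M" and [measurable_cong, simp]: "sets M = sets borel"
  shows "almost_differentiable (\<lambda>x. \<integral>y. F (x + y) \<partial>M) (\<lambda>x. \<integral>y. G (x + y) \<partial>M) a b L \<epsilon> K"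
proof -
  interpret M: prob_space M by fact
  have [simp]: "space M = UNIV" using sets_eq_imp_space_eq[of M borel] by simp
  have iF: "integrable M (\<lambda>y. F (x + y))" for x
    by (rule M.integrable_const_bound[of _ b]) (use Fabs in auto)
  have iG: "integrable M (\<lambda>y. G (x + y))" for x
    by (rule M.integrable_const_bound[of _ L]) (use G in auto)
  have [simp]: "measure M UNIV = 1" using M.prob_space by simp
  have const: "(\<integral>y. c \<partial>M) = c" for c :: real by simp
  have le: "norm (\<integral>y. f y \<partial>M) \<le> c" if "\<And>y. norm (f y) \<le> c" for f :: "real^'n \<Rightarrow> 'b::euclidean_space" and c
  proof -
    have "norm (\<integral>y. f y \<partial>M) \<le> (\<integral>y. c \<partial>M)"
    proof (cases "integrable M f")
      case True
      then have "norm (\<integral>y. f y \<partial>M) \<le> (\<integral>y. norm (f y) \<partial>M)" by (intro integral_norm_bound)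
      also have "\<dots> \<le> (\<integral>y. c \<partial>M)" using True that by (intro integral_mono) auto
      finally show ?thesis .
    next
      case False
      then show ?thesis using order_trans[OF norm_ge_zero that[of 0]] by (simp add: not_integrable_integral_eq const)
    qed
    then show ?thesis by (simp only: const)
  qed
  show ?thesis
  proof
    show "(\<lambda>x. \<integral>y. F (x + y) \<partial>M) \<in> borel_measurable borel"
      by (rule M.borel_measurable_lebesgue_integral) measurable
    show "(\<lambda>x. \<integral>y. G (x + y) \<partial>M) \<in> borel_measurable borel"
      by (rule M.borel_measurable_lebesgue_integral) measurable
    show "a \<le> (\<integral>y. F (x + y) \<partial>M)" "(\<integral>y. F (x + y) \<partial>M) \<le> b" for x
      using integral_mono[OF _ iF[of x], of "\<lambda>_. a"] integral_mono[OF iF[of x], of "\<lambda>_. b"] F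
      by (auto simp: const)
    show "norm (\<integral>y. G (x + y) \<partial>M) \<le> L" for x by (rule le[OF G])
    fix x z
    have d: "(\<integral>y. F (x + z + y) \<partial>M) - (\<integral>y. F (x + y) \<partial>M) = (\<integral>y. F (x + y + z) - F (x + y) \<partial>M)"
      using iF[of x] iF[of "x + z"] by (simp add: add.commute add.left_commute)
    show "\<bar>(\<integral>y. F (x + z + y) \<partial>M) - (\<integral>y. F (x + y) \<partial>M)\<bar> \<le> L * norm z"
      unfolding d using le[of "\<lambda>y. F (x + y + z) - F (x + y)" "L * norm z"] Flip by simp
    have iFd: "integrable M (\<lambda>y. F (x + y + z) - F (x + y))"
      using iF[of x] iF[of "x + z"] by (simp add: add.commute add.left_commute)
    have "(\<integral>y. F (x + y + z) - F (x + y) \<partial>M) - (\<integral>y. G (x + y) \<partial>M) \<bullet> z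
        = (\<integral>y. (F (x + y + z) - F (x + y)) - G (x + y) \<bullet> z \<partial>M)"
      using iFd iG[of x] by (subst Bochner_Integration.integral_diff) auto
    then show "\<bar>(\<integral>y. F (x + z + y) \<partial>M) - (\<integral>y. F (x + y) \<partial>M) - (\<integral>y. G (x + y) \<partial>M) \<bullet> z\<bar>
        \<le> \<epsilon> * norm z + K * (norm z)\<^sup>2"
      unfolding d using le[of "\<lambda>y. (F (x + y + z) - F (x + y)) - G (x + y) \<bullet> z" "\<epsilon> * norm z + K * (norm z)\<^sup>2"] Ftaylor
      by simp
    have "(\<integral>y. G (x + z + y) \<partial>M) - (\<integral>y. G (x + y) \<partial>M) = (\<integral>y. G (x + y + z) - G (x + y) \<partial>M)"
      using iG[of x] iG[of "x + z"] by (simp add: add.commute add.left_commute)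
    then show "norm ((\<integral>y. G (x + z + y) \<partial>M) - (\<integral>y. G (x + y) \<partial>M)) \<le> \<epsilon> + K * norm z"
      using le[of "\<lambda>y. G (x + y + z) - G (x + y)" "\<epsilon> + K * norm z"] Gcont by simp
  qed (rule a nn)+
qed

text \<open>|G|^2 / F is jointly convex: for each w it is at least 2 G . w - |w|^2 F, which is
  linear in (G, F). Averaging with w equal to the quotient of the two averages gives the
  claim.\<close>

lemma jensen_Q:
  assumes M: "prob_space M" and [measurable_cong, simp]: "sets M = sets borel"
  shows "(norm (\<integral>y. G (x + y) \<partial>M))\<^sup>2 / (\<integral>y. F (x + y) \<partial>M) \<le> (\<integral>y. Q (x + y) \<partial>M)"
proof -
  interpret M: prob_space M by fact
  have [simp]: "space M = UNIV" using sets_eq_imp_space_eq[of M borel] by simp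
  have iF: "integrable M (\<lambda>y. F (x + y))"
    by (rule M.integrable_const_bound[of _ b]) (use Fabs in auto)
  have iG: "integrable M (\<lambda>y. G (x + y))"
    by (rule M.integrable_const_bound[of _ L]) (use G in auto)
  have iQ: "integrable M (\<lambda>y. Q (x + y))"
    by (rule M.integrable_const_bound[of _ "L\<^sup>2 / a"]) (use Qbound in auto)
  define u m where "u = (\<integral>y. G (x + y) \<partial>M)" and "m = (\<integral>y. F (x + y) \<partial>M)"
  have "(\<integral>y. a \<partial>M) \<le> m" unfolding m_def using iF F by (intro integral_mono) auto
  then have m: "m > 0" using a M.prob_space by simp
  define w where "w = u /\<^sub>R m"
  have le: "2 * (G y \<bullet> w) - (norm w)\<^sup>2 * F y \<le> Q y" for y
  proof -
    have "0 \<le> (norm (G y - F y *\<^sub>R w))\<^sup>2" by simp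
    also have "\<dots> = (norm (G y))\<^sup>2 - 2 * F y * (G y \<bullet> w) + (F y)\<^sup>2 * (norm w)\<^sup>2"
      unfolding power2_norm_eq_inner by (simp add: inner_simps inner_commute power2_eq_square algebra_simps)
    finally have "(2 * (G y \<bullet> w) - (norm w)\<^sup>2 * F y) * F y \<le> (norm (G y))\<^sup>2"
      by (simp add: power2_eq_square algebra_simps)
    then show ?thesis unfolding Q_def using Fpos[of y] by (simp add: pos_le_divide_eq)
  qed
  have "(norm u)\<^sup>2 / m = 2 * (u \<bullet> w) - (norm w)\<^sup>2 * m"
    using m by (simp add: w_def power_mult_distrib power2_norm_eq_inner[symmetric] field_simps power2_eq_square)
  also have "\<dots> = (\<integral>y. 2 * (G (x + y) \<bullet> w) - (norm w)\<^sup>2 * F (x + y) \<partial>M)"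
    unfolding u_def m_def using iF iG by simp
  also have "\<dots> \<le> (\<integral>y. Q (x + y) \<partial>M)"
    using iF iG iQ le by (intro integral_mono) auto
  finally show ?thesis unfolding u_def m_def .
qed

text \<open>Taylor expansion yields Q at the base point, whereas composing steps requires its
  average. This bounds the loss in replacing one by the other; the part growing with |z| is of order
  sqrt \<delta> on average.\<close>

lemma Q_shift: "Q x - Q (x + z) \<le> 2 * L * \<epsilon> / a + (2 * L * K / a + L ^ 3 / a\<^sup>2) * norm z"
proof -
  have "(norm (G x))\<^sup>2 - (norm (G (x + z)))\<^sup>2 = (norm (G x) - norm (G (x + z))) * (norm (G x) + norm (G (x + z)))"
    by (simp add: power2_eq_square algebra_simps)
  also have "\<dots> \<le> (\<epsilon> + K * norm z) * (L + L)"
  proof (rule mult_mono)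
    show "norm (G x) - norm (G (x + z)) \<le> \<epsilon> + K * norm z"
      using Gcont[of x z] norm_triangle_ineq2[of "G x" "G (x + z)"] by (simp add: norm_minus_commute)
  qed (use G[of x] G[of "x + z"] nn in auto)
  finally have 1: "(norm (G x))\<^sup>2 - (norm (G (x + z)))\<^sup>2 \<le> 2 * L * (\<epsilon> + K * norm z)" by (simp add: mult.commute)
  have "((norm (G x))\<^sup>2 - (norm (G (x + z)))\<^sup>2) / F x \<le> (2 * L * (\<epsilon> + K * norm z)) / F x"
    using 1 Fpos[of x] by (simp add: divide_right_mono)
  also have "\<dots> \<le> (2 * L * (\<epsilon> + K * norm z)) / a"
    using F(1)[of x] a nn Fpos[of x] by (intro divide_left_mono) auto
  finally have A: "((norm (G x))\<^sup>2 - (norm (G (x + z)))\<^sup>2) / F x \<le> 2 * L * (\<epsilon> + K * norm z) / a" .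
  have "(norm (G (x + z)))\<^sup>2 / F x - (norm (G (x + z)))\<^sup>2 / F (x + z) = (norm (G (x + z)))\<^sup>2 * (F (x + z) - F x) / (F x * F (x + z))"
    using Fpos[of x] Fpos[of "x + z"] by (simp add: field_simps)
  also have "\<dots> \<le> L\<^sup>2 * (L * norm z) / (a * a)"
  proof (rule frac_le)
    show "(norm (G (x + z)))\<^sup>2 * (F (x + z) - F x) \<le> L\<^sup>2 * (L * norm z)"
    proof -
      have "(norm (G (x + z)))\<^sup>2 * (F (x + z) - F x) \<le> (norm (G (x + z)))\<^sup>2 * (L * norm z)"
        using Flip[of x z] by (intro mult_left_mono) auto
      also have "\<dots> \<le> L\<^sup>2 * (L * norm z)" using G[of "x + z"] nn by (intro mult_right_mono power_mono) auto
      finally show ?thesis .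
    qed
    show "a * a \<le> F x * F (x + z)" using F(1)[of x] F(1)[of "x + z"] a by (intro mult_mono) auto
  qed (use a nn in auto)
  finally have B: "(norm (G (x + z)))\<^sup>2 / F x - (norm (G (x + z)))\<^sup>2 / F (x + z) \<le> L ^ 3 / a\<^sup>2 * norm z"
    by (simp add: power2_eq_square power3_eq_cube)
  have "Q x - Q (x + z) \<le> 2 * L * (\<epsilon> + K * norm z) / a + L ^ 3 / a\<^sup>2 * norm z"
    using A B unfolding Q_def by (simp add: diff_divide_distrib)
  also have "\<dots> = 2 * L * \<epsilon> / a + (2 * L * K / a + L ^ 3 / a\<^sup>2) * norm z"
    by (simp add: algebra_simps add_divide_distrib)
  finally show ?thesis .
qed

text \<open>The entropy is expanded around c = F x. The affine part integrates to the tangent of r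
  ln r at c, evaluated at the mean m, hence to at most m ln m. The quadratic part integrates to at
  most \<delta> / 2 times Q x, and \<open>Q_shift\<close> replaces Q x by its average. What remains
  is \<delta> times a multiple of \<epsilon> plus a multiple of sqrt \<delta>.\<close>

lemma short_step:
  assumes d: "\<delta> > 0"
  defines "M \<equiv> weighted (gauss \<delta>) :: (real^'n) measure"
  shows "(\<integral>z. F (x + z) * ln (F (x + z)) \<partial>M) \<le> (\<integral>z. F (x + z) \<partial>M) * ln (\<integral>z. F (x + z) \<partial>M)
     + \<delta> / 2 * (\<integral>z. Q (x + z) \<partial>M) + \<delta> * (err1 (real CARD('n)) a L * \<epsilon> + err2 (real CARD('n)) a L K * sqrt \<delta>)"
proof -
  interpret M: prob_space M unfolding M_def by (rule prob_space_gauss[OF d])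
  have [measurable_cong, simp]: "sets M = sets borel" by (simp add: M_def)
  have [simp]: "space M = UNIV" by (simp add: M_def)
  define n where "n = real CARD('n)"
  note mom = gauss_norm_moments[OF d, where 'n = 'n, folded M_def n_def]
  have sd: "sqrt \<delta> > 0" "sqrt \<delta> * sqrt \<delta> = \<delta>" using d by auto
  \<comment> \<open>Odd moments are reduced to even ones by the arithmetic-geometric mean inequality
    with weight sqrt \<delta>, which preserves their natural orders \<delta>^(1/2) and
    \<delta>^(3/2).\<close>
  have n1: "norm z \<le> (sqrt \<delta> + (norm z)\<^sup>2 / sqrt \<delta>) / 2" for z :: "real^'n"
  proof -
    have "0 \<le> (sqrt \<delta> - norm z)\<^sup>2" by simp
    then have "2 * norm z * sqrt \<delta> \<le> sqrt \<delta> * sqrt \<delta> + (norm z)\<^sup>2"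
      by (simp add: power2_eq_square algebra_simps)
    then show ?thesis using sd(1) by (simp add: field_simps)
  qed
  have n3: "norm z ^ 3 \<le> (sqrt \<delta> * (norm z)\<^sup>2 + (norm z) ^ 4 / sqrt \<delta>) / 2" for z :: "real^'n"
  proof -
    have "(norm z)\<^sup>2 * norm z \<le> (norm z)\<^sup>2 * ((sqrt \<delta> + (norm z)\<^sup>2 / sqrt \<delta>) / 2)"
      by (intro mult_left_mono n1) auto
    then show ?thesis by (simp add: power2_eq_square power3_eq_cube power4_eq_xxxx algebra_simps add_divide_distrib)
  qed
  have i1': "integrable M (\<lambda>z. (sqrt \<delta> + (norm z)\<^sup>2 / sqrt \<delta>) / 2)" using mom(1) by simp
  have i3': "integrable M (\<lambda>z. (sqrt \<delta> * (norm z)\<^sup>2 + (norm z) ^ 4 / sqrt \<delta>) / 2)" using mom(1,3) by simp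
  have i1: "integrable M (\<lambda>z. norm z)"
    by (rule Bochner_Integration.integrable_bound[OF i1']) (use n1 in \<open>auto intro: order_trans[OF _ abs_ge_self]\<close>)
  have i3: "integrable M (\<lambda>z. norm z ^ 3)"
    by (rule Bochner_Integration.integrable_bound[OF i3']) (use n3 in \<open>auto intro: order_trans[OF _ abs_ge_self]\<close>)
  have "(\<integral>z. norm z \<partial>M) \<le> (\<integral>z. (sqrt \<delta> + (norm z)\<^sup>2 / sqrt \<delta>) / 2 \<partial>M)" by (rule integral_mono[OF i1 i1' n1])
  also have "\<dots> = (sqrt \<delta> + (\<integral>z. (norm z)\<^sup>2 \<partial>M) / sqrt \<delta>) / 2" using mom(1) M.prob_space by simp
  also have "\<dots> \<le> (sqrt \<delta> + n * \<delta> / sqrt \<delta>) / 2"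
    using mom(2) sd(1) by (intro divide_right_mono add_left_mono) auto
  also have "n * \<delta> / sqrt \<delta> = n * sqrt \<delta>" using sd by (simp add: field_simps)
  finally have m1: "(\<integral>z. norm z \<partial>M) \<le> (1 + n) / 2 * sqrt \<delta>" by (simp add: algebra_simps)
  have "(\<integral>z. norm z ^ 3 \<partial>M) \<le> (\<integral>z. (sqrt \<delta> * (norm z)\<^sup>2 + (norm z) ^ 4 / sqrt \<delta>) / 2 \<partial>M)" by (rule integral_mono[OF i3 i3' n3])
  also have "\<dots> = (sqrt \<delta> * (\<integral>z. (norm z)\<^sup>2 \<partial>M) + (\<integral>z. (norm z) ^ 4 \<partial>M) / sqrt \<delta>) / 2" using mom(1,3) by simp
  also have "\<dots> \<le> (sqrt \<delta> * (n * \<delta>) + 1024 * n\<^sup>2 * \<delta>\<^sup>2 / sqrt \<delta>) / 2"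
    using mom(2,4) sd(1) by (intro divide_right_mono add_mono mult_left_mono) auto
  also have "1024 * n\<^sup>2 * \<delta>\<^sup>2 / sqrt \<delta> = 1024 * n\<^sup>2 * \<delta> * sqrt \<delta>"
    using sd by (simp add: power2_eq_square field_simps)
  finally have m3: "(\<integral>z. norm z ^ 3 \<partial>M) \<le> (n + 1024 * n\<^sup>2) / 2 * \<delta> * sqrt \<delta>" by (simp add: algebra_simps)
  have iF: "integrable M (\<lambda>y. F (x + y))"
    by (rule M.integrable_const_bound[of _ b]) (use Fabs in auto)
  have iFF: "integrable M (\<lambda>y. F (x + y) * ln (F (x + y)))"
    by (rule M.integrable_const_bound[of _ "b * b + b + 1"]) (use entropy_bound in auto)
  have iQ: "integrable M (\<lambda>y. Q (x + y))"
    by (rule M.integrable_const_bound[of _ "L\<^sup>2 / a"]) (use Qbound in auto)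
  define c where "c = F x"
  have c: "c > 0" "a \<le> c" using Fpos F by (auto simp: c_def)
  define m where "m = (\<integral>z. F (x + z) \<partial>M)"
  have "(\<integral>y. a \<partial>M) \<le> m" unfolding m_def using iF F by (intro integral_mono) auto
  then have m: "m > 0" using a M.prob_space by simp
  define S where "S = L * K / a + L ^ 3 / (2 * a\<^sup>2)"
  have S: "S \<ge> 0" using a nn by (simp add: S_def)
  define U where "U z = c * ln c + (ln c + 1) * (F (x + z) - c) + ((G x \<bullet> z)\<^sup>2 / (2 * c) + (L * \<epsilon> / a * (norm z)\<^sup>2 + S * norm z ^ 3))" for z
  note gm = gauss_second_moment[OF d, of "G x", folded M_def]
  have iU: "integrable M U"
    unfolding U_def using iF gm(1) mom(1) i3 by simp
  have le: "F (x + z) * ln (F (x + z)) \<le> U z" for z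
  proof -
    define D where "D = F (x + z) - c"
    have D: "\<bar>D\<bar> \<le> L * norm z" using Flip by (simp add: D_def c_def)
    have Gz: "\<bar>G x \<bullet> z\<bar> \<le> L * norm z"
      using Cauchy_Schwarz_ineq2[of "G x" z] mult_right_mono[OF G[of x] norm_ge_zero[of z]] by simp
    \<comment> \<open>In the factored difference one factor is the Taylor error and the other is at
      most 2 L |z|, so the linear part may replace the increment in the quadratic term.\<close>
    have "D\<^sup>2 - (G x \<bullet> z)\<^sup>2 = (D - G x \<bullet> z) * (D + G x \<bullet> z)" by (simp add: power2_eq_square algebra_simps)
    also have "\<dots> \<le> \<bar>D - G x \<bullet> z\<bar> * \<bar>D + G x \<bullet> z\<bar>" by (simp add: abs_mult[symmetric])
    also have "\<dots> \<le> (\<epsilon> * norm z + K * (norm z)\<^sup>2) * (2 * L * norm z)"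
      using Ftaylor[of x z] D Gz nn by (intro mult_mono) (auto simp: D_def c_def)
    finally have D2: "D\<^sup>2 \<le> (G x \<bullet> z)\<^sup>2 + 2 * (L * \<epsilon> * (norm z)\<^sup>2 + L * K * norm z ^ 3)"
      by (simp add: power2_eq_square power3_eq_cube algebra_simps)
    have "D\<^sup>2 / (2 * c) \<le> (G x \<bullet> z)\<^sup>2 / (2 * c) + (L * \<epsilon> * (norm z)\<^sup>2 + L * K * norm z ^ 3) / c"
      using divide_right_mono[OF D2, of "2 * c"] c by (simp add: add_divide_distrib)
    also have "\<dots> \<le> (G x \<bullet> z)\<^sup>2 / (2 * c) + (L * \<epsilon> * (norm z)\<^sup>2 + L * K * norm z ^ 3) / a"
      using c a nn by (intro add_left_mono divide_left_mono) auto
    finally have T2: "D\<^sup>2 / (2 * c) \<le> (G x \<bullet> z)\<^sup>2 / (2 * c) + (L * \<epsilon> * (norm z)\<^sup>2 + L * K * norm z ^ 3) / a" .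
    have "\<bar>D\<bar> ^ 3 / (2 * c\<^sup>2) \<le> (L * norm z) ^ 3 / (2 * a\<^sup>2)"
      using D a c nn by (intro frac_le power_mono mult_left_mono) auto
    then have T3: "\<bar>D\<bar> ^ 3 / (2 * c\<^sup>2) \<le> L ^ 3 / (2 * a\<^sup>2) * norm z ^ 3" by (simp add: power_mult_distrib)
    have "F (x + z) * ln (F (x + z)) \<le> c * ln c + (ln c + 1) * D + D\<^sup>2 / (2 * c) + \<bar>D\<bar> ^ 3 / (2 * c\<^sup>2)"
      unfolding D_def by (rule entropy_upper[OF Fpos c(1)])
    also have "\<dots> \<le> U z"
      using T2 T3 unfolding U_def S_def D_def[symmetric] by (simp add: algebra_simps add_divide_distrib)
    finally show ?thesis .
  qed
  have "(\<integral>z. F (x + z) * ln (F (x + z)) \<partial>M) \<le> (\<integral>z. U z \<partial>M)" by (rule integral_mono[OF iFF iU le])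
  also have "\<dots> = c * ln c + (ln c + 1) * (m - c) + ((\<integral>z. (G x \<bullet> z)\<^sup>2 \<partial>M) / (2 * c)
      + (L * \<epsilon> / a * (\<integral>z. (norm z)\<^sup>2 \<partial>M) + S * (\<integral>z. norm z ^ 3 \<partial>M)))"
    unfolding U_def m_def using iF gm(1) mom(1) i3 M.prob_space by simp
  also have "\<dots> \<le> m * ln m + (\<delta> * (norm (G x))\<^sup>2 / (2 * c)
      + (L * \<epsilon> / a * (n * \<delta>) + S * ((n + 1024 * n\<^sup>2) / 2 * \<delta> * sqrt \<delta>)))"
    using entropy_tangent[OF m c(1)] gm(2) mom(2) m3 c(1) a nn S
    by (intro add_mono divide_right_mono mult_left_mono) auto
  also have "\<delta> * (norm (G x))\<^sup>2 / (2 * c) = \<delta> / 2 * Q x" by (simp add: Q_def c_def)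
  finally have 1: "(\<integral>z. F (x + z) * ln (F (x + z)) \<partial>M)
      \<le> m * ln m + (\<delta> / 2 * Q x + (L * \<epsilon> / a * (n * \<delta>) + S * ((n + 1024 * n\<^sup>2) / 2 * \<delta> * sqrt \<delta>)))" .
  define T where "T = 2 * L * K / a + L ^ 3 / a\<^sup>2"
  have T: "T \<ge> 0" using a nn by (simp add: T_def)
  have "(\<integral>z. Q x \<partial>M) \<le> (\<integral>z. Q (x + z) + (2 * L * \<epsilon> / a + T * norm z) \<partial>M)"
    using iQ i1 Q_shift[of x] unfolding T_def by (intro integral_mono) (auto simp: algebra_simps)
  also have "\<dots> = (\<integral>z. Q (x + z) \<partial>M) + (2 * L * \<epsilon> / a + T * (\<integral>z. norm z \<partial>M))"
    using iQ i1 M.prob_space by simp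
  also have "\<dots> \<le> (\<integral>z. Q (x + z) \<partial>M) + (2 * L * \<epsilon> / a + T * ((1 + n) / 2 * sqrt \<delta>))"
    using m1 T by (intro add_left_mono mult_left_mono)
  finally have 2: "Q x \<le> (\<integral>z. Q (x + z) \<partial>M) + (2 * L * \<epsilon> / a + T * ((1 + n) / 2 * sqrt \<delta>))"
    using M.prob_space by simp
  have "\<delta> / 2 * Q x \<le> \<delta> / 2 * ((\<integral>z. Q (x + z) \<partial>M) + (2 * L * \<epsilon> / a + T * ((1 + n) / 2 * sqrt \<delta>)))"
    using 2 d by (intro mult_left_mono) auto
  moreover have "\<delta> / 2 * ((\<integral>z. Q (x + z) \<partial>M) + (2 * L * \<epsilon> / a + T * ((1 + n) / 2 * sqrt \<delta>)))
      + (L * \<epsilon> / a * (n * \<delta>) + S * ((n + 1024 * n\<^sup>2) / 2 * \<delta> * sqrt \<delta>))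
    = \<delta> / 2 * (\<integral>z. Q (x + z) \<partial>M) + \<delta> * (err1 (real CARD('n)) a L * \<epsilon> + err2 (real CARD('n)) a L K * sqrt \<delta>)"
  proof -
    have "\<delta> * (err1 (real CARD('n)) a L * \<epsilon> + err2 (real CARD('n)) a L K * sqrt \<delta>) = \<delta> * ((L * n / a + L / a) * \<epsilon>
       + (S * ((n + 1024 * n\<^sup>2) / 2) + T * (1 + n) / 4) * sqrt \<delta>)"
      unfolding err1_def err2_def S_def T_def n_def ..
    note E = this
    show ?thesis unfolding E by (simp add: field_simps)
  qed
  ultimately show ?thesis using 1 unfolding m_def by linarith
qed

end

section \<open>Composing the steps\<close>

text \<open>By the semigroup property the last step can be integrated first; it replaces F by its
  average F1, which satisfies the same conditions with the same constants, so the induction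
  hypothesis applies to F1. By \<open>jensen_Q\<close> the Fisher information of F1 is at most that
  of F, hence the contributions add up to the total variance. \<open>M N\<close> has variance (N +
  1) \<delta>, so that N = 0 is one step from the origin.\<close>

lemma entropy_chain:
  fixes F :: "real^'n \<Rightarrow> real" and G :: "real^'n \<Rightarrow> real^'n"
  assumes "almost_differentiable F G a b L \<epsilon> K" and d: "\<delta> > 0"
  defines "M N \<equiv> weighted (gauss (real (Suc N) * \<delta>)) :: (real^'n) measure"
  shows "(\<integral>x. F x * ln (F x) \<partial>M N) \<le> (\<integral>x. F x \<partial>M N) * ln (\<integral>x. F x \<partial>M N)
       + real (Suc N) * \<delta> / 2 * (\<integral>x. (norm (G x))\<^sup>2 / F x \<partial>M N)
       + real (Suc N) * \<delta> * (err1 (real CARD('n)) a L * \<epsilon> + err2 (real CARD('n)) a L K * sqrt \<delta>)"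
  using assms(1)
proof (induction N arbitrary: F G)
  case 0
  interpret almost_differentiable F G a b L \<epsilon> K by (rule 0)
  show ?case using short_step[OF d, of 0] by (simp add: Q_def M_def)
next
  case (Suc N)
  interpret almost_differentiable F G a b L \<epsilon> K by (rule Suc.prems)
  define D where "D = (weighted (gauss \<delta>) :: (real^'n) measure)"
  have D: "prob_space D" unfolding D_def by (rule prob_space_gauss[OF d])
  interpret D: prob_space D by (rule D)
  have [measurable_cong, simp]: "sets D = sets borel" by (simp add: D_def)
  have dN: "real (Suc N) * \<delta> > 0" using d by simp
  interpret MN: prob_space "M N" unfolding M_def by (rule prob_space_gauss[OF dN])
  have [measurable_cong, simp]: "sets (M N) = sets borel" "space (M N) = UNIV" "space D = UNIV"
    by (simp_all add: M_def D_def)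
  have [simp]: "measure (M N) UNIV = 1" using MN.prob_space by simp
  define F1 G1 where "F1 x = (\<integral>y. F (x + y) \<partial>D)" and "G1 x = (\<integral>y. G (x + y) \<partial>D)" for x
  have av: "almost_differentiable F1 G1 a b L \<epsilon> K"
    unfolding F1_def[abs_def] G1_def[abs_def] by (rule averaged[OF D]) simp
  interpret A: almost_differentiable F1 G1 a b L \<epsilon> K by (rule av)
  have split: "(\<integral>x. k x \<partial>M (Suc N)) = (\<integral>y. (\<integral>z. k (y + z) \<partial>D) \<partial>M N)"
    if "k \<in> borel_measurable borel" "\<And>x. \<bar>k x\<bar> \<le> B" for k :: "real^'n \<Rightarrow> real" and B
  proof -
    have "real (Suc (Suc N)) * \<delta> = real (Suc N) * \<delta> + \<delta>" by (simp add: algebra_simps)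
    then show ?thesis unfolding M_def D_def using gauss_semigroup[OF dN d that] by simp
  qed
  have inner: "integrable (M N) (\<lambda>y. \<integral>z. k (y + z) \<partial>D)"
    if [measurable]: "k \<in> borel_measurable borel" and B: "\<And>x. \<bar>k x\<bar> \<le> B" for k :: "real^'n \<Rightarrow> real" and B
  proof (rule MN.integrable_const_bound[of _ B])
    have "\<bar>\<integral>z. k (y + z) \<partial>D\<bar> \<le> B" for y
    proof -
      have i: "integrable D (\<lambda>z. k (y + z))" by (rule D.integrable_const_bound[of _ B]) (use B in auto)
      have "\<bar>\<integral>z. k (y + z) \<partial>D\<bar> \<le> (\<integral>z. \<bar>k (y + z)\<bar> \<partial>D)" by (rule integral_abs_bound)
      also have "\<dots> \<le> (\<integral>z. B \<partial>D)" using i B by (intro integral_mono) auto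
      finally show ?thesis using D.prob_space by simp
    qed
    then show "AE y in M N. norm (\<integral>z. k (y + z) \<partial>D) \<le> B" by simp
    have "(\<lambda>y. \<integral>z. k (y + z) \<partial>D) \<in> borel_measurable borel"
      by (rule D.borel_measurable_lebesgue_integral) measurable
    then show "(\<lambda>y. \<integral>z. k (y + z) \<partial>D) \<in> borel_measurable (M N)" by simp
  qed
  have entm: "(\<lambda>x. F x * ln (F x)) \<in> borel_measurable borel" by measurable
  define \<eta> where "\<eta> = err1 (real CARD('n)) a L * \<epsilon> + err2 (real CARD('n)) a L K * sqrt \<delta>"
  have iFF: "integrable (M N) (\<lambda>y. F1 y * ln (F1 y))"
    by (rule MN.integrable_const_bound[of _ "b * b + b + 1"]) (use A.entropy_bound in auto)
  have iQ1: "integrable (M N) (\<lambda>y. \<integral>z. Q (y + z) \<partial>D)" by (rule inner[OF Qm Qbound])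
  have iAQ: "integrable (M N) A.Q"
    by (rule MN.integrable_const_bound[of _ "L\<^sup>2 / a"]) (use A.Qbound in auto)
  have "(\<integral>x. F x * ln (F x) \<partial>M (Suc N)) = (\<integral>y. (\<integral>z. F (y + z) * ln (F (y + z)) \<partial>D) \<partial>M N)"
    by (rule split[OF entm entropy_bound])
  also have "\<dots> \<le> (\<integral>y. F1 y * ln (F1 y) + \<delta> / 2 * (\<integral>z. Q (y + z) \<partial>D) + \<delta> * \<eta> \<partial>M N)"
  proof (rule integral_mono)
    show "integrable (M N) (\<lambda>y. \<integral>z. F (y + z) * ln (F (y + z)) \<partial>D)" by (rule inner[OF entm entropy_bound])
    show "integrable (M N) (\<lambda>y. F1 y * ln (F1 y) + \<delta> / 2 * (\<integral>z. Q (y + z) \<partial>D) + \<delta> * \<eta>)"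
      using iFF iQ1 by simp
    show "(\<integral>z. F (y + z) * ln (F (y + z)) \<partial>D) \<le> F1 y * ln (F1 y) + \<delta> / 2 * (\<integral>z. Q (y + z) \<partial>D) + \<delta> * \<eta>" for y
      using short_step[OF d, of y] unfolding D_def F1_def \<eta>_def .
  qed
  also have "\<dots> = (\<integral>y. F1 y * ln (F1 y) \<partial>M N) + \<delta> / 2 * (\<integral>y. (\<integral>z. Q (y + z) \<partial>D) \<partial>M N) + \<delta> * \<eta>"
    using iFF iQ1 by simp
  finally have 1: "(\<integral>x. F x * ln (F x) \<partial>M (Suc N))
    \<le> (\<integral>y. F1 y * ln (F1 y) \<partial>M N) + \<delta> / 2 * (\<integral>y. (\<integral>z. Q (y + z) \<partial>D) \<partial>M N) + \<delta> * \<eta>" .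
  have 2: "(\<integral>y. (\<integral>z. Q (y + z) \<partial>D) \<partial>M N) = (\<integral>x. Q x \<partial>M (Suc N))"
    by (rule split[OF Qm Qbound, symmetric])
  have 3: "(\<integral>y. F1 y \<partial>M N) = (\<integral>x. F x \<partial>M (Suc N))"
    unfolding F1_def by (rule split[OF Fm Fabs, symmetric])
  have "(\<integral>x. A.Q x \<partial>M N) \<le> (\<integral>y. (\<integral>z. Q (y + z) \<partial>D) \<partial>M N)"
    using jensen_Q[OF D] by (intro integral_mono iAQ iQ1) (simp add: A.Q_def F1_def G1_def)
  then have 4: "real (Suc N) * \<delta> / 2 * (\<integral>x. A.Q x \<partial>M N) \<le> real (Suc N) * \<delta> / 2 * (\<integral>x. Q x \<partial>M (Suc N))"
    unfolding 2 using d by (intro mult_left_mono) auto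
  have "(\<integral>y. F1 y * ln (F1 y) \<partial>M N) \<le> (\<integral>x. F x \<partial>M (Suc N)) * ln (\<integral>x. F x \<partial>M (Suc N))
      + real (Suc N) * \<delta> / 2 * (\<integral>x. A.Q x \<partial>M N) + real (Suc N) * \<delta> * \<eta>"
    using Suc.IH[OF av] unfolding 3 \<eta>_def A.Q_def .
  then have "(\<integral>x. F x * ln (F x) \<partial>M (Suc N)) \<le> (\<integral>x. F x \<partial>M (Suc N)) * ln (\<integral>x. F x \<partial>M (Suc N))
      + real (Suc N) * \<delta> / 2 * (\<integral>x. Q x \<partial>M (Suc N)) + \<delta> / 2 * (\<integral>x. Q x \<partial>M (Suc N)) + real (Suc N) * \<delta> * \<eta> + \<delta> * \<eta>"
    using 1 4 unfolding 2 by linarith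
  also have "\<dots> = (\<integral>x. F x \<partial>M (Suc N)) * ln (\<integral>x. F x \<partial>M (Suc N))
       + real (Suc (Suc N)) * \<delta> / 2 * (\<integral>x. Q x \<partial>M (Suc N)) + real (Suc (Suc N)) * \<delta> * \<eta>"
    by (simp add: algebra_simps add_divide_distrib)
  finally show ?case unfolding \<eta>_def Q_def .
qed

text \<open>The order of quantifiers is the point: b and L are fixed before \<epsilon>, and only K
  may depend on it.\<close>

lemma almost_differentiable_C1:
  fixes \<phi> :: "real^'n \<Rightarrow> real"
  assumes \<phi>: "compact_C1 \<phi> g" "\<And>x. \<phi> x \<ge> 0" and a: "a > 0"
  shows "\<exists>b L. \<forall>\<epsilon>>0. \<exists>K. almost_differentiable (\<lambda>x. a + \<phi> x) g a b L \<epsilon> K"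
proof -
  note C = compact_C1_C1[OF \<phi>(1)]
  note [measurable] = C1_measurable[OF C]
  obtain B where B: "B > 0" "\<And>x. \<bar>\<phi> x\<bar> \<le> B" "\<And>x. norm (g x) \<le> B"
    using compact_C1_bounded[OF \<phi>(1)] by blast
  \<comment> \<open>Here d is a modulus of uniform continuity of g for \<epsilon>. Beyond distance d
    the gradient still changes by at most 2 B, which is at most (2 B / d) |z|.\<close>
  have "almost_differentiable (\<lambda>x. a + \<phi> x) g a (a + B) B \<epsilon> (2 * B / d)"
    if e: "\<epsilon> > 0" and d: "d > 0" "\<And>x z. norm z < d \<Longrightarrow> norm (g (x + z) - g x) < \<epsilon>" for \<epsilon> d
  proof
    show "\<bar>(a + \<phi> (x + z)) - (a + \<phi> x)\<bar> \<le> B * norm z" for x z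
      using C1_lipschitz[OF C B(3), where x = x and y = "x + z"] by simp
    show gc: "norm (g (x + z) - g x) \<le> \<epsilon> + 2 * B / d * norm z" for x z
    proof (cases "norm z < d")
      case True
      then show ?thesis using d(2)[of z x] B(1) d(1) by (smt (verit) divide_nonneg_pos mult_nonneg_nonneg norm_ge_zero)
    next
      case False
      have "norm (g (x + z) - g x) \<le> B + B" using norm_triangle_ineq4[of "g (x + z)" "g x"] B(3)[of x] B(3)[of "x + z"] by simp
      also have "\<dots> = 2 * B / d * d" using d by simp
      also have "\<dots> \<le> 2 * B / d * norm z" using False B(1) d(1) by (intro mult_left_mono) auto
      finally show ?thesis using e by simp
    qed
    show "\<bar>(a + \<phi> (x + z)) - (a + \<phi> x) - g x \<bullet> z\<bar> \<le> \<epsilon> * norm z + 2 * B / d * (norm z)\<^sup>2" for x z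
    proof -
      let ?M = "\<epsilon> + 2 * B / d * norm z"
      \<comment> \<open>The mean value inequality for \<phi> minus its linearisation at x, on the
        ball of radius |z| around x.\<close>
      have "\<bar>(\<phi> (x + z) + (- g x \<bullet> (x + z) + 0)) - (\<phi> x + (- g x \<bullet> x + 0))\<bar> \<le> ?M * norm (x + z - x)"
      proof (rule C1_lipschitz_on[OF C1_add[OF C C1_inner_const] convex_cball[of x "norm z"]])
        show "norm (g y + - g x) \<le> ?M" if "y \<in> cball x (norm z)" for y
        proof -
          have "norm (g (x + (y - x)) - g x) \<le> \<epsilon> + 2 * B / d * norm (y - x)" by (rule gc)
          also have "\<dots> \<le> ?M" using that B(1) d(1)
            by (intro add_left_mono mult_left_mono) (auto simp: dist_norm norm_minus_commute)
          finally show ?thesis by simp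
        qed
      qed (auto simp: dist_norm)
      then show ?thesis by (simp add: inner_add_right algebra_simps power2_eq_square)
    qed
  qed (use \<phi>(2) B a e d(1) in \<open>auto intro: order_trans[OF abs_ge_self]\<close>)
  moreover have "\<exists>d>0. \<forall>x z. norm z < d \<longrightarrow> norm (g (x + z) - g x) < \<epsilon>" if e: "\<epsilon> > 0" for \<epsilon>
  proof -
    obtain R where R: "R > 0" "\<And>x. norm x > R \<Longrightarrow> g x = 0"
      using compact_C1_E[OF \<phi>(1)] by metis
    have "uniformly_continuous_on (cball 0 (R + 1)) g"
      by (intro compact_uniformly_continuous continuous_on_subset[OF C1_continuous_grad[OF C]]) auto
    then obtain d where d: "d > 0" "\<And>x y. x \<in> cball 0 (R + 1) \<Longrightarrow> y \<in> cball 0 (R + 1) \<Longrightarrow> dist y x < d \<Longrightarrow> dist (g y) (g x) < \<epsilon>"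
      using e unfolding uniformly_continuous_on_def by metis
    \<comment> \<open>As |z| < 1, either both points lie in the ball of radius R + 1, where g is
      uniformly continuous, or both lie outside the support.\<close>
    have "norm (g (x + z) - g x) < \<epsilon>" if z: "norm z < min d 1" for x z
    proof (cases "norm x \<le> R \<or> norm (x + z) \<le> R")
      case True
      then have "norm x \<le> R + 1" "norm (x + z) \<le> R + 1"
        using z norm_triangle_ineq[of x z] norm_triangle_ineq4[of "x + z" z] by auto
      then have "dist (g (x + z)) (g x) < \<epsilon>"
      proof (intro d(2))
        show "dist (x + z) x < d" using z by (simp add: dist_norm)
      qed (simp_all only: mem_cball_0)
      then show ?thesis by (simp add: dist_norm)
    next
      case False
      then show ?thesis using R(2) e by simp
    qed
    then show ?thesis using d(1) by (intro exI[of _ "min d 1"]) auto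
  qed
  ultimately show ?thesis by (metis (no_types, lifting))
qed

text \<open>\<beta> is cut into N + 1 equal steps. For fixed \<epsilon>, and hence fixed K, the
  limit N -> \<infinity> removes the \<open>err2\<close> term; afterwards \<epsilon> -> 0 removes
  \<open>err1\<close>.\<close>

lemma log_sobolev_compact:
  fixes \<phi> :: "real^'n \<Rightarrow> real"
  assumes \<phi>: "compact_C1 \<phi> g" "\<And>x. \<phi> x \<ge> 0" and a: "a > 0" and \<beta>: "\<beta> > 0"
  defines "F x \<equiv> a + \<phi> x" and "M \<equiv> weighted (gauss \<beta>) :: (real^'n) measure"
  shows "(\<integral>x. F x * ln (F x) \<partial>M) \<le> (\<integral>x. F x \<partial>M) * ln (\<integral>x. F x \<partial>M) + \<beta> / 2 * (\<integral>x. (norm (g x))\<^sup>2 / F x \<partial>M)"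
proof -
  obtain b L where *: "\<And>\<epsilon>. \<epsilon> > 0 \<Longrightarrow> \<exists>K. almost_differentiable F g a b L \<epsilon> K"
    using almost_differentiable_C1[OF \<phi> a] unfolding F_def[abs_def] by blast
  let ?n = "real CARD('n)"
  define R where "R = (\<integral>x. F x \<partial>M) * ln (\<integral>x. F x \<partial>M) + \<beta> / 2 * (\<integral>x. (norm (g x))\<^sup>2 / F x \<partial>M)"
  have 1: "(\<integral>x. F x * ln (F x) \<partial>M) \<le> R + \<beta> * (err1 ?n a L * \<epsilon>)" if e: "\<epsilon> > 0" for \<epsilon>
  proof -
    obtain K where K: "almost_differentiable F g a b L \<epsilon> K" using *[OF e] by blast
    have "(\<integral>x. F x * ln (F x) \<partial>M) \<le> R + \<beta> * (err1 ?n a L * \<epsilon> + err2 ?n a L K * sqrt (\<beta> * inverse (real (Suc N))))" for N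
    proof -
      have eq: "real (Suc N) * (\<beta> * inverse (real (Suc N))) = \<beta>" by (simp add: field_simps)
      have "\<beta> * inverse (real (Suc N)) > 0" using \<beta> by simp
      from entropy_chain[OF K this, of N] show ?thesis unfolding eq R_def M_def .
    qed
    moreover have "(\<lambda>N. R + \<beta> * (err1 ?n a L * \<epsilon> + err2 ?n a L K * sqrt (\<beta> * inverse (real (Suc N)))))
        \<longlonglongrightarrow> R + \<beta> * (err1 ?n a L * \<epsilon> + err2 ?n a L K * sqrt (\<beta> * 0))"
      by (intro tendsto_intros LIMSEQ_inverse_real_of_nat)
    ultimately have "(\<integral>x. F x * ln (F x) \<partial>M) \<le> R + \<beta> * (err1 ?n a L * \<epsilon> + err2 ?n a L K * sqrt (\<beta> * 0))"
      by (intro LIMSEQ_le_const) auto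
    then show ?thesis by simp
  qed
  have "(\<lambda>N. R + \<beta> * (err1 ?n a L * inverse (real (Suc N)))) \<longlonglongrightarrow> R + \<beta> * (err1 ?n a L * 0)"
    by (intro tendsto_intros LIMSEQ_inverse_real_of_nat)
  then have "(\<integral>x. F x * ln (F x) \<partial>M) \<le> R + \<beta> * (err1 ?n a L * 0)"
    using 1 by (intro LIMSEQ_le_const) auto
  then show ?thesis by (simp add: R_def)
qed

subsection \<open>Logarithmic Sobolev inequality and Fisher information\<close>

lemma abs_x_ln_x_le:
  fixes r :: real
  assumes "r > 0"
  shows "\<bar>r * ln r\<bar> \<le> r\<^sup>2 + 1"
proof -
  have "r * ln r \<le> r * (r - 1)" using assms by (intro mult_left_mono ln_le_minus_one) auto
  moreover have "r * (r - 1) = r\<^sup>2 - r" by (simp add: power2_eq_square algebra_simps)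
  ultimately have 1: "r * ln r \<le> r\<^sup>2" using assms by linarith
  have "1 * ln 1 + (ln 1 + 1) * (r - 1) \<le> r * ln r" by (rule entropy_tangent) (use assms in auto)
  then have "- 1 \<le> r * ln r" using assms by simp
  then show ?thesis using 1 by (simp add: abs_le_iff) (smt (verit) zero_le_power2)
qed

lemma integral_positive:
  fixes f :: "'a \<Rightarrow> real"
  assumes i: "integrable M f" and pos: "\<And>x. 0 < f x" and M: "emeasure M (space M) \<noteq> 0"
  shows "0 < integral\<^sup>L M f"
proof -
  have "integral\<^sup>L M f \<noteq> 0"
  proof
    assume "integral\<^sup>L M f = 0"
    then have "AE x in M. f x = 0"
      using integral_nonneg_eq_0_iff_AE[OF i] pos by (simp add: less_imp_le)
    then have "AE x in M. False" by eventually_elim (use pos in \<open>metis less_irrefl\<close>)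
    then show False using M by (simp add: eventually_False ae_filter_eq_bot_iff)
  qed
  moreover have "0 \<le> integral\<^sup>L M f" using pos by (intro integral_nonneg_AE AE_I2 less_imp_le)
  ultimately show ?thesis by simp
qed

lemma norm_add_sq_le:
  fixes p q :: "'a::real_inner"
  assumes a: "a > 0"
  shows "(norm (p + q))\<^sup>2 \<le> (1 + a) * (norm p)\<^sup>2 + (1 + 1 / a) * (norm q)\<^sup>2"
proof -
  have "0 \<le> (norm (a *\<^sub>R p - q))\<^sup>2" by simp
  also have "\<dots> = a\<^sup>2 * (norm p)\<^sup>2 - 2 * a * (p \<bullet> q) + (norm q)\<^sup>2"
    unfolding power2_norm_eq_inner by (simp add: inner_simps inner_commute power2_eq_square algebra_simps)
  finally have "a * (2 * (p \<bullet> q)) \<le> a * (a * (norm p)\<^sup>2 + (norm q)\<^sup>2 / a)"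
    using a by (simp add: power2_eq_square algebra_simps)
  then have "2 * (p \<bullet> q) \<le> a * (norm p)\<^sup>2 + (norm q)\<^sup>2 / a" using a by simp
  moreover have "(norm (p + q))\<^sup>2 = (norm p)\<^sup>2 + 2 * (p \<bullet> q) + (norm q)\<^sup>2"
    unfolding power2_norm_eq_inner by (simp add: inner_simps inner_commute algebra_simps)
  ultimately show ?thesis by (simp add: algebra_simps)
qed

lemma cutoff_tendsto: "(\<lambda>k. cutoff (real (Suc k)) x) \<longlonglongrightarrow> 1"
proof -
  obtain N :: nat where "norm x \<le> real N" using real_arch_simple by blast
  then have "\<forall>\<^sub>F k in sequentially. cutoff (real (Suc k)) x = 1"
    unfolding eventually_sequentially by (intro exI[of _ N] allI impI cutoff_eq_1) simp
  then show ?thesis by (rule tendsto_eventually)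
qed

lemma cutoff'_tendsto: "(\<lambda>k. cutoff' (real (Suc k)) x) \<longlonglongrightarrow> 0"
proof -
  obtain N :: nat where "norm x \<le> real N" using real_arch_simple by blast
  then have "\<forall>\<^sub>F k in sequentially. cutoff' (real (Suc k)) x = 0"
    unfolding eventually_sequentially by (intro exI[of _ N] allI impI cutoff'_eq_0) auto
  then show ?thesis by (rule tendsto_eventually)
qed

lemma cutoff_measurable [measurable]:
  "cutoff (real (Suc k)) \<in> borel_measurable borel" "cutoff' (real (Suc k)) \<in> borel_measurable borel"
  using C1_measurable[OF compact_C1_C1[OF compact_C1_cutoff[of "real (Suc k)"]]] by auto

text \<open>Approximation by a_k + \<zeta>_k^2 F. With the square of the cutoff the gradient is
  \<zeta>_k p_k, and division by \<zeta>_k^2 F cancels the cutoff, leaving |p_k|^2 / F. Square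
  integrability of F dominates the entropies, since |r ln r| <= r^2 + 1.\<close>

theorem log_sobolev:
  fixes F :: "real^'n \<Rightarrow> real"
  assumes C: "C1 F G" and pos: "\<And>x. F x > 0" and \<beta>: "\<beta> > 0"
  defines "M \<equiv> weighted (gauss \<beta>) :: (real^'n) measure"
  assumes F2: "integrable M (\<lambda>x. (F x)\<^sup>2)" and I: "integrable M (\<lambda>x. (norm (G x))\<^sup>2 / F x)"
  shows "integrable M F" "integrable M (\<lambda>x. F x * ln (F x))"
    and "(\<integral>x. F x * ln (F x) \<partial>M) \<le> (\<integral>x. F x \<partial>M) * ln (\<integral>x. F x \<partial>M) + \<beta> / 2 * (\<integral>x. (norm (G x))\<^sup>2 / F x \<partial>M)"
proof -
  interpret M: prob_space M unfolding M_def by (rule prob_space_gauss[OF \<beta>])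
  have [measurable_cong, simp]: "sets M = sets borel" "space M = UNIV" by (simp_all add: M_def)
  note [measurable] = C1_measurable[OF C]
  have i1: "integrable M (\<lambda>x. 2 * (1 + F x)\<^sup>2 + 1)"
  proof -
    have "integrable M (\<lambda>x. 5 + 4 * (F x)\<^sup>2)" using F2 by simp
    then show ?thesis
    proof (rule Bochner_Integration.integrable_bound)
      show "AE x in M. norm (2 * (1 + F x)\<^sup>2 + 1) \<le> norm (5 + 4 * (F x)\<^sup>2)"
      proof (rule AE_I2)
        fix x
        have "0 \<le> (1 - F x)\<^sup>2" by simp
        then have "2 * (1 + F x)\<^sup>2 + 1 \<le> 5 + 4 * (F x)\<^sup>2"
          by (simp add: power2_eq_square algebra_simps)
        then show "norm (2 * (1 + F x)\<^sup>2 + 1) \<le> norm (5 + 4 * (F x)\<^sup>2)" by simp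
      qed
    qed measurable
  qed
  have bound: "\<bar>r * ln r\<bar> \<le> 2 * (1 + F x)\<^sup>2 + 1" "\<bar>r\<bar> \<le> 2 * (1 + F x)\<^sup>2 + 1" if r: "0 < r" "r \<le> 1 + F x" for r x
  proof -
    have "r\<^sup>2 \<le> (1 + F x)\<^sup>2" using r by (intro power_mono) auto
    moreover have "1 + F x \<le> (1 + F x)\<^sup>2" using pos[of x] by (simp add: power2_eq_square)
    ultimately show "\<bar>r * ln r\<bar> \<le> 2 * (1 + F x)\<^sup>2 + 1" "\<bar>r\<bar> \<le> 2 * (1 + F x)\<^sup>2 + 1"
      using abs_x_ln_x_le[OF r(1)] r zero_le_power2[of "1 + F x"] by linarith+
  qed
  show iF: "integrable M F"
    by (rule Bochner_Integration.integrable_bound[OF i1]) (use bound(2)[OF pos] pos in auto)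
  show "integrable M (\<lambda>x. F x * ln (F x))"
    by (rule Bochner_Integration.integrable_bound[OF i1]) (use bound(1)[OF pos] in auto)
  define m where "m = (\<integral>x. F x \<partial>M)"
  define J where "J = (\<integral>x. (norm (G x))\<^sup>2 / F x \<partial>M)"
  have m: "m > 0" unfolding m_def by (rule integral_positive[OF iF pos]) (use M.emeasure_space_1 in simp)
  \<comment> \<open>The same number serves as lower bound of the approximants, as reciprocal of the
    cutoff radius and as weight in Young's inequality.\<close>
  define a where "a k = inverse (real (Suc k))" for k
  have a: "a k > 0" "a k \<le> 1" "a k = 1 / real (Suc k)" for k by (auto simp: a_def field_simps)
  have a0: "a \<longlonglongrightarrow> 0" unfolding a_def by (rule LIMSEQ_inverse_real_of_nat)
  define \<zeta> \<zeta>' where "\<zeta> k = (cutoff (real (Suc k)) :: real^'n \<Rightarrow> real)" and "\<zeta>' k = (cutoff' (real (Suc k)) :: real^'n \<Rightarrow> _)" for k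
  have [measurable]: "\<zeta> k \<in> borel_measurable borel" "\<zeta>' k \<in> borel_measurable borel" for k
    unfolding \<zeta>_def \<zeta>'_def by measurable
  have \<zeta>: "compact_C1 (\<zeta> k) (\<zeta>' k)" "0 \<le> \<zeta> k x" "\<zeta> k x \<le> 1" "norm (\<zeta>' k x) \<le> 4 * a k" for k x
    unfolding \<zeta>_def \<zeta>'_def using compact_C1_cutoff[of "real (Suc k)"] cutoff_bounds[of "real (Suc k)" x]
      cutoff'_bound[of "real (Suc k)" x] by (auto simp: a_def divide_inverse)
  define \<phi> where "\<phi> k x = \<zeta> k x * (\<zeta> k x * F x)" for k x
  define p where "p k x = \<zeta> k x *\<^sub>R G x + (2 * F x) *\<^sub>R \<zeta>' k x" for k x
  have \<phi>C: "compact_C1 (\<phi> k) (\<lambda>x. \<zeta> k x *\<^sub>R p k x)" for k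
  proof -
    have "compact_C1 (\<lambda>x. \<zeta> k x * (\<zeta> k x * F x))
       (\<lambda>x. \<zeta> k x *\<^sub>R (\<zeta> k x *\<^sub>R G x + F x *\<^sub>R \<zeta>' k x) + (\<zeta> k x * F x) *\<^sub>R \<zeta>' k x)"
      by (intro compact_C1_mult C1_mult C compact_C1_C1 \<zeta>)
    moreover have "(\<lambda>x. \<zeta> k x *\<^sub>R (\<zeta> k x *\<^sub>R G x + F x *\<^sub>R \<zeta>' k x) + (\<zeta> k x * F x) *\<^sub>R \<zeta>' k x) = (\<lambda>x. \<zeta> k x *\<^sub>R p k x)"
    proof
      fix x
      have "(\<zeta> k x * (2 * F x)) *\<^sub>R \<zeta>' k x = (\<zeta> k x * F x) *\<^sub>R \<zeta>' k x + (\<zeta> k x * F x) *\<^sub>R \<zeta>' k x"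
        by (simp add: scaleR_add_left[symmetric])
      then show "\<zeta> k x *\<^sub>R (\<zeta> k x *\<^sub>R G x + F x *\<^sub>R \<zeta>' k x) + (\<zeta> k x * F x) *\<^sub>R \<zeta>' k x = \<zeta> k x *\<^sub>R p k x"
        by (simp add: p_def scaleR_add_right)
    qed
    ultimately show ?thesis unfolding \<phi>_def[abs_def] by simp
  qed
  have \<phi>b: "0 \<le> \<phi> k x" "\<phi> k x \<le> F x" for k x
  proof -
    have "\<zeta> k x * \<zeta> k x \<le> 1" using \<zeta>(2,3)[of k x] by (simp add: mult_le_one)
    then show "0 \<le> \<phi> k x" "\<phi> k x \<le> F x"
      using pos[of x] \<zeta>(2)[of k x] unfolding \<phi>_def mult.assoc[symmetric] by (auto simp: mult_le_cancel_right1)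
  qed
  define Fk where "Fk k x = a k + \<phi> k x" for k x
  have Fkb: "0 < Fk k x" "Fk k x \<le> 1 + F x" for k x
    using a(1,2)[of k] \<phi>b[of k x] by (auto simp: Fk_def)
  have [measurable]: "Fk k \<in> borel_measurable borel" for k
    unfolding Fk_def[abs_def] \<phi>_def[abs_def] by measurable
  have FkF: "(\<lambda>k. Fk k x) \<longlonglongrightarrow> F x" for x
  proof -
    have "(\<lambda>k. Fk k x) \<longlonglongrightarrow> 0 + 1 * (1 * F x)"
      unfolding Fk_def \<phi>_def \<zeta>_def by (intro tendsto_intros a0 cutoff_tendsto)
    then show ?thesis by simp
  qed
  have L1: "(\<lambda>k. \<integral>x. Fk k x \<partial>M) \<longlonglongrightarrow> m"
    unfolding m_def
    by (rule integral_dominated_convergence[OF _ _ i1]) (use FkF bound(2)[OF Fkb] in auto)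
  have L2: "(\<lambda>k. \<integral>x. Fk k x * ln (Fk k x) \<partial>M) \<longlonglongrightarrow> (\<integral>x. F x * ln (F x) \<partial>M)"
  proof (rule integral_dominated_convergence[OF _ _ i1])
    show "AE x in M. (\<lambda>k. Fk k x * ln (Fk k x)) \<longlonglongrightarrow> F x * ln (F x)"
      using FkF pos by (intro AE_I2 tendsto_intros) (auto simp: less_imp_neq[symmetric])
  qed (use bound(1)[OF Fkb] in auto)
  have energy: "(\<integral>x. (norm (\<zeta> k x *\<^sub>R p k x))\<^sup>2 / Fk k x \<partial>M) \<le> (1 + a k) * J + 128 * a k * m" for k
  proof -
    have le: "(norm (\<zeta> k x *\<^sub>R p k x))\<^sup>2 / Fk k x \<le> (1 + a k) * ((norm (G x))\<^sup>2 / F x) + 128 * a k * F x" for x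
    proof -
      have p1: "(norm (\<zeta> k x *\<^sub>R p k x))\<^sup>2 / Fk k x \<le> (norm (p k x))\<^sup>2 / F x"
      proof (cases "\<zeta> k x = 0")
        case True then show ?thesis using pos[of x] by simp
      next
        case False
        then have "\<phi> k x > 0" using pos[of x] \<zeta>(2)[of k x] by (simp add: \<phi>_def less_le)
        then have "(norm (\<zeta> k x *\<^sub>R p k x))\<^sup>2 / Fk k x \<le> (norm (\<zeta> k x *\<^sub>R p k x))\<^sup>2 / \<phi> k x"
          using a[of k] Fkb[of k x] by (intro divide_left_mono) (auto simp: Fk_def)
        also have "\<dots> = (norm (p k x))\<^sup>2 / F x"
          using False pos[of x] by (simp add: \<phi>_def power_mult_distrib power2_eq_square field_simps)
        finally show ?thesis .
      qed
      \<comment> \<open>Young's inequality with weight a_k: the factor 1 / a_k on the cutoff term is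
        beaten by the square of |\<zeta>_k'| <= 4 a_k, leaving an error of order a_k.\<close>
      have "(norm (p k x))\<^sup>2 \<le> (1 + a k) * (norm (\<zeta> k x *\<^sub>R G x))\<^sup>2 + (1 + 1 / a k) * (norm ((2 * F x) *\<^sub>R \<zeta>' k x))\<^sup>2"
        unfolding p_def by (rule norm_add_sq_le[OF a(1)])
      also have "\<dots> \<le> (1 + a k) * (norm (G x))\<^sup>2 + (1 + 1 / a k) * (2 * F x * (4 * a k))\<^sup>2"
        using a(1)[of k] \<zeta>(2-4)[of k x] pos[of x]
        by (intro add_mono mult_left_mono power_mono) (auto simp: mult_left_le_one_le)
      also have "(1 + 1 / a k) * (2 * F x * (4 * a k))\<^sup>2 = 64 * (a k + (a k)\<^sup>2) * (F x)\<^sup>2"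
        using a(1)[of k] by (simp add: power2_eq_square field_simps)
      also have "\<dots> \<le> 128 * a k * (F x)\<^sup>2"
      proof -
        have "(a k)\<^sup>2 \<le> a k" using a(1,2)[of k] by (simp add: power2_eq_square mult_left_le_one_le)
        then show ?thesis by (intro mult_right_mono) auto
      qed
      finally have "(norm (p k x))\<^sup>2 / F x \<le> ((1 + a k) * (norm (G x))\<^sup>2 + 128 * a k * (F x)\<^sup>2) / F x"
        using pos[of x] by (intro divide_right_mono) auto
      also have "\<dots> = (1 + a k) * ((norm (G x))\<^sup>2 / F x) + 128 * a k * F x"
        using pos[of x] by (simp add: add_divide_distrib power2_eq_square)
      finally show ?thesis using p1 by linarith
    qed
    have "(\<integral>x. (norm (\<zeta> k x *\<^sub>R p k x))\<^sup>2 / Fk k x \<partial>M) \<le> (\<integral>x. (1 + a k) * ((norm (G x))\<^sup>2 / F x) + 128 * a k * F x \<partial>M)"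
    proof (rule integral_mono')
      show "integrable M (\<lambda>x. (1 + a k) * ((norm (G x))\<^sup>2 / F x) + 128 * a k * F x)"
        by (intro Bochner_Integration.integrable_add integrable_mult_right I iF)
      show "0 \<le> (1 + a k) * ((norm (G x))\<^sup>2 / F x) + 128 * a k * F x" for x
        using a(1)[of k] pos[of x] by (intro add_nonneg_nonneg mult_nonneg_nonneg divide_nonneg_nonneg) auto
    qed (rule le)
    also have "\<dots> = (\<integral>x. (1 + a k) * ((norm (G x))\<^sup>2 / F x) \<partial>M) + (\<integral>x. 128 * a k * F x \<partial>M)"
      by (intro Bochner_Integration.integral_add integrable_mult_right I iF)
    finally show ?thesis by (simp add: J_def m_def del: times_divide_eq_right)
  qed
  have "(\<integral>x. Fk k x * ln (Fk k x) \<partial>M)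
      \<le> (\<integral>x. Fk k x \<partial>M) * ln (\<integral>x. Fk k x \<partial>M) + \<beta> / 2 * ((1 + a k) * J + 128 * a k * m)" for k
  proof -
    have "(\<integral>x. Fk k x * ln (Fk k x) \<partial>M)
      \<le> (\<integral>x. Fk k x \<partial>M) * ln (\<integral>x. Fk k x \<partial>M) + \<beta> / 2 * (\<integral>x. (norm (\<zeta> k x *\<^sub>R p k x))\<^sup>2 / Fk k x \<partial>M)"
      unfolding Fk_def M_def by (rule log_sobolev_compact[OF \<phi>C \<phi>b(1) a(1) \<beta>])
    moreover have "\<beta> / 2 * (\<integral>x. (norm (\<zeta> k x *\<^sub>R p k x))\<^sup>2 / Fk k x \<partial>M) \<le> \<beta> / 2 * ((1 + a k) * J + 128 * a k * m)"
      using \<beta> by (intro mult_left_mono energy) auto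
    ultimately show ?thesis by linarith
  qed
  moreover have "(\<lambda>k. (\<integral>x. Fk k x \<partial>M) * ln (\<integral>x. Fk k x \<partial>M) + \<beta> / 2 * ((1 + a k) * J + 128 * a k * m))
     \<longlonglongrightarrow> m * ln m + \<beta> / 2 * ((1 + 0) * J + 128 * 0 * m)"
    using m by (intro tendsto_intros L1 a0) auto
  ultimately have "(\<integral>x. F x * ln (F x) \<partial>M) \<le> m * ln m + \<beta> / 2 * ((1 + 0) * J + 128 * 0 * m)"
    by (intro LIMSEQ_le[OF L2]) auto
  then show "(\<integral>x. F x * ln (F x) \<partial>M) \<le> (\<integral>x. F x \<partial>M) * ln (\<integral>x. F x \<partial>M) + \<beta> / 2 * (\<integral>x. (norm (G x))\<^sup>2 / F x \<partial>M)"
    by (simp add: m_def J_def)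
qed

section \<open>Integration by parts on the whole space\<close>

lemma cutoff_integral_tendsto:
  fixes q :: "real^'n \<Rightarrow> real"
  assumes q: "integrable lborel q"
  shows "integrable lborel (\<lambda>x. cutoff (real (Suc k)) x * q x)"
    and "(\<lambda>k. LBINT x. cutoff (real (Suc k)) x * q x) \<longlonglongrightarrow> (LBINT x. q x)"
proof -
  note [measurable] = borel_measurable_integrable[OF q]
  have le: "norm (cutoff (real (Suc k)) x * q x) \<le> norm (q x)" for k x
    using cutoff_bounds[of "real (Suc k)" x] by (simp add: abs_mult mult_left_le_one_le)
  have m: "(\<lambda>x. cutoff (real (Suc k)) x * q x) \<in> borel_measurable lborel" for k
    by measurable
  show "integrable lborel (\<lambda>x. cutoff (real (Suc k)) x * q x)"
    by (rule Bochner_Integration.integrable_bound[OF q m]) (use le in auto)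
  show "(\<lambda>k. LBINT x. cutoff (real (Suc k)) x * q x) \<longlonglongrightarrow> (LBINT x. q x)"
  proof (rule integral_dominated_convergence[OF _ _ integrable_norm[OF q]])
    show "AE x in lborel. (\<lambda>k. cutoff (real (Suc k)) x * q x) \<longlonglongrightarrow> q x"
      using tendsto_mult_right[OF cutoff_tendsto] by fastforce
  qed (use le m in auto)
qed

lemma cutoff'_integral_tendsto:
  fixes p :: "real^'n \<Rightarrow> real^'n"
  assumes D: "integrable lborel D" and p [measurable]: "p \<in> borel_measurable borel"
    and le: "\<And>k x. \<bar>p x \<bullet> cutoff' (real (Suc k)) x\<bar> \<le> D x"
  shows "integrable lborel (\<lambda>x. p x \<bullet> cutoff' (real (Suc k)) x)"
    and "(\<lambda>k. LBINT x. p x \<bullet> cutoff' (real (Suc k)) x) \<longlonglongrightarrow> 0"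
proof -
  have m: "(\<lambda>x. p x \<bullet> cutoff' (real (Suc k)) x) \<in> borel_measurable lborel" for k
    by measurable
  show "integrable lborel (\<lambda>x. p x \<bullet> cutoff' (real (Suc k)) x)"
    by (rule Bochner_Integration.integrable_bound[OF D m]) (use le in \<open>auto intro: order_trans[OF _ abs_ge_self]\<close>)
  have "(\<lambda>k. LBINT x. p x \<bullet> cutoff' (real (Suc k)) x) \<longlonglongrightarrow> integral\<^sup>L lborel (\<lambda>x :: real^'n. 0)"
  proof (rule integral_dominated_convergence[OF _ _ D])
    show "AE x in lborel. (\<lambda>k. p x \<bullet> cutoff' (real (Suc k)) x) \<longlonglongrightarrow> 0"
      using tendsto_inner[OF tendsto_const cutoff'_tendsto] by fastforce
  qed (use le m in auto)
  then show "(\<lambda>k. LBINT x. p x \<bullet> cutoff' (real (Suc k)) x) \<longlonglongrightarrow> 0" by simp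
qed

text \<open>Below, \<open>v\<close> is the gradient of \<open>ln w\<close>, so that \<open>\<integral> \<bar>v\<bar>\<^sup>2 w\<close> is the Fisher
  information of \<open>w\<close>.\<close>

lemma integral_x_score:
  fixes w :: "real^'n \<Rightarrow> real" and v :: "real^'n \<Rightarrow> real^'n"
  assumes C: "C1 w (\<lambda>x. w x *\<^sub>R v x)" and pos: "\<And>x. w x > 0"
    and iw: "integrable lborel w" and ix: "integrable lborel (\<lambda>x. w x * (x \<bullet> v x))"
  shows "(LBINT x. w x * (x \<bullet> v x)) = - real CARD('n) * (LBINT x. w x)"
proof -
  let ?\<zeta> = "\<lambda>k. cutoff (real (Suc k)) :: real^'n \<Rightarrow> real"
  let ?\<zeta>' = "\<lambda>k. cutoff' (real (Suc k)) :: real^'n \<Rightarrow> real^'n"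
  note [measurable] = C1_measurable(1)[OF C]
  \<comment> \<open>On the support of the cutoff gradient |x| <= 2 R, so |x| times the bound 4 / R
    is at most 8 for every R. Integrability of w is then enough for domination.\<close>
  have b8: "\<bar>(w x *\<^sub>R x) \<bullet> ?\<zeta>' k x\<bar> \<le> w x * 8" for k x
  proof (cases "norm x > 2 * real (Suc k)")
    case False
    have "norm x * norm (?\<zeta>' k x) \<le> 2 * real (Suc k) * (4 / real (Suc k))"
      using False by (intro mult_mono cutoff'_bound) auto
    also have "\<dots> = 8" by (simp add: nonzero_divide_eq_eq)
    finally have "\<bar>x \<bullet> ?\<zeta>' k x\<bar> \<le> 8" using Cauchy_Schwarz_ineq2[of x "?\<zeta>' k x"] by simp
    then show ?thesis using pos[of x] by (simp add: abs_mult)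
  qed (use pos[of x] in \<open>simp add: cutoff'_eq_0\<close>)
  have CC: "compact_C1 (\<lambda>x. ?\<zeta> k x * w x) (\<lambda>x. ?\<zeta> k x *\<^sub>R (w x *\<^sub>R v x) + w x *\<^sub>R ?\<zeta>' k x)" for k
    by (intro compact_C1_mult C compact_C1_cutoff) simp
  note L1 = cutoff_integral_tendsto[OF ix] and L3 = cutoff_integral_tendsto(2)[OF iw]
  note L2 = cutoff'_integral_tendsto[where p = "\<lambda>x. w x *\<^sub>R x", OF integrable_mult_left[OF iw] _ b8]
  \<comment> \<open>Integration by parts against the identity field, whose divergence is n.\<close>
  have eq: "(LBINT x. ?\<zeta> k x * (w x * (x \<bullet> v x))) + (LBINT x. (w x *\<^sub>R x) \<bullet> ?\<zeta>' k x)
      = - real CARD('n) * (LBINT x. ?\<zeta> k x * w x)" for k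
  proof -
    have "trace (mat 1 :: real^'n^'n) = real CARD('n)" by (simp add: trace_def mat_def)
    moreover have "(LBINT x. (0 + mat 1 *v x) \<bullet> (?\<zeta> k x *\<^sub>R (w x *\<^sub>R v x) + w x *\<^sub>R ?\<zeta>' k x))
        = - (trace (mat 1 :: real^'n^'n) * (LBINT x. ?\<zeta> k x * w x))"
      by (rule integral_affine_inner_grad[OF CC])
    ultimately show ?thesis using L1(1)[of k] L2(1)[of k] by (simp add: inner_add_right mult.assoc)
  qed
  have "(\<lambda>k. (LBINT x. ?\<zeta> k x * (w x * (x \<bullet> v x))) + (LBINT x. (w x *\<^sub>R x) \<bullet> ?\<zeta>' k x))
      \<longlonglongrightarrow> (LBINT x. w x * (x \<bullet> v x)) + 0"
    by (intro tendsto_add L1(2) L2(2)) measurable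
  moreover have "(\<lambda>k. - real CARD('n) * (LBINT x. ?\<zeta> k x * w x)) \<longlonglongrightarrow> - real CARD('n) * (LBINT x. w x)"
    by (intro tendsto_mult tendsto_const L3)
  ultimately show ?thesis unfolding eq using LIMSEQ_unique by fastforce
qed

text \<open>\<open>flux_nonneg\<close> is applied to the field s v and the test function \<zeta> w,
  whose gradient is \<zeta> w v + w \<zeta>'; the cutoff term vanishes in the limit. The factor s
  makes one statement serve upper and lower bounds on the divergence of v.\<close>

lemma fisher_information_bound:
  fixes w :: "real^'n \<Rightarrow> real" and v :: "real^'n \<Rightarrow> real^'n"
  assumes C: "C1 w (\<lambda>x. w x *\<^sub>R v x)" and pos: "\<And>x. w x > 0"
    and iw: "integrable lborel w" and iJ: "integrable lborel (\<lambda>x. w x * (norm (v x))\<^sup>2)"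
    and v: "\<And>x. (v has_derivative (\<lambda>h. A x *v h)) (at x)"
    and div: "\<And>x. s * trace (A x) \<ge> c"
  shows "s * (LBINT x. w x * (norm (v x))\<^sup>2) \<le> - c * (LBINT x. w x)"
proof -
  let ?\<zeta> = "\<lambda>k. cutoff (real (Suc k)) :: real^'n \<Rightarrow> real"
  let ?\<zeta>' = "\<lambda>k. cutoff' (real (Suc k)) :: real^'n \<Rightarrow> real^'n"
  have "continuous_on UNIV v"
    by (rule continuous_at_imp_continuous_on) (use has_derivative_continuous[OF v] in blast)
  then have [measurable]: "v \<in> borel_measurable borel" by (rule borel_measurable_continuous_onI)
  note [measurable] = C1_measurable(1)[OF C]
  have b4: "\<bar>(w x *\<^sub>R v x) \<bullet> ?\<zeta>' k x\<bar> \<le> 4 * w x + 4 * (w x * (norm (v x))\<^sup>2)" for k x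
  proof -
    have "norm (?\<zeta>' k x) \<le> 4 / real (Suc k)" by (rule cutoff'_bound) simp
    also have "\<dots> \<le> 4" by (simp add: field_simps)
    finally have "norm (v x) * norm (?\<zeta>' k x) \<le> norm (v x) * 4" by (intro mult_left_mono) auto
    moreover have "norm (v x) \<le> 1 + (norm (v x))\<^sup>2"
      using zero_le_power2[of "norm (v x) - 1 / 2"] by (simp add: power2_eq_square algebra_simps)
    ultimately have "norm (v x) * norm (?\<zeta>' k x) \<le> 4 * (1 + (norm (v x))\<^sup>2)" by simp
    with Cauchy_Schwarz_ineq2 have "\<bar>v x \<bullet> ?\<zeta>' k x\<bar> \<le> 4 * (1 + (norm (v x))\<^sup>2)" by (rule order_trans)
    then have "w x * \<bar>v x \<bullet> ?\<zeta>' k x\<bar> \<le> w x * (4 * (1 + (norm (v x))\<^sup>2))"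
      using pos[of x] by (intro mult_left_mono) auto
    then show ?thesis using pos[of x] by (simp add: abs_mult algebra_simps)
  qed
  have CC: "compact_C1 (\<lambda>x. ?\<zeta> k x * w x) (\<lambda>x. ?\<zeta> k x *\<^sub>R (w x *\<^sub>R v x) + w x *\<^sub>R ?\<zeta>' k x)" for k
    by (intro compact_C1_mult C compact_C1_cutoff) simp
  have dom: "integrable lborel (\<lambda>x. 4 * w x + 4 * (w x * (norm (v x))\<^sup>2))" using iw iJ by simp
  note L1 = cutoff_integral_tendsto[OF iJ] and L3 = cutoff_integral_tendsto(2)[OF iw]
  note L2 = cutoff'_integral_tendsto[where p = "\<lambda>x. w x *\<^sub>R v x", OF dom _ b4]
  have le: "s * ((LBINT x. ?\<zeta> k x * (w x * (norm (v x))\<^sup>2)) + (LBINT x. (w x *\<^sub>R v x) \<bullet> ?\<zeta>' k x))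
      \<le> - c * (LBINT x. ?\<zeta> k x * w x)" for k
  proof -
    have "0 \<le> flux (\<lambda>x. s *\<^sub>R v x) c (\<lambda>x. ?\<zeta> k x * w x)"
    proof (rule flux_nonneg[OF _ _ CC, of _ "\<lambda>x. s *\<^sub>R A x"])
      show "((\<lambda>x. s *\<^sub>R v x) has_derivative (\<lambda>h. (s *\<^sub>R A x) *v h)) (at x)" for x
        using has_derivative_scaleR_right[OF v, of s x] by (simp add: scaleR_matrix_vector_assoc)
      show "c \<le> trace (s *\<^sub>R A x)" for x using div[of x] by (simp add: trace_def sum_distrib_left)
      show "0 \<le> ?\<zeta> k x * w x" for x by (intro mult_nonneg_nonneg cutoff_bounds less_imp_le pos)
    qed
    moreover have "(LBINT x. s *\<^sub>R v x \<bullet> (?\<zeta> k x *\<^sub>R (w x *\<^sub>R v x) + w x *\<^sub>R ?\<zeta>' k x))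
       = s * ((LBINT x. ?\<zeta> k x * (w x * (norm (v x))\<^sup>2)) + (LBINT x. (w x *\<^sub>R v x) \<bullet> ?\<zeta>' k x))"
    proof -
      have "(LBINT x. s *\<^sub>R v x \<bullet> (?\<zeta> k x *\<^sub>R (w x *\<^sub>R v x) + w x *\<^sub>R ?\<zeta>' k x))
        = (LBINT x. s * (?\<zeta> k x * (w x * (norm (v x))\<^sup>2) + (w x *\<^sub>R v x) \<bullet> ?\<zeta>' k x))"
        by (intro Bochner_Integration.integral_cong refl) (simp add: inner_add_right power2_norm_eq_inner algebra_simps)
      then show ?thesis using L1(1)[of k] L2(1)[of k] by simp
    qed
    ultimately show ?thesis
      by (simp only: flux_def C1_grad[OF compact_C1_C1[OF CC]])
  qed
  have "s * ((LBINT x. w x * (norm (v x))\<^sup>2) + 0) \<le> - c * (LBINT x. w x)"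
    by (rule LIMSEQ_le[OF tendsto_mult[OF tendsto_const tendsto_add[OF L1(2) L2(2)]] tendsto_mult[OF tendsto_const L3]])
       (use le in auto)
  then show ?thesis by simp
qed

subsection \<open>The deficit estimate\<close>

text \<open>Both the square root of w / \<gamma> and the quotient w /
  \<open>\<gamma>\<^sub>\<beta>\<close> have this form, with u = ln w.\<close>

lemma C1_exp_quadratic:
  fixes u :: "real^'n \<Rightarrow> real"
  assumes "C1 u v"
  shows "C1 (\<lambda>x. k * exp (s * (u x + b * (norm x)\<^sup>2))) (\<lambda>x. (k * exp (s * (u x + b * (norm x)\<^sup>2)) * s) *\<^sub>R (v x + (2 * b) *\<^sub>R x))"
proof -
  have "C1 (\<lambda>x. u x + b * (norm x)\<^sup>2) (\<lambda>x. v x + (b *\<^sub>R (2 *\<^sub>R x) + ((norm x)\<^sup>2) *\<^sub>R 0))"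
    by (intro C1_add C1_mult C1_const C1_norm_sq assms)
  then have "C1 (\<lambda>x. k * exp (s * (u x + b * (norm x)\<^sup>2)))
      (\<lambda>x. (k * (exp (s * (u x + b * (norm x)\<^sup>2)) * s)) *\<^sub>R (v x + (b *\<^sub>R (2 *\<^sub>R x) + ((norm x)\<^sup>2) *\<^sub>R 0)))"
    by (rule C1_compose) (auto intro!: derivative_eq_intros continuous_intros)
  then show ?thesis by (simp add: mult.assoc mult.commute[of b 2])
qed

text \<open>Jensen's inequality in tangent form: ln (c / h) <= c / h - 1, integrated against w. The
  choice c = m / A makes the affine terms 2 m - 2 c A cancel, so the integral of w ln h^2 is at
  least 2 m ln (m / A). A second use of ln t <= t - 1, at t = A^2 / m, trades the logarithm for m -
  A^2.\<close>

lemma entropy_ge_L1: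
  fixes w h :: "real^'n \<Rightarrow> real"
  assumes \<beta>: "\<beta> > 0" and h: "\<And>x. h x > 0" and w: "\<And>x. w x = gauss \<beta> x * (h x)\<^sup>2"
    and iw: "integrable lborel w" and ih: "integrable lborel (\<lambda>x. gauss \<beta> x * h x)"
    and ie: "integrable lborel (\<lambda>x. w x * ln ((h x)\<^sup>2))"
  defines "m \<equiv> \<integral>x. w x \<partial>lborel" and "A \<equiv> \<integral>x. gauss \<beta> x * h x \<partial>lborel"
  shows "m * ln m + m - A\<^sup>2 \<le> (LBINT x. w x * ln ((h x)\<^sup>2))"
proof -
  have wpos: "w x > 0" for x unfolding w by (intro mult_pos_pos zero_less_power h gauss_pos[OF \<beta>])
  have m: "m > 0" unfolding m_def by (rule integral_positive[OF iw wpos]) simp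
  have A: "A > 0" unfolding A_def by (rule integral_positive[OF ih mult_pos_pos[OF gauss_pos[OF \<beta>] h]]) simp
  define c where "c = m / A"
  have c: "c > 0" using m A by (simp add: c_def)
  have le: "w x * ln (c\<^sup>2) + 2 * w x - 2 * c * (gauss \<beta> x * h x) \<le> w x * ln ((h x)\<^sup>2)" for x
  proof -
    have "ln (c / h x) \<le> c / h x - 1" using c h[of x] by (intro ln_le_minus_one) auto
    then have "ln c - ln (h x) \<le> c / h x - 1" using c h[of x] by (simp add: ln_div)
    then have "w x * (2 * (ln c - ln (h x))) \<le> w x * (2 * (c / h x - 1))"
      using wpos[of x] by (intro mult_left_mono) auto
    moreover have "w x * (2 * (ln c - ln (h x))) = w x * ln (c\<^sup>2) - w x * ln ((h x)\<^sup>2)"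
      using c h[of x] by (simp add: ln_realpow algebra_simps)
    moreover have "w x * (2 * (c / h x - 1)) = 2 * c * (gauss \<beta> x * h x) - 2 * w x"
      using h[of x] by (simp add: w power2_eq_square right_diff_distrib)
    ultimately show ?thesis by linarith
  qed
  have "(LBINT x. w x * ln (c\<^sup>2) + 2 * w x - 2 * c * (gauss \<beta> x * h x)) \<le> (LBINT x. w x * ln ((h x)\<^sup>2))"
    using iw ih by (intro integral_mono ie le) auto
  moreover have "(LBINT x. w x * ln (c\<^sup>2) + 2 * w x - 2 * c * (gauss \<beta> x * h x)) = m * ln (c\<^sup>2) + 2 * m - 2 * c * A"
    unfolding m_def A_def using iw ih by simp
  moreover have "c * A = m" using A by (simp add: c_def)
  ultimately have 1: "m * ln (c\<^sup>2) \<le> (LBINT x. w x * ln ((h x)\<^sup>2))" by simp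
  have "ln (A\<^sup>2 / m) \<le> A\<^sup>2 / m - 1" using A m by (intro ln_le_minus_one) auto
  then have "2 * ln A - ln m \<le> A\<^sup>2 / m - 1" using A m by (simp add: ln_div ln_realpow)
  then have "m * (2 * ln A - ln m) \<le> m * (A\<^sup>2 / m - 1)" using m by (intro mult_left_mono) auto
  also have "\<dots> = A\<^sup>2 - m" using m by (simp add: right_diff_distrib)
  finally have "m * (2 * ln A - ln m) \<le> A\<^sup>2 - m" .
  moreover have "m * ln (c\<^sup>2) = m * ln m - m * (2 * ln A - ln m)"
    using A m by (simp add: c_def ln_realpow ln_div algebra_simps)
  ultimately show ?thesis using 1 by linarith
qed

theorem corollary6p4:
  fixes \<beta> :: real and f :: "real ^ 'n \<Rightarrow> real" and Df :: "real ^ 'n \<Rightarrow> real ^ 'n"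
  assumes "\<beta> > 0"
    and "f \<in> L2 gauss_measure"
    and "weak_gradient f Df"
    and "Df \<in> L2 gauss_measure"
    and "\<And>x. gauss 1 x * (f x)\<^sup>2 > 0"
    and "twice_differentiable (\<lambda>x. gauss 1 x * (f x)\<^sup>2)"
    and "(\<lambda>x. gauss 1 x * (f x)\<^sup>2) \<in> L2 (weighted (\<lambda>x. 1 / gauss \<beta> x))"
    and "\<beta> > 1 \<Longrightarrow> semi_log_subharmonic \<beta> (\<lambda>x. gauss 1 x * (f x)\<^sup>2)"
    and "\<beta> < 1 \<Longrightarrow> semi_log_concave \<beta> (\<lambda>x. gauss 1 x * (f x)\<^sup>2)"
  shows "1 / 2 * (1 + D_const CARD('n) \<beta>) * (\<integral>x. (f x)\<^sup>2 \<partial>gauss_measure)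
           - 1 / 2 * (\<integral>x. \<bar>f x\<bar> \<partial>gauss_measure)\<^sup>2
         \<le> (\<integral>x. (norm (Df x))\<^sup>2 \<partial>gauss_measure)"
proof -
  note \<beta> = assms(1)
  let ?n = "real CARD('n)"

  \<comment> \<open>The density w, its score v and the derivative of v\<close>
  define w where "w x = gauss 1 x * (f x)\<^sup>2" for x
  have wpos: "w x > 0" for x using assms(5) by (simp add: w_def)
  have tw: "twice_differentiable w" using assms(6) unfolding w_def[abs_def] .
  have Cw: "C1 w (grad w)" by (rule twice_differentiable_C1[OF tw])
  define u where "u x = ln (w x)" for x
  define v where "v x = (1 / w x) *\<^sub>R grad w x" for x
  have Cu: "C1 u v"
    unfolding u_def[abs_def] v_def[abs_def]
    by (rule C1_compose[OF Cw])
       (use wpos in \<open>auto intro!: derivative_eq_intros continuous_intros simp: less_imp_neq[symmetric]\<close>)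
  have gw: "grad w x = w x *\<^sub>R v x" for x using wpos[of x] by (simp add: v_def)
  have Cwv: "C1 w (\<lambda>x. w x *\<^sub>R v x)" using Cw unfolding gw[symmetric] .
  note [measurable] = C1_measurable[OF Cu] C1_measurable(1)[OF Cw]
  define H where "H x = hessian u x" for x
  have Hv: "(v has_derivative (\<lambda>h. H x *v h)) (at x)" for x
  proof -
    have "w differentiable at x" "grad w differentiable at x"
      using tw by (auto simp: twice_differentiable_def)
    then have "v differentiable at x"
      unfolding v_def[abs_def] using wpos[of x]
      by (intro derivative_intros differentiable_scaleR) auto
    then show ?thesis
      using jacobian_works[of v "at x"] unfolding H_def hessian_def C1_grad[OF Cu] by blast
  qed
  have fm [measurable]: "f \<in> borel_measurable borel" and Dm [measurable]: "Df \<in> borel_measurable borel"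
    and if2: "integrable gauss_measure (\<lambda>x. (f x)\<^sup>2)" and iD2: "integrable gauss_measure (\<lambda>x. (norm (Df x))\<^sup>2)"
    using assms(2,4) by (auto simp: L2_def cong: measurable_cong_sets)
  have iw: "integrable lborel w"
    using if2 unfolding w_def[abs_def] by (subst (asm) integrable_weighted_gauss) auto
  define m where "m = (LBINT x. w x)"
  have mf: "(\<integral>x. (f x)\<^sup>2 \<partial>gauss_measure) = m"
    unfolding m_def w_def by (rule integral_weighted_gauss) simp
  have g1: "gauss 1 x > 0" and gb: "gauss \<beta> x > 0" for x :: "real^'n"
    by (intro gauss_pos \<beta> zero_less_one)+
  have ln_gauss: "ln (gauss t x) = - (?n / 2 * ln (2 * pi * t)) - (norm x)\<^sup>2 / (2 * t)" if "t > 0" for t and x :: "real^'n"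
    using that unfolding gauss_def by (simp add: ln_mult ln_powr)

  \<comment> \<open>The function h = |f| and its energy\<close>
  \<comment> \<open>The square root of w / \<gamma>, written as an exponential so that its gradient
    (h / 2) (v + x) can be read off.\<close>
  define h where "h x = (2 * pi) powr (?n / 4) * exp (1 / 2 * (u x + 1 / 2 * (norm x)\<^sup>2))" for x
  have hpos: "h x > 0" for x by (simp add: h_def)
  have h2: "w x = gauss 1 x * (h x)\<^sup>2" for x
  proof -
    have "(h x)\<^sup>2 = (2 * pi) powr (?n / 2) * exp (u x + 1 / 2 * (norm x)\<^sup>2)"
    proof -
      have "(exp (1 / 2 * y))\<^sup>2 = exp y" for y :: real
        by (simp add: power2_eq_square exp_add[symmetric])
      moreover have "((2 * pi) powr (?n / 4))\<^sup>2 = (2 * pi) powr (?n / 2)"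
        by (simp add: power2_eq_square powr_add[symmetric])
      ultimately show ?thesis unfolding h_def power_mult_distrib by simp
    qed
    then show ?thesis
      using wpos[of x] unfolding gauss_def u_def
      by (simp add: exp_add exp_minus powr_minus) (simp add: field_simps)
  qed
  have fh: "\<bar>f x\<bar> = h x" for x
  proof -
    have "(f x)\<^sup>2 = (h x)\<^sup>2" using h2[of x] g1[of x] by (simp add: w_def)
    then show ?thesis using hpos[of x] by (metis abs_of_pos power2_eq_iff abs_minus_cancel)
  qed
  define hg where "hg x = (h x / 2) *\<^sub>R (v x + x)" for x
  have Ch: "C1 h hg"
    using C1_exp_quadratic[OF Cu, of "(2 * pi) powr (?n / 4)" "1 / 2" "1 / 2"]
    unfolding h_def[abs_def] hg_def[abs_def] by (simp add: h_def)
  have hg2: "gauss 1 x * (norm (hg x))\<^sup>2 = w x * (norm (v x + x))\<^sup>2 / 4" for x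
    using hpos[of x] by (simp add: hg_def h2 power_mult_distrib power_divide)
  have hD: "AE x in lborel. gauss 1 x * (norm (hg x))\<^sup>2 \<le> gauss 1 x * (norm (Df x))\<^sup>2"
    using norm_gradient_abs_le[OF assms(3) fm Dm Ch fh] by eventually_elim (simp add: gauss_nonneg mult_left_mono)
  have iD: "integrable lborel (\<lambda>x. gauss 1 x * (norm (Df x))\<^sup>2)"
    using iD2 by (subst (asm) integrable_weighted_gauss) auto
  have iS: "integrable lborel (\<lambda>x. w x * (norm (v x + x))\<^sup>2 / 4)"
    unfolding hg2[symmetric]
    by (rule Bochner_Integration.integrable_bound[OF iD])
       (use hD C1_measurable[OF Ch] in \<open>auto simp: gauss_nonneg\<close>)
  have energy: "(LBINT x. w x * (norm (v x + x))\<^sup>2 / 4) \<le> (\<integral>x. (norm (Df x))\<^sup>2 \<partial>gauss_measure)"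
  proof -
    have "(\<integral>x. (norm (Df x))\<^sup>2 \<partial>gauss_measure) = (LBINT x. gauss 1 x * (norm (Df x))\<^sup>2)"
      by (rule integral_weighted_gauss) simp
    then show ?thesis
      using integral_mono_AE[OF iS iD] hD unfolding hg2 by simp
  qed

  \<comment> \<open>The density F of w relative to the Gaussian of variance \<beta>, and
    integrability\<close>
  define F where "F x = (2 * pi * \<beta>) powr (?n / 2) * exp (1 * (u x + 1 / (2 * \<beta>) * (norm x)\<^sup>2))" for x
  define G where "G x = F x *\<^sub>R (v x + (1 / \<beta>) *\<^sub>R x)" for x
  have Fpos: "F x > 0" for x using \<beta> by (simp add: F_def)
  have CF: "C1 F G"
    using C1_exp_quadratic[OF Cu, of "(2 * pi * \<beta>) powr (?n / 2)" 1 "1 / (2 * \<beta>)"]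
    unfolding F_def[abs_def] G_def[abs_def] by (simp add: F_def)
  note [measurable] = C1_measurable[OF CF]
  have Fw: "gauss \<beta> x * F x = w x" for x
    using wpos[of x] \<beta> unfolding gauss_def F_def u_def
    by (simp add: exp_add exp_minus powr_minus) (simp add: field_simps)
  have lnF: "ln (F x) = ?n / 2 * ln (2 * pi * \<beta>) + u x + (norm x)\<^sup>2 / (2 * \<beta>)" for x
    using \<beta> unfolding F_def by (simp add: ln_mult ln_powr)
  have iF2': "integrable lborel (\<lambda>x. gauss \<beta> x * (F x)\<^sup>2)"
  proof -
    have m: "(\<lambda>x. 1 / gauss \<beta> x) \<in> borel_measurable borel" by measurable
    have "integrable (weighted (\<lambda>x. 1 / gauss \<beta> x)) (\<lambda>x. (norm (w x))\<^sup>2)"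
      using assms(7) unfolding w_def[abs_def] by (simp add: L2_def)
    then have "integrable lborel (\<lambda>x. (1 / gauss \<beta> x) *\<^sub>R (norm (w x))\<^sup>2)"
      unfolding weighted_def by (subst (asm) integrable_density) (use gb in \<open>auto simp: less_imp_le\<close>)
    moreover have "(1 / gauss \<beta> x) *\<^sub>R (norm (w x))\<^sup>2 = gauss \<beta> x * (F x)\<^sup>2" for x
      using gb[of x] unfolding Fw[of x, symmetric] by (simp add: power2_eq_square)
    ultimately show ?thesis by simp
  qed
  have iF2: "integrable (weighted (gauss \<beta>)) (\<lambda>x. (F x)\<^sup>2)"
    by (subst integrable_weighted_gauss) (use iF2' in auto)
  have i4: "integrable lborel (\<lambda>x::real^'n. gauss \<beta> x * norm x ^ 4)"
    using gauss_norm_moments(3)[OF \<beta>, where 'n = 'n] by (subst (asm) integrable_weighted_gauss) auto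
  \<comment> \<open>Since w is the Gaussian density times F, the bound F |x|^2 <= F^2 + |x|^4
    reduces this to the L^2 hypothesis and the fourth Gaussian moment.\<close>
  have ixx: "integrable lborel (\<lambda>x. w x * (norm x)\<^sup>2)"
  proof (rule Bochner_Integration.integrable_bound[OF Bochner_Integration.integrable_add[OF iF2' i4]])
    show "AE x in lborel. norm (w x * (norm x)\<^sup>2) \<le> norm (gauss \<beta> x * (F x)\<^sup>2 + gauss \<beta> x * norm x ^ 4)"
    proof (rule AE_I2)
      fix x
      have "0 \<le> (F x - (norm x)\<^sup>2)\<^sup>2" "0 \<le> (F x)\<^sup>2" "0 \<le> norm x ^ 4" by auto
      moreover have "(F x - (norm x)\<^sup>2)\<^sup>2 = (F x)\<^sup>2 - 2 * (F x * (norm x)\<^sup>2) + norm x ^ 4"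
        by (simp add: power2_diff power_mult[symmetric] mult.assoc)
      ultimately have "F x * (norm x)\<^sup>2 \<le> (F x)\<^sup>2 + norm x ^ 4" by linarith
      then have "gauss \<beta> x * (F x * (norm x)\<^sup>2) \<le> gauss \<beta> x * ((F x)\<^sup>2 + norm x ^ 4)"
        using gb[of x] by (intro mult_left_mono) auto
      then have "w x * (norm x)\<^sup>2 \<le> gauss \<beta> x * (F x)\<^sup>2 + gauss \<beta> x * norm x ^ 4"
        unfolding Fw[of x, symmetric] by (simp add: algebra_simps)
      then show "norm (w x * (norm x)\<^sup>2) \<le> norm (gauss \<beta> x * (F x)\<^sup>2 + gauss \<beta> x * norm x ^ 4)"
        using wpos[of x] by simp
    qed
  qed measurable
  \<comment> \<open>From v = (v + x) - x: the first term has finite energy, the second a finite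
    second moment.\<close>
  have iJ: "integrable lborel (\<lambda>x. w x * (norm (v x))\<^sup>2)"
  proof (rule Bochner_Integration.integrable_bound)
    show "integrable lborel (\<lambda>x. 8 * (w x * (norm (v x + x))\<^sup>2 / 4) + 2 * (w x * (norm x)\<^sup>2))"
      by (intro Bochner_Integration.integrable_add integrable_mult_right iS ixx)
    show "AE x in lborel. norm (w x * (norm (v x))\<^sup>2) \<le> norm (8 * (w x * (norm (v x + x))\<^sup>2 / 4) + 2 * (w x * (norm x)\<^sup>2))"
    proof (rule AE_I2)
      fix x
      have "(norm (v x + x + - x))\<^sup>2 \<le> (1 + 1) * (norm (v x + x))\<^sup>2 + (1 + 1 / 1) * (norm (- x))\<^sup>2"
        by (rule norm_add_sq_le) simp
      then have "w x * (norm (v x))\<^sup>2 \<le> w x * (2 * (norm (v x + x))\<^sup>2 + 2 * (norm x)\<^sup>2)"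
        using wpos[of x] by (intro mult_left_mono) auto
      then show "norm (w x * (norm (v x))\<^sup>2) \<le> norm (8 * (w x * (norm (v x + x))\<^sup>2 / 4) + 2 * (w x * (norm x)\<^sup>2))"
        using wpos[of x] by (simp add: algebra_simps)
    qed
  qed measurable
  have ixv: "integrable lborel (\<lambda>x. w x * (x \<bullet> v x))"
  proof (rule Bochner_Integration.integrable_bound)
    show "integrable lborel (\<lambda>x. w x * (norm x)\<^sup>2 + w x * (norm (v x))\<^sup>2)"
      by (intro Bochner_Integration.integrable_add ixx iJ)
    show "AE x in lborel. norm (w x * (x \<bullet> v x)) \<le> norm (w x * (norm x)\<^sup>2 + w x * (norm (v x))\<^sup>2)"
    proof (rule AE_I2)
      fix x
      have "0 \<le> (norm x - norm (v x))\<^sup>2" by simp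
      then have "2 * (norm x * norm (v x)) \<le> (norm x)\<^sup>2 + (norm (v x))\<^sup>2"
        by (simp add: power2_diff)
      moreover have "0 \<le> norm x * norm (v x)" by simp
      ultimately have "\<bar>x \<bullet> v x\<bar> \<le> (norm x)\<^sup>2 + (norm (v x))\<^sup>2"
        using Cauchy_Schwarz_ineq2[of x "v x"] by linarith
      then have "w x * \<bar>x \<bullet> v x\<bar> \<le> w x * ((norm x)\<^sup>2 + (norm (v x))\<^sup>2)"
        using wpos[of x] by (intro mult_left_mono) auto
      then show "norm (w x * (x \<bullet> v x)) \<le> norm (w x * (norm x)\<^sup>2 + w x * (norm (v x))\<^sup>2)"
        using wpos[of x] by (simp add: abs_mult distrib_left)
    qed
  qed measurable

  \<comment> \<open>Fisher information and second moment in the energy\<close>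
  define J M2 where "J = (LBINT x. w x * (norm (v x))\<^sup>2)" and "M2 = (LBINT x. w x * (norm x)\<^sup>2)"
  have X: "(LBINT x. w x * (x \<bullet> v x)) = - ?n * m"
    unfolding m_def by (rule integral_x_score[OF Cwv wpos iw ixv])
  \<comment> \<open>Used at t = 1 for the energy of h and at t = 1 / \<beta> for the energy term of
    F.\<close>
  have quad: "integrable lborel (\<lambda>x. w x * (norm (v x + t *\<^sub>R x))\<^sup>2)"
    "(LBINT x. w x * (norm (v x + t *\<^sub>R x))\<^sup>2) = J - 2 * t * (?n * m) + t\<^sup>2 * M2" for t
  proof -
    have e: "w x * (norm (v x + t *\<^sub>R x))\<^sup>2 = w x * (norm (v x))\<^sup>2 + 2 * t * (w x * (x \<bullet> v x)) + t\<^sup>2 * (w x * (norm x)\<^sup>2)" for x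
      unfolding power2_norm_eq_inner by (simp add: inner_simps inner_commute power2_eq_square algebra_simps)
    show "integrable lborel (\<lambda>x. w x * (norm (v x + t *\<^sub>R x))\<^sup>2)"
      unfolding e by (intro Bochner_Integration.integrable_add integrable_mult_right iJ ixv ixx)
    show "(LBINT x. w x * (norm (v x + t *\<^sub>R x))\<^sup>2) = J - 2 * t * (?n * m) + t\<^sup>2 * M2"
      unfolding e using iJ ixv ixx X by (simp add: J_def M2_def)
  qed
  have E1: "J / 4 - ?n * m / 2 + M2 / 4 \<le> (\<integral>x. (norm (Df x))\<^sup>2 \<partial>gauss_measure)"
    using energy quad(2)[of 1] by simp

  \<comment> \<open>The logarithmic Sobolev inequality for F\<close>
  have GF: "gauss \<beta> x * ((norm (G x))\<^sup>2 / F x) = w x * (norm (v x + (1 / \<beta>) *\<^sub>R x))\<^sup>2" for x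
    using Fpos[of x] unfolding G_def Fw[of x, symmetric] by (simp add: power_mult_distrib power2_eq_square)
  have iGF: "integrable (weighted (gauss \<beta>)) (\<lambda>x. (norm (G x))\<^sup>2 / F x)"
    by (subst integrable_weighted_gauss) (use quad(1)[of "1 / \<beta>"] GF in auto)
  note lsi = log_sobolev[OF CF Fpos \<beta> iF2 iGF]
  have iwF: "integrable lborel (\<lambda>x. w x * ln (F x))"
    using lsi(2) unfolding Fw[symmetric]
    by (subst (asm) integrable_weighted_gauss) (auto simp: mult.assoc)
  have iwu: "integrable lborel (\<lambda>x. w x * u x)"
  proof -
    have "integrable lborel (\<lambda>x. w x * ln (F x) - ?n / 2 * ln (2 * pi * \<beta>) * w x - 1 / (2 * \<beta>) * (w x * (norm x)\<^sup>2))"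
      by (intro Bochner_Integration.integrable_diff integrable_mult_right iwF iw ixx)
    then show ?thesis unfolding lnF by (simp add: algebra_simps)
  qed
  define E where "E = (LBINT x. w x * u x)"
  have wF: "(LBINT x. w x * ln (F x)) = ?n / 2 * ln (2 * pi * \<beta>) * m + E + M2 / (2 * \<beta>)"
  proof -
    have e: "w x * ln (F x) = ?n / 2 * ln (2 * pi * \<beta>) * w x + w x * u x + 1 / (2 * \<beta>) * (w x * (norm x)\<^sup>2)" for x
      unfolding lnF by (simp add: algebra_simps)
    have "(LBINT x. w x * ln (F x))
        = (LBINT x. ?n / 2 * ln (2 * pi * \<beta>) * w x) + (LBINT x. w x * u x) + (LBINT x. 1 / (2 * \<beta>) * (w x * (norm x)\<^sup>2))"
      unfolding e using iw iwu ixx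
      by (subst Bochner_Integration.integral_add; (intro Bochner_Integration.integrable_add integrable_mult_right)?; simp)+
    then show ?thesis by (simp add: m_def E_def M2_def)
  qed
  have LSI: "?n / 2 * ln (2 * pi * \<beta>) * m + E + M2 / (2 * \<beta>)
      \<le> m * ln m + \<beta> / 2 * (J - 2 * (1 / \<beta>) * (?n * m) + (1 / \<beta>)\<^sup>2 * M2)"
  proof -
    have "(\<integral>x. F x * ln (F x) \<partial>weighted (gauss \<beta>)) = (LBINT x. w x * ln (F x))"
      by (subst integral_weighted_gauss) (auto simp: Fw[symmetric] mult.assoc)
    moreover have "(\<integral>x. F x \<partial>weighted (gauss \<beta>)) = m"
      by (subst integral_weighted_gauss) (auto simp: Fw m_def)
    moreover have "(\<integral>x. (norm (G x))\<^sup>2 / F x \<partial>weighted (gauss \<beta>)) = (LBINT x. w x * (norm (v x + (1 / \<beta>) *\<^sub>R x))\<^sup>2)"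
      by (subst integral_weighted_gauss) (auto simp: GF simp del: times_divide_eq_right)
    ultimately show ?thesis using lsi(3) wF quad(2)[of "1 / \<beta>"] by simp
  qed

  \<comment> \<open>Comparison of J with n m / \<beta>\<close>
  have fisher: "0 \<le> (1 - \<beta>) * (J - ?n * m / \<beta>)"
  proof -
    consider "\<beta> > 1" | "\<beta> < 1" | "\<beta> = 1" by linarith
    then show ?thesis
    proof cases
      case 1
      have "laplacian u x \<ge> - (?n / \<beta>)" for x
        using assms(8)[OF 1] unfolding semi_log_subharmonic_def u_def[abs_def] w_def by blast
      \<comment> \<open>The bound is used with s = 1, c = - n / \<beta> here, and with s = -1, c = n
        / \<beta> when \<beta> < 1, so that both factors of the claim have the same sign.\<close>
      then have "1 * J \<le> - (- (?n / \<beta>)) * m"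
        unfolding J_def m_def
        by (intro fisher_information_bound[OF Cwv wpos iw iJ Hv]) (simp add: laplacian_def H_def)
      then show ?thesis using 1 by (intro mult_nonpos_nonpos) auto
    next
      case 2
      have c: "y \<bullet> (H x *v y) \<le> - (1 / \<beta>) * (y \<bullet> y)" for x y
        using assms(9)[OF 2] unfolding semi_log_concave_def H_def u_def[abs_def] w_def by blast
      \<comment> \<open>Evaluating the quadratic form at the coordinate vectors bounds the diagonal
        entries.\<close>
      have "trace (H x) \<le> - (?n / \<beta>)" for x
      proof -
        have "H x $ i $ i \<le> - (1 / \<beta>)" for i
          using c[of "axis i 1" x] by (simp add: matrix_vector_mult_basis column_def inner_axis' inner_axis_axis)
        then have "trace (H x) \<le> (\<Sum>i\<in>(UNIV::'n set). - (1 / \<beta>))" unfolding trace_def by (intro sum_mono)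
        then show ?thesis by simp
      qed
      then have "(-1) * J \<le> - (?n / \<beta>) * m"
        unfolding J_def m_def
        by (intro fisher_information_bound[OF Cwv wpos iw iJ Hv]) (simp add: minus_le_iff le_minus_iff)
      then show ?thesis using 2 by (intro mult_nonneg_nonneg) auto
    qed simp
  qed

  \<comment> \<open>The lower bound for the entropy of f^2\<close>
  have lnh: "ln ((h x)\<^sup>2) = ?n / 2 * ln (2 * pi) + u x + (norm x)\<^sup>2 / 2" for x
    unfolding h_def by (simp add: ln_realpow ln_mult ln_powr)
  have iwh: "integrable lborel (\<lambda>x. w x * ln ((h x)\<^sup>2))"
  proof -
    have "integrable lborel (\<lambda>x. ?n / 2 * ln (2 * pi) * w x + w x * u x + 1 / 2 * (w x * (norm x)\<^sup>2))"
      by (intro Bochner_Integration.integrable_add integrable_mult_right iw iwu ixx)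
    then show ?thesis unfolding lnh by (simp add: algebra_simps)
  qed
  have wh: "(LBINT x. w x * ln ((h x)\<^sup>2)) = ?n / 2 * ln (2 * pi) * m + E + M2 / 2"
  proof -
    have e: "w x * ln ((h x)\<^sup>2) = ?n / 2 * ln (2 * pi) * w x + w x * u x + 1 / 2 * (w x * (norm x)\<^sup>2)" for x
      unfolding lnh by (simp add: algebra_simps)
    have "(LBINT x. w x * ln ((h x)\<^sup>2))
        = (LBINT x. ?n / 2 * ln (2 * pi) * w x) + (LBINT x. w x * u x) + (LBINT x. 1 / 2 * (w x * (norm x)\<^sup>2))"
      unfolding e using iw iwu ixx
      by (subst Bochner_Integration.integral_add; (intro Bochner_Integration.integrable_add integrable_mult_right)?; simp)+
    then show ?thesis by (simp add: m_def E_def M2_def)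
  qed
  define A where "A = (\<integral>x. \<bar>f x\<bar> \<partial>gauss_measure)"
  have Ah: "A = (LBINT x. gauss 1 x * h x)"
    unfolding A_def fh[symmetric] by (rule integral_weighted_gauss) simp
  have igh: "integrable lborel (\<lambda>x. gauss 1 x * h x)"
  proof -
    interpret prob_space "gauss_measure :: (real^'n) measure" by (rule prob_space_gauss) simp
    have "integrable gauss_measure (\<lambda>x. 1 + (f x)\<^sup>2)" using if2 by simp
    then have "integrable gauss_measure (\<lambda>x. \<bar>f x\<bar>)"
    proof (rule Bochner_Integration.integrable_bound)
      show "AE x in gauss_measure. norm \<bar>f x\<bar> \<le> norm (1 + (f x)\<^sup>2)"
      proof (rule AE_I2)
        fix x
        have "0 \<le> (\<bar>f x\<bar> - 1 / 2)\<^sup>2" by simp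
        then have "\<bar>f x\<bar> \<le> (f x)\<^sup>2 + 1 / 4" by (simp add: power2_diff power_divide)
        then show "norm \<bar>f x\<bar> \<le> norm (1 + (f x)\<^sup>2)" by simp
      qed
    qed simp
    then show ?thesis unfolding fh[symmetric] by (subst (asm) integrable_weighted_gauss) auto
  qed
  have ENT: "m * ln m + m - A\<^sup>2 \<le> ?n / 2 * ln (2 * pi) * m + E + M2 / 2"
    using entropy_ge_L1[OF zero_less_one hpos h2 iw igh iwh]
    unfolding m_def[symmetric] Ah[symmetric] wh .

  \<comment> \<open>Combining the inequalities\<close>
  have lnb: "ln (2 * pi * \<beta>) = ln (2 * pi) + ln \<beta>" using \<beta> by (simp add: ln_mult)
  \<comment> \<open>The term M2 / (2 \<beta>) occurs on both sides of \<open>LSI\<close> and drops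
    out.\<close>
  have "\<beta> / 2 * (J - 2 * (1 / \<beta>) * (?n * m) + (1 / \<beta>)\<^sup>2 * M2) = \<beta> * J / 2 - ?n * m + M2 / (2 * \<beta>)"
    using \<beta> by (simp add: field_simps power2_eq_square)
  then have LSI': "?n / 2 * ln (2 * pi) * m + ?n / 2 * ln \<beta> * m + E \<le> m * ln m + \<beta> * J / 2 - ?n * m"
    using LSI unfolding lnb by (simp add: algebra_simps)
  have fisher': "0 \<le> J - ?n * m / \<beta> - \<beta> * J + ?n * m"
  proof -
    have "(1 - \<beta>) * (J - ?n * m / \<beta>) = J - ?n * m / \<beta> - \<beta> * J + ?n * m"
    proof -
      have "\<beta> * (?n * m / \<beta>) = ?n * m" using \<beta> by simp
      moreover have "(1 - \<beta>) * (J - k) = J - k - \<beta> * J + \<beta> * k" for k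
        by (simp add: algebra_simps)
      ultimately show ?thesis by presburger
    qed
    then show ?thesis using fisher by simp
  qed
  have "1 / 2 * (1 + D_const CARD('n) \<beta>) * m = m / 2 + (?n / 2 * ln \<beta> * m) / 2 - ?n * m / 4 + (?n * m / \<beta>) / 4"
    unfolding D_const_def by (simp add: field_simps)
  then have "1 / 2 * (1 + D_const CARD('n) \<beta>) * m - 1 / 2 * A\<^sup>2 \<le> J / 4 - ?n * m / 2 + M2 / 4"
  proof -
    \<comment> \<open>The conclusion is half of \<open>ENT\<close> plus half of \<open>LSI'\<close>
      plus a quarter of \<open>fisher'\<close>. Products are replaced by variables to make this a
      linear problem.\<close>
    have "d - 1 / 2 * A2 \<le> J / 4 - K / 2 + M2 / 4"
      if "d = m / 2 + L / 2 - K / 4 + k / 4" "T + m - A2 \<le> P + E + M2 / 2"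
        "P + L + E \<le> T + B / 2 - K" "0 \<le> J - k - B + K" for d L K k T A2 P B :: real
      using that by linarith
    from this[OF _ ENT LSI' fisher'] \<open>1 / 2 * (1 + D_const CARD('n) \<beta>) * m = _\<close>
    show ?thesis by blast
  qed
  then show ?thesis using E1 unfolding mf A_def by linarith
qed

end
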